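(* For $T>0$ and $\gamma>0$ let $\mathcal{F}_T: L^2(\omega_1)\to L^2(\omega)$ be the feedback law defined in the context. There are two positive constants $C_1$ and $C_2$, depending only on $\gamma_0$, $\Omega$, $\omega$, $\omega_1$ and $d$ (in particular not on $T$ or $\gamma$), such that for each $\gamma>0$ there is a function $\alpha:(0,+\infty)\to(0,+\infty)$ with $$ \alpha(T)\le\|\mathcal{F}_T\|\le e^{C_1(1+\frac1T)+\frac{\gamma_0T}{4}}\,e^{C_2(1+\frac1T)\gamma}\quad\text{for all }T>0, $$ where $\|\mathcal{F}_T\|=\|\mathcal{F}_T\|_{\mathcal{L}(L^2(\omega_1);L^2(\omega))}$, and $$ \alpha(T)=O(1/T)\ \text{ as }T\to0;\qquad \alpha(T)=O\big(e^{-\frac{\lambda_1T}{4}}\big)\ \text{ as }T\to+\infty. $$ Here $f(s)=O(g(s))$ as $s\to s_0$ means that $f$ and $g$ are of the same order as $s\to s_0$ (see context).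
   Context: Setting: $\Omega\subset\mathbb{R}^d$, $d\ge1$, is a bounded domain with $C^2$ boundary; $V\in L^\infty(\Omega)$ is a nonzero function and $\gamma_0=\|V\|_{L^\infty(\Omega)}$; $Ay=\Delta y-Vy$ with $D(A)=H_0^1(\Omega)\cap H^2(\Omega)$, generating the $C_0$-semigroup $e^{tA}$ on $L^2(\Omega)$; $\omega,\omega_1\subset\Omega$ are nonempty open subsets; $\mathbf{1}_\omega:L^2(\omega)\to L^2(\Omega)$ is the zero extension operator and $\mathbf{1}_\omega^*$ its adjoint (restriction to $\omega$); similarly $\mathbf{1}_{\omega_1},\mathbf{1}_{\omega_1}^*$. $\|\cdot\|,\langle\cdot,\cdot\rangle$ are the norm and inner product of $L^2(\Omega)$; $\|\cdot\|_\omega,\langle\cdot,\cdot\rangle_\omega$ (resp. $\|\cdot\|_{\omega_1},\langle\cdot,\cdot\rangle_{\omega_1}$) those of $L^2(\omega)$ (resp. $L^2(\omega_1)$). Solutions are mild solutions. The notation $f(s)=O(g(s))$ as $s\to s_0$ is used in the paper in the sense that $f$ and $g$ have the same order as $s\to s_0$, i.e. there are constants $0<c\le c'$ with $c\,g(s)\le f(s)\le c'g(s)$ for $s$ close to $s_0$. $\{\lambda_j\}_{j\ge1}$ are the eigenvalues of $-A$, ordered as $\lambda_1\le\lambda_2\le\cdots\le\lambda_m\le0<\lambda_{m+1}\le\cdots$, with corresponding eigenfunctions $\{\xi_j\}$ forming an orthonormal basis of $L^2(\Omega)$. It is assumed that $-A$ has at least one negative eigenvalue. $X_M=\mathrm{span}\{\xi_1,\dots,\xi_M\}$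 and $P_M$ is the orthogonal projection of $L^2(\Omega)$ onto $X_M$. The constant $\tilde C_1$: $\tilde C_1=C_0/2$, where $C_0>0$ is a fixed constant depending only on $\Omega,\omega,\omega_1$ (not on $V$) such that, for both $\hat\omega=\omega$ and $\hat\omega=\omega_1$, for every $M\in\mathbb{N}^+$ with $\lambda_M\ge0$ and every $\alpha\in\mathbb{R}^M$, one has $\alpha' B^{-1}\alpha\le e^{C_0(1+\gamma_0^{2/3}+\sqrt{\lambda_M})}|\alpha|^2$, where $B$ is the (positive definite) $M\times M$ matrix with entries $\int_{\hat\omega}\xi_i\xi_j\,dx$ and $|\cdot|$ is the Euclidean norm. Construction of $\mathcal{F}_T$: given $T>0$ and $\gamma>0$ let $\hat c_p=\max\{0,\lambda_{m+1}-3\gamma_0\}$; $N=\max\{j\in\mathbb{N}^+: \lambda_j<2\gamma+(\ln 9)/T\}$; $$C(\gamma,T)=\left(\frac{\tilde C_1+\sqrt{\tilde C_1^2+2T\big[\ln(9\sqrt N)+\tilde C_1(1+\gamma_0^{2/3})\big]+(4\gamma+3\gamma_0)T^2}}{T}\right)^2+\hat c_p;$$ $M=\max\{j\in\mathbb{N}^+:\lambda_j<C(\gamma,T)\}$; $\varepsilon_0=\frac{1}{9\sqrt N}e^{-(2\gamma+\frac32\gamma_0+\hat c_p)T}$. For $j=1,\dots,N$, let $f_j\in L^2(\omega)$ be the (unique) element of minimal norm $\|f\|_\omega$ among all $f\in L^2(\omega)$ such that the solution $y$ of $y'(t)-Ay(t)=\mathbf{1}_\omega f$ on $(0,T/2)$,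 $y(0)=\xi_j$ ($f$ being independent of time) satisfies $\|P_My(T/2)\|\le\varepsilon_0\|\xi_j\|$. Let $h_j\in L^2(\omega_1)$ be the (unique) element of minimal norm $\|h\|_{\omega_1}$ among all $h\in L^2(\omega_1)$ such that the solution $z$ of the impulse equation $z'(t)-Az(t)=0$ on $(0,T/2)\setminus\{T/4\}$, $z(0)=\xi_j$, $z(T/4)=z(T/4-)+\mathbf{1}_{\omega_1}h$ satisfies $\|P_Mz(T/2)\|\le\varepsilon_0\|\xi_j\|$. The feedback law is $$\mathcal{F}_T(v)=-\sum_{j=1}^N\langle\mathbf{1}_{\omega_1}v,\mathbf{1}_{\omega_1}h_j\rangle f_j,\qquad v\in L^2(\omega_1).$$ (It depends on $\gamma$ as well as on $T$.) *)

theory Defs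
  imports "HOL-Analysis.Analysis" "HOL-Probability.Essential_Supremum" "HOL-Library.Landau_Symbols"
begin

definition square_integrable :: "('a::euclidean_space \<Rightarrow> real) \<Rightarrow> bool" where
  "square_integrable f \<longleftrightarrow> f \<in> borel_measurable lebesgue \<and> integrable lebesgue (\<lambda>x. (f x)\<^sup>2)"

definition L2_rel :: "('a::euclidean_space \<Rightarrow> real) \<Rightarrow> ('a \<Rightarrow> real) \<Rightarrow> bool" where
  "L2_rel f g \<longleftrightarrow> square_integrable f \<and> square_integrable g \<and> (AE x in lebesgue. f x = g x)"

lemma square_integrable_0: "square_integrable (\<lambda>x. 0)"
  by (simp add: square_integrable_def)

lemma square_integrable_mult:
  assumes "square_integrable f" "square_integrable g"
  shows "integrable lebesgue (\<lambda>x. f x * g x)"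
proof -
  have [measurable]: "f \<in> borel_measurable lebesgue" "g \<in> borel_measurable lebesgue"
    using assms by (auto simp: square_integrable_def)
  have "integrable lebesgue (\<lambda>x. (f x)\<^sup>2 + (g x)\<^sup>2)"
    using assms by (auto simp: square_integrable_def)
  then show ?thesis
  proof (rule Bochner_Integration.integrable_bound)
    show "AE x in lebesgue. norm (f x * g x) \<le> norm ((f x)\<^sup>2 + (g x)\<^sup>2)"
    proof (rule AE_I2)
      fix x
      have "2 * (\<bar>f x\<bar> * \<bar>g x\<bar>) \<le> (f x)\<^sup>2 + (g x)\<^sup>2"
        using sum_squares_bound[of "\<bar>f x\<bar>" "\<bar>g x\<bar>"] by simp
      moreover have "0 \<le> \<bar>f x\<bar> * \<bar>g x\<bar>" by simp
      ultimately have "\<bar>f x\<bar> * \<bar>g x\<bar> \<le> (f x)\<^sup>2 + (g x)\<^sup>2" by linarith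
      then show "norm (f x * g x) \<le> norm ((f x)\<^sup>2 + (g x)\<^sup>2)"
        by (simp add: abs_mult)
    qed
  qed measurable
qed

lemma square_integrable_add:
  assumes "square_integrable f" "square_integrable g"
  shows "square_integrable (\<lambda>x. f x + g x)"
  using assms square_integrable_mult[OF assms]
  by (auto simp: square_integrable_def power2_sum mult.assoc)

lemma square_integrable_cmult:
  "square_integrable f \<Longrightarrow> square_integrable (\<lambda>x. c * f x)"
  by (auto simp: square_integrable_def power_mult_distrib)

lemma square_integrable_uminus:
  "square_integrable f \<Longrightarrow> square_integrable (\<lambda>x. - f x)"
  using square_integrable_cmult[of f "-1"] by simp

lemma square_integrable_diff:
  "square_integrable f \<Longrightarrow> square_integrable g \<Longrightarrow> square_integrable (\<lambda>x. f x - g x)"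
  using square_integrable_add[of f "\<lambda>x. - g x"] square_integrable_uminus[of g] by simp

lemma part_equivp_L2_rel: "part_equivp (L2_rel :: ('a::euclidean_space \<Rightarrow> real) \<Rightarrow> _)"
proof (rule part_equivpI)
  show "\<exists>f::'a \<Rightarrow> real. L2_rel f f"
    using square_integrable_0 by (auto simp: L2_rel_def)
  show "symp (L2_rel :: ('a \<Rightarrow> real) \<Rightarrow> _)"
    by (auto simp: symp_def L2_rel_def elim: eventually_mono)
  show "transp (L2_rel :: ('a \<Rightarrow> real) \<Rightarrow> _)"
    by (auto simp: transp_def L2_rel_def elim: eventually_elim2)
qed

quotient_type (overloaded) 'a L2 = "'a::euclidean_space \<Rightarrow> real" / partial: L2_rel
  morphisms fun_of L2_of
  by (rule part_equivp_L2_rel)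

instantiation L2 :: (euclidean_space) real_vector
begin

lift_definition zero_L2 :: "'a L2" is "\<lambda>x. 0"
  by (simp add: L2_rel_def square_integrable_0)

lift_definition plus_L2 :: "'a L2 \<Rightarrow> 'a L2 \<Rightarrow> 'a L2" is "\<lambda>f g x. f x + g x"
  by (auto simp: L2_rel_def square_integrable_add elim: eventually_elim2)

lift_definition minus_L2 :: "'a L2 \<Rightarrow> 'a L2 \<Rightarrow> 'a L2" is "\<lambda>f g x. f x - g x"
  by (auto simp: L2_rel_def square_integrable_diff elim: eventually_elim2)

lift_definition uminus_L2 :: "'a L2 \<Rightarrow> 'a L2" is "\<lambda>f x. - f x"
  by (auto simp: L2_rel_def square_integrable_uminus)

lift_definition scaleR_L2 :: "real \<Rightarrow> 'a L2 \<Rightarrow> 'a L2" is "\<lambda>c f x. c * f x"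
  by (auto simp: L2_rel_def square_integrable_cmult elim: eventually_mono)

instance
proof
  fix u v w :: "'a L2" and a b :: real
  show "u + v + w = u + (v + w)"
    by transfer (auto simp: L2_rel_def square_integrable_add add.assoc)
  show "u + v = v + u"
    by transfer (auto simp: L2_rel_def square_integrable_add add.commute)
  show "0 + u = u"
    by transfer (auto simp: L2_rel_def)
  show "- u + u = 0"
    by transfer (auto simp: L2_rel_def square_integrable_0)
  show "u - v = u + - v"
    by transfer (auto simp: L2_rel_def square_integrable_diff)
  show "a *\<^sub>R (u + v) = a *\<^sub>R u + a *\<^sub>R v"
    by transfer (auto simp: L2_rel_def square_integrable_add square_integrable_cmult distrib_left)
  show "(a + b) *\<^sub>R u = a *\<^sub>R u + b *\<^sub>R u"
    by transfer (auto simp: L2_rel_def square_integrable_add square_integrable_cmult distrib_right)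
  show "a *\<^sub>R b *\<^sub>R u = (a * b) *\<^sub>R u"
    by transfer (auto simp: L2_rel_def square_integrable_cmult mult.assoc)
  show "1 *\<^sub>R u = u"
    by transfer (auto simp: L2_rel_def)
qed

end

instantiation L2 :: (euclidean_space) real_inner
begin

lift_definition inner_L2 :: "'a L2 \<Rightarrow> 'a L2 \<Rightarrow> real" is "\<lambda>f g. \<integral>x. f x * g x \<partial>lebesgue"
proof -
  fix f f' g g' :: "'a \<Rightarrow> real"
  assume *: "L2_rel f f'" "L2_rel g g'"
  then have [measurable]: "f \<in> borel_measurable lebesgue" "f' \<in> borel_measurable lebesgue"
    "g \<in> borel_measurable lebesgue" "g' \<in> borel_measurable lebesgue"
    by (auto simp: L2_rel_def square_integrable_def)
  show "(\<integral>x. f x * g x \<partial>lebesgue) = (\<integral>x. f' x * g' x \<partial>lebesgue)"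
    using * by (intro integral_cong_AE) (auto simp: L2_rel_def elim: eventually_elim2)
qed

definition norm_L2 :: "'a L2 \<Rightarrow> real" where "norm_L2 u = sqrt (inner u u)"
definition sgn_L2 :: "'a L2 \<Rightarrow> 'a L2" where "sgn_L2 u = u /\<^sub>R norm u"
definition dist_L2 :: "'a L2 \<Rightarrow> 'a L2 \<Rightarrow> real" where "dist_L2 u v = norm (u - v)"
definition uniformity_L2 :: "('a L2 \<times> 'a L2) filter" where
  "uniformity_L2 = (INF e\<in>{0<..}. principal {(u, v). dist u v < e})"
definition open_L2 :: "'a L2 set \<Rightarrow> bool" where
  "open_L2 U \<longleftrightarrow> (\<forall>u\<in>U. \<forall>\<^sub>F (u', v) in uniformity. u' = u \<longrightarrow> v \<in> U)"

instance
proof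
  fix u v w :: "'a L2" and a :: real and U :: "'a L2 set"
  show "inner u v = inner v u"
    by transfer (simp add: mult.commute)
  show "inner (u + v) w = inner u w + inner v w"
    by transfer (auto simp: L2_rel_def distrib_right square_integrable_mult)
  show "inner (a *\<^sub>R u) v = a * inner u v"
    by transfer (auto simp: L2_rel_def mult.assoc)
  show "0 \<le> inner u u"
    by transfer (auto intro!: integral_nonneg_AE)
  show "inner u u = 0 \<longleftrightarrow> u = 0"
    by transfer
      (auto simp: L2_rel_def square_integrable_0 square_integrable_mult integral_nonneg_eq_0_iff_AE)
  show "norm u = sqrt (inner u u)" by (fact norm_L2_def)
  show "sgn u = u /\<^sub>R norm u" by (fact sgn_L2_def)
  show "dist u v = norm (u - v)" by (fact dist_L2_def)
  show "uniformity = (INF e\<in>{0<..}. principal {(u::'a L2, v). dist u v < e})"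
    by (fact uniformity_L2_def)
  show "open U \<longleftrightarrow> (\<forall>u\<in>U. \<forall>\<^sub>F (u', v) in uniformity. u' = u \<longrightarrow> v \<in> U)"
    by (fact open_L2_def)
qed

end

text \<open>
  For measurable $U$, the space $L^2(U)$ is identified, by extension by zero, with the subspace
  of $L^2(\mathbf{R}^d)$ of functions vanishing almost everywhere outside $U$. Norm and inner
  product are the same on both sides of this identification.
\<close>

definition L2_on :: "'a::euclidean_space set \<Rightarrow> 'a L2 set" where
  "L2_on U = {u. AE x in lebesgue. x \<notin> U \<longrightarrow> fun_of u x = 0}"

text \<open>
  Under this identification multiplication by the indicator function of $U$ is at once the zero
  extension operator on \<^term>\<open>L2_on U\<close> and its adjoint, the restriction to $U$.
\<close>

definition ind_op :: "'a::euclidean_space set \<Rightarrow> 'a L2 \<Rightarrow> 'a L2" where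
  "ind_op U u = L2_of (\<lambda>x. indicator U x * fun_of u x)"

definition Linf_on :: "'a::euclidean_space set \<Rightarrow> ('a \<Rightarrow> real) set" where
  "Linf_on U = {V \<in> borel_measurable (lebesgue_on U).
                  esssup (lebesgue_on U) (\<lambda>x. ereal \<bar>V x\<bar>) < \<infinity>}"

definition Linf_norm :: "'a::euclidean_space set \<Rightarrow> ('a \<Rightarrow> real) \<Rightarrow> real" where
  "Linf_norm U V = real_of_ereal (esssup (lebesgue_on U) (\<lambda>x. ereal \<bar>V x\<bar>))"

definition pderivative :: "'a::euclidean_space \<Rightarrow> ('a \<Rightarrow> real) \<Rightarrow> 'a \<Rightarrow> real" where
  "pderivative i f x = frechet_derivative f (at x) i"

fun Ck :: "nat \<Rightarrow> ('a::euclidean_space \<Rightarrow> real) \<Rightarrow> bool" where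
  "Ck 0 f \<longleftrightarrow> continuous_on UNIV f"
| "Ck (Suc k) f \<longleftrightarrow> (\<forall>x. f differentiable (at x)) \<and> (\<forall>i\<in>Basis. Ck k (pderivative i f))"

text \<open>
  Near each boundary point the set is, in suitable orthonormal coordinates, the region above the
  graph of a $C^2$ function. The last coordinate axis is spanned by the unit vector $\nu$;
  \<open>g\<close> is only evaluated on the hyperplane orthogonal to $\nu$.
\<close>

definition C2_boundary :: "'a::euclidean_space set \<Rightarrow> bool" where
  "C2_boundary U \<longleftrightarrow> (\<forall>p\<in>frontier U. \<exists>r>0. \<exists>\<nu> g. norm \<nu> = 1 \<and> Ck 2 g \<and>
     U \<inter> ball p r = {x \<in> ball p r. inner x \<nu> > g (x - inner x \<nu> *\<^sub>R \<nu>)})"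

definition bounded_C2_domain :: "'a::euclidean_space set \<Rightarrow> bool" where
  "bounded_C2_domain U \<longleftrightarrow> U \<noteq> {} \<and> open U \<and> connected U \<and> bounded U \<and> C2_boundary U"

definition test_functions :: "'a::euclidean_space set \<Rightarrow> ('a \<Rightarrow> real) set" where
  "test_functions U = {\<phi>. (\<forall>k. Ck k \<phi>) \<and> compact (closure {x. \<phi> x \<noteq> 0})
                           \<and> closure {x. \<phi> x \<noteq> 0} \<subseteq> U}"

definition has_weak_derivative ::
  "'a::euclidean_space set \<Rightarrow> 'a \<Rightarrow> 'a L2 \<Rightarrow> 'a L2 \<Rightarrow> bool" where
  "has_weak_derivative U i u g \<longleftrightarrow> g \<in> L2_on U \<and>
     (\<forall>\<phi>\<in>test_functions U.
        (\<integral>x. fun_of u x * pderivative i \<phi> x \<partial>lebesgue) = - (\<integral>x. fun_of g x * \<phi> x \<partial>lebesgue))"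

definition weak_derivative :: "'a::euclidean_space set \<Rightarrow> 'a \<Rightarrow> 'a L2 \<Rightarrow> 'a L2" where
  "weak_derivative U i u = (THE g. has_weak_derivative U i u g)"

definition H1 :: "'a::euclidean_space set \<Rightarrow> 'a L2 set" where
  "H1 U = {u \<in> L2_on U. \<forall>i\<in>Basis. \<exists>g. has_weak_derivative U i u g}"

definition H2 :: "'a::euclidean_space set \<Rightarrow> 'a L2 set" where
  "H2 U = {u \<in> H1 U. \<forall>i\<in>Basis. weak_derivative U i u \<in> H1 U}"

definition H10 :: "'a::euclidean_space set \<Rightarrow> 'a L2 set" where
  "H10 U = {u \<in> H1 U. \<exists>\<phi>::nat \<Rightarrow> 'a \<Rightarrow> real. (\<forall>n. \<phi> n \<in> test_functions U) \<and>
     (\<lambda>n. L2_of (\<phi> n)) \<longlonglongrightarrow> u \<and>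
     (\<forall>i\<in>Basis. (\<lambda>n. L2_of (pderivative i (\<phi> n))) \<longlonglongrightarrow> weak_derivative U i u)}"

definition laplacian :: "'a::euclidean_space set \<Rightarrow> 'a L2 \<Rightarrow> 'a L2" where
  "laplacian U u = (\<Sum>i\<in>Basis. weak_derivative U i (weak_derivative U i u))"

definition mult_op :: "'a::euclidean_space set \<Rightarrow> ('a \<Rightarrow> real) \<Rightarrow> 'a L2 \<Rightarrow> 'a L2" where
  "mult_op U V u = L2_of (\<lambda>x. indicator U x * (V x * fun_of u x))"

definition dom_A :: "'a::euclidean_space set \<Rightarrow> 'a L2 set" where
  "dom_A \<Omega> = H10 \<Omega> \<inter> H2 \<Omega>"

definition op_A :: "'a::euclidean_space set \<Rightarrow> ('a \<Rightarrow> real) \<Rightarrow> 'a L2 \<Rightarrow> 'a L2" where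
  "op_A \<Omega> V y = laplacian \<Omega> y - mult_op \<Omega> V y"

text \<open>Sequences are indexed from 1; the values at index 0 are irrelevant.\<close>

definition eigensystem ::
  "'a::euclidean_space set \<Rightarrow> ('a \<Rightarrow> real) \<Rightarrow> (nat \<Rightarrow> real) \<Rightarrow> (nat \<Rightarrow> 'a L2) \<Rightarrow> bool" where
  "eigensystem \<Omega> V lam \<xi> \<longleftrightarrow>
     (\<forall>j\<ge>1. \<xi> j \<in> dom_A \<Omega> \<and> - op_A \<Omega> V (\<xi> j) = lam j *\<^sub>R \<xi> j) \<and>
     (\<forall>i\<ge>1. \<forall>j\<ge>i. lam i \<le> lam j) \<and>
     (\<forall>i\<ge>1. \<forall>j\<ge>1. inner (\<xi> i) (\<xi> j) = (if i = j then 1 else 0)) \<and>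
     closure (span (\<xi> ` {1..})) = L2_on \<Omega>"

definition standing_assumptions ::
  "'a::euclidean_space set \<Rightarrow> ('a \<Rightarrow> real) \<Rightarrow> (nat \<Rightarrow> real) \<Rightarrow> (nat \<Rightarrow> 'a L2) \<Rightarrow> bool" where
  "standing_assumptions \<Omega> V lam \<xi> \<longleftrightarrow>
     V \<in> Linf_on \<Omega> \<and> \<not> (AE x in lebesgue_on \<Omega>. V x = 0) \<and>
     eigensystem \<Omega> V lam \<xi> \<and> (\<exists>j\<ge>1. lam j < 0)"

text \<open>Semigroups on a closed subspace \<open>X\<close>; only the values \<open>S t u\<close> with \<open>t \<ge> 0\<close>, \<open>u \<in> X\<close> matter.\<close>

definition C0_semigroup_on :: "'b::real_normed_vector set \<Rightarrow> (real \<Rightarrow> 'b \<Rightarrow> 'b) \<Rightarrow> bool" where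
  "C0_semigroup_on X S \<longleftrightarrow>
     (\<forall>t\<ge>0. S t ` X \<subseteq> X \<and>
        (\<forall>u\<in>X. \<forall>v\<in>X. \<forall>a b. S t (a *\<^sub>R u + b *\<^sub>R v) = a *\<^sub>R S t u + b *\<^sub>R S t v) \<and>
        (\<exists>K. \<forall>u\<in>X. norm (S t u) \<le> K * norm u)) \<and>
     (\<forall>u\<in>X. S 0 u = u) \<and>
     (\<forall>s\<ge>0. \<forall>t\<ge>0. \<forall>u\<in>X. S (s + t) u = S s (S t u)) \<and>
     (\<forall>u\<in>X. ((\<lambda>t. S t u) \<longlongrightarrow> u) (at_right 0))"

definition generates_semigroup ::
  "'b::real_normed_vector set \<Rightarrow> 'b set \<Rightarrow> ('b \<Rightarrow> 'b) \<Rightarrow> (real \<Rightarrow> 'b \<Rightarrow> 'b) \<Rightarrow> bool" where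
  "generates_semigroup X D A S \<longleftrightarrow> C0_semigroup_on X S \<and>
     D = {u \<in> X. \<exists>w. ((\<lambda>h. (S h u - u) /\<^sub>R h) \<longlongrightarrow> w) (at_right 0)} \<and>
     (\<forall>u\<in>D. ((\<lambda>h. (S h u - u) /\<^sub>R h) \<longlongrightarrow> A u) (at_right 0))"

text \<open>
  The mild solution of $y' - Ay = b$, $y(0) = y_0$, and that of the impulse problem
  $z' - Az = 0$ away from $\tau$, $z(0) = z_0$, $z(\tau) = z(\tau-) + b$.
\<close>

definition mild_solution ::
  "(real \<Rightarrow> 'b::real_normed_vector \<Rightarrow> 'b) \<Rightarrow> 'b \<Rightarrow> (real \<Rightarrow> 'b) \<Rightarrow> real \<Rightarrow> 'b" where
  "mild_solution S y0 b t = S t y0 + integral {0..t} (\<lambda>s. S (t - s) (b s))"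

definition impulse_solution ::
  "(real \<Rightarrow> 'b::real_normed_vector \<Rightarrow> 'b) \<Rightarrow> 'b \<Rightarrow> real \<Rightarrow> 'b \<Rightarrow> real \<Rightarrow> 'b" where
  "impulse_solution S z0 \<tau> b t =
     (if t < \<tau> then S t z0 else S (t - \<tau>) (Lim (at_left \<tau>) (\<lambda>s. S s z0) + b))"

definition gram ::
  "(nat \<Rightarrow> 'a::euclidean_space L2) \<Rightarrow> 'a set \<Rightarrow> nat \<Rightarrow> nat \<Rightarrow> real" where
  "gram \<xi> U i j = (LINT x:U|lebesgue. fun_of (\<xi> i) x * fun_of (\<xi> j) x)"

text \<open>
  \<open>Binv\<close> is the inverse of the $M \times M$ Gram matrix with indices in \<open>{1..M}\<close>; for square
  matrices the one-sided equation suffices.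
\<close>

definition spectral_constant ::
  "'a::euclidean_space set \<Rightarrow> 'a set \<Rightarrow> 'a set \<Rightarrow> real \<Rightarrow> bool" where
  "spectral_constant \<Omega> \<omega> \<omega>1 C0 \<longleftrightarrow> C0 > 0 \<and>
     (\<forall>V lam \<xi>. standing_assumptions \<Omega> V lam \<xi> \<longrightarrow>
        (\<forall>U\<in>{\<omega>, \<omega>1}. \<forall>M\<ge>1. lam M \<ge> 0 \<longrightarrow>
           (\<exists>Binv :: nat \<Rightarrow> nat \<Rightarrow> real.
              (\<forall>i\<in>{1..M}. \<forall>j\<in>{1..M}.
                 (\<Sum>k=1..M. gram \<xi> U i k * Binv k j) = (if i = j then 1 else 0)) \<and>
              (\<forall>a :: nat \<Rightarrow> real.
                 (\<Sum>i=1..M. \<Sum>j=1..M. a i * Binv i j * a j)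
                   \<le> exp (C0 * (1 + Linf_norm \<Omega> V powr (2/3) + sqrt (lam M))) * (\<Sum>i=1..M. (a i)\<^sup>2)))))"

text \<open>This is the $m$ with $\lambda_m \le 0 < \lambda_{m+1}$; an eigenvalue 0 is counted.\<close>

definition nonpos_count :: "(nat \<Rightarrow> real) \<Rightarrow> nat" where
  "nonpos_count lam = Max {j. 1 \<le> j \<and> lam j \<le> 0}"

definition c_hat :: "(nat \<Rightarrow> real) \<Rightarrow> real \<Rightarrow> real" where
  "c_hat lam \<gamma>0 = max 0 (lam (nonpos_count lam + 1) - 3 * \<gamma>0)"

definition N_index :: "(nat \<Rightarrow> real) \<Rightarrow> real \<Rightarrow> real \<Rightarrow> nat" where
  "N_index lam \<gamma> T = Max {j. 1 \<le> j \<and> lam j < 2 * \<gamma> + ln 9 / T}"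

definition C_threshold :: "(nat \<Rightarrow> real) \<Rightarrow> real \<Rightarrow> real \<Rightarrow> real \<Rightarrow> real \<Rightarrow> real" where
  "C_threshold lam \<gamma>0 C0 \<gamma> T =
     (let C1 = C0 / 2 in
      ((C1 + sqrt (C1\<^sup>2 + 2 * T * (ln (9 * sqrt (real (N_index lam \<gamma> T))) + C1 * (1 + \<gamma>0 powr (2/3)))
                   + (4 * \<gamma> + 3 * \<gamma>0) * T\<^sup>2)) / T)\<^sup>2 + c_hat lam \<gamma>0)"

definition M_index :: "(nat \<Rightarrow> real) \<Rightarrow> real \<Rightarrow> real \<Rightarrow> real \<Rightarrow> real \<Rightarrow> nat" where
  "M_index lam \<gamma>0 C0 \<gamma> T = Max {j. 1 \<le> j \<and> lam j < C_threshold lam \<gamma>0 C0 \<gamma> T}"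

definition eps0 :: "(nat \<Rightarrow> real) \<Rightarrow> real \<Rightarrow> real \<Rightarrow> real \<Rightarrow> real" where
  "eps0 lam \<gamma>0 \<gamma> T =
     1 / (9 * sqrt (real (N_index lam \<gamma> T))) * exp (- (2 * \<gamma> + 3/2 * \<gamma>0 + c_hat lam \<gamma>0) * T)"

definition orth_proj :: "'b::real_inner set \<Rightarrow> 'b \<Rightarrow> 'b" where
  "orth_proj X u = (THE p. p \<in> X \<and> (\<forall>x\<in>X. inner (u - p) x = 0))"

definition P_proj :: "(nat \<Rightarrow> 'a::euclidean_space L2) \<Rightarrow> nat \<Rightarrow> 'a L2 \<Rightarrow> 'a L2" where
  "P_proj \<xi> M = orth_proj (span (\<xi> ` {1..M}))"

definition min_norm_element :: "'b::real_normed_vector set \<Rightarrow> 'b" where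
  "min_norm_element K = (THE f. f \<in> K \<and> (\<forall>g\<in>K. norm f \<le> norm g))"

definition f_control ::
  "'a::euclidean_space set \<Rightarrow> (nat \<Rightarrow> real) \<Rightarrow> (nat \<Rightarrow> 'a L2) \<Rightarrow> (real \<Rightarrow> 'a L2 \<Rightarrow> 'a L2)
     \<Rightarrow> real \<Rightarrow> real \<Rightarrow> real \<Rightarrow> real \<Rightarrow> nat \<Rightarrow> 'a L2" where
  "f_control \<omega> lam \<xi> S \<gamma>0 C0 \<gamma> T j = min_norm_element {f \<in> L2_on \<omega>.
     norm (P_proj \<xi> (M_index lam \<gamma>0 C0 \<gamma> T) (mild_solution S (\<xi> j) (\<lambda>_. ind_op \<omega> f) (T/2)))
       \<le> eps0 lam \<gamma>0 \<gamma> T * norm (\<xi> j)}"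

definition h_control ::
  "'a::euclidean_space set \<Rightarrow> (nat \<Rightarrow> real) \<Rightarrow> (nat \<Rightarrow> 'a L2) \<Rightarrow> (real \<Rightarrow> 'a L2 \<Rightarrow> 'a L2)
     \<Rightarrow> real \<Rightarrow> real \<Rightarrow> real \<Rightarrow> real \<Rightarrow> nat \<Rightarrow> 'a L2" where
  "h_control \<omega>1 lam \<xi> S \<gamma>0 C0 \<gamma> T j = min_norm_element {h \<in> L2_on \<omega>1.
     norm (P_proj \<xi> (M_index lam \<gamma>0 C0 \<gamma> T) (impulse_solution S (\<xi> j) (T/4) (ind_op \<omega>1 h) (T/2)))
       \<le> eps0 lam \<gamma>0 \<gamma> T * norm (\<xi> j)}"

definition feedback ::
  "'a::euclidean_space set \<Rightarrow> 'a set \<Rightarrow> (nat \<Rightarrow> real) \<Rightarrow> (nat \<Rightarrow> 'a L2) \<Rightarrow> (real \<Rightarrow> 'a L2 \<Rightarrow> 'a L2)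
     \<Rightarrow> real \<Rightarrow> real \<Rightarrow> real \<Rightarrow> real \<Rightarrow> 'a L2 \<Rightarrow> 'a L2" where
  "feedback \<omega> \<omega>1 lam \<xi> S \<gamma>0 C0 \<gamma> T v =
     - (\<Sum>j=1..N_index lam \<gamma> T.
          inner (ind_op \<omega>1 v) (ind_op \<omega>1 (h_control \<omega>1 lam \<xi> S \<gamma>0 C0 \<gamma> T j))
            *\<^sub>R f_control \<omega> lam \<xi> S \<gamma>0 C0 \<gamma> T j)"

text \<open>As in \<^const>\<open>onorm\<close>, the vector 0 contributes $0/0 = 0$.\<close>

definition onorm_on :: "'b::real_normed_vector set \<Rightarrow> ('b \<Rightarrow> 'c::real_normed_vector) \<Rightarrow> real" where
  "onorm_on X F = (SUP x\<in>X. norm (F x) / norm x)"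

end

theory Submission
  imports Defs
begin

text \<open>
  Everything is computed in the eigenbasis. The semigroup multiplies the $i$-th coordinate by
  $e^{-\lambda_i t}$, so each coordinate of the controlled state at time $T/2$ is an affine function
  of one inner product of the control with $\mathbf{1}_\omega \xi_i$ (or $\mathbf{1}_{\omega_1}\xi_i$).
  The minimisation defining $f_j$ or $h_j$ thus becomes a finite dimensional problem with the Gram
  matrix $B$ (\<open>min_norm_element_finite_constraint\<close>), and steering to zero exactly shows that the
  squared norm of the minimiser is at most the spectral bound
  $D = e^{C_0 (1 + \gamma_0^{2/3} + \sqrt{\lambda_M})}$ times the squared cost of cancelling the single
  mode $j$. That cost is at most $2/T + \gamma_0$ for $f_j$ and $e^{\gamma_0 T/4}$ for $h_j$, since
  $\lambda_j \ge -\gamma_0$. Summing over $j$ gives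
  $\|\mathcal{F}_T\| \le N D (2/T + \gamma_0) e^{\gamma_0 T/4}$ (\<open>onorm_feedback_le\<close>).

  To turn this into the stated form, $\ln N$ and $\sqrt{\lambda_M}$ must be at most a constant times
  $(1 + 1/T)(1 + \gamma)$, uniformly in the potential. This requires two facts about eigenvalues.
  The first is a bound on the number of eigenvalues below $\Lambda$ that is exponential in $\Lambda$
  (\<open>counting_bound\<close>): an eigenfunction has Dirichlet integral at most $\Lambda + \gamma_0$, so it is
  close to its averages over small cells, and by Bessel's inequality an orthonormal family has
  little total mass in such averages. It also shows that the maxima defining $m$, $N$ and $M$ are
  maxima of finite sets. The second is a bound on $\lambda_{m+1}$, which enters through $\hat c_p$; it
  is obtained by comparing two systems with the same $\gamma_0$
  (\<open>first_positive_eigenvalue_bound\<close>), so the constants may be read off from any one of them.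

  For the lower bound the feedback is tested on the first eigenfunction, which grows like
  $E = e^{-\lambda_1 T/2}$ in time $T/2$. The controls $f_1$ and $h_1$ must cancel all but
  $\varepsilon_0$ of this growth, while for $j \ge 2$ they leave the first coordinate within
  $\varepsilon_0$ of zero; since $N \varepsilon_0^2 \le 1/81$, the term $j = 1$ dominates
  (\<open>lower_profile_le_onorm\<close>). The resulting $\alpha(T)$ is explicit and has the required orders
  of growth.

  Two foundations are established on the way: $L^2$ is complete, which makes the Duhamel integral
  meaningful, and weak derivatives are unique, because the eigenfunctions are limits of test
  functions and span a dense subspace.
\<close>

section \<open>Square integrable functions modulo null sets\<close>

lemma L2_of_fun_of: "L2_of (fun_of u) = u"
  by (rule Quotient3_abs_rep[OF Quotient3_L2])

lemma L2_rel_fun_of: "L2_rel (fun_of u) (fun_of u)"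
  by (rule Quotient3_rep_reflp[OF Quotient3_L2])

lemma square_integrable_fun_of: "square_integrable (fun_of u)"
  using L2_rel_fun_of[of u] by (simp add: L2_rel_def)

lemma fun_of_measurable [measurable]: "fun_of u \<in> borel_measurable lebesgue"
  using square_integrable_fun_of[of u] by (simp add: square_integrable_def)

lemma L2_rel_refl: "square_integrable f \<Longrightarrow> L2_rel f f"
  by (simp add: L2_rel_def)

lemma fun_of_L2_of:
  assumes "square_integrable f"
  shows "AE x in lebesgue. fun_of (L2_of f) x = f x"
proof -
  have "L2_rel (fun_of (L2_of f)) f"
    by (rule rep_abs_rsp_left[OF Quotient3_L2]) (rule L2_rel_refl[OF assms])
  then show ?thesis by (simp add: L2_rel_def)
qed

lemma L2_of_eqI:
  assumes "square_integrable f" "square_integrable g" "AE x in lebesgue. f x = g x"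
  shows "L2_of f = L2_of g"
  using assms by (intro Quotient3_rel_abs[OF Quotient3_L2]) (simp add: L2_rel_def)

lemma L2_eqI: "AE x in lebesgue. fun_of u x = fun_of v x \<Longrightarrow> u = v"
  using L2_of_eqI[OF square_integrable_fun_of square_integrable_fun_of, of u v]
  by (simp add: L2_of_fun_of)

lemma L2_of_add:
  assumes "square_integrable f" "square_integrable g"
  shows "L2_of f + L2_of g = L2_of (\<lambda>x. f x + g x)"
  using plus_L2.abs_eq[OF L2_rel_refl L2_rel_refl] assms by blast

lemma L2_of_diff:
  assumes "square_integrable f" "square_integrable g"
  shows "L2_of f - L2_of g = L2_of (\<lambda>x. f x - g x)"
  using minus_L2.abs_eq[OF L2_rel_refl L2_rel_refl] assms by blast

lemma L2_of_scaleR: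
  assumes "square_integrable f"
  shows "c *\<^sub>R L2_of f = L2_of (\<lambda>x. c * f x)"
  using scaleR_L2.abs_eq[OF L2_rel_refl] assms by blast

lemma inner_L2_of:
  assumes "square_integrable f" "square_integrable g"
  shows "inner (L2_of f) (L2_of g) = (\<integral>x. f x * g x \<partial>lebesgue)"
  using inner_L2.abs_eq[OF L2_rel_refl L2_rel_refl] assms by blast

lemma inner_L2_eq: "inner u v = (\<integral>x. fun_of u x * fun_of v x \<partial>lebesgue)"
  using inner_L2_of[OF square_integrable_fun_of square_integrable_fun_of, of u v]
  by (simp add: L2_of_fun_of)

lemma inner_fun_of_L2_of:
  assumes "square_integrable g"
  shows "inner u (L2_of g) = (\<integral>x. fun_of u x * g x \<partial>lebesgue)"
  using inner_L2_of[OF square_integrable_fun_of assms, of u] by (simp add: L2_of_fun_of)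

lemma norm_L2_of_power2:
  assumes "square_integrable f"
  shows "(norm (L2_of f))\<^sup>2 = (\<integral>x. (f x)\<^sup>2 \<partial>lebesgue)"
  using inner_L2_of[OF assms assms] by (simp add: power2_norm_eq_inner flip: power2_eq_square)

lemma ennreal_norm_L2_of:
  assumes "square_integrable f"
  shows "ennreal ((norm (L2_of f))\<^sup>2) = (\<integral>\<^sup>+x. ennreal ((f x)\<^sup>2) \<partial>lebesgue)"
  using assms by (subst nn_integral_eq_integral) (auto simp: square_integrable_def norm_L2_of_power2)

lemma fun_of_add: "AE x in lebesgue. fun_of (u + v) x = fun_of u x + fun_of v x"
proof -
  have "u + v = L2_of (\<lambda>x. fun_of u x + fun_of v x)"
    using L2_of_add[OF square_integrable_fun_of square_integrable_fun_of, of u v]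
    by (simp add: L2_of_fun_of)
  then show ?thesis
    using fun_of_L2_of square_integrable_add square_integrable_fun_of by metis
qed

lemma fun_of_scaleR: "AE x in lebesgue. fun_of (c *\<^sub>R u) x = c * fun_of u x"
proof -
  have "c *\<^sub>R u = L2_of (\<lambda>x. c * fun_of u x)"
    using L2_of_scaleR[OF square_integrable_fun_of, of c u] by (simp add: L2_of_fun_of)
  then show ?thesis
    using fun_of_L2_of square_integrable_cmult square_integrable_fun_of by metis
qed

lemma fun_of_zero: "AE x in lebesgue. fun_of 0 x = 0"
  using fun_of_scaleR[of 0 0] by simp

lemma subspace_L2_on: "subspace (L2_on U)"
  unfolding L2_on_def
proof (rule subspaceI; simp)
  show "AE x in lebesgue. x \<notin> U \<longrightarrow> fun_of 0 x = 0"
    using fun_of_zero by eventually_elim simp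
next
  fix u v :: "'a L2"
  assume "AE x in lebesgue. x \<notin> U \<longrightarrow> fun_of u x = 0" "AE x in lebesgue. x \<notin> U \<longrightarrow> fun_of v x = 0"
  then show "AE x in lebesgue. x \<notin> U \<longrightarrow> fun_of (u + v) x = 0"
    using fun_of_add[of u v] by eventually_elim simp
next
  fix u :: "'a L2" and c
  assume "AE x in lebesgue. x \<notin> U \<longrightarrow> fun_of u x = 0"
  then show "AE x in lebesgue. x \<notin> U \<longrightarrow> fun_of (c *\<^sub>R u) x = 0"
    using fun_of_scaleR[of c u] by eventually_elim simp
qed

lemma L2_on_mono: "U \<subseteq> W \<Longrightarrow> L2_on U \<subseteq> L2_on W"
  unfolding L2_on_def by (auto elim: eventually_mono)

lemma square_integrable_bounded_mult:
  assumes "square_integrable f" and [measurable]: "g \<in> borel_measurable lebesgue"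
    and "AE x in lebesgue. \<bar>g x\<bar> \<le> c"
  shows "square_integrable (\<lambda>x. g x * f x)"
proof -
  have [measurable]: "f \<in> borel_measurable lebesgue" using assms by (simp add: square_integrable_def)
  have "integrable lebesgue (\<lambda>x. c\<^sup>2 * (f x)\<^sup>2)" using assms by (simp add: square_integrable_def)
  then have "integrable lebesgue (\<lambda>x. (g x * f x)\<^sup>2)"
  proof (rule Bochner_Integration.integrable_bound)
    show "AE x in lebesgue. norm ((g x * f x)\<^sup>2) \<le> norm (c\<^sup>2 * (f x)\<^sup>2)"
      using assms(3)
      by eventually_elim
         (auto simp: power_mult_distrib intro!: mult_right_mono simp flip: abs_le_square_iff)
  qed measurable
  then show ?thesis by (simp add: square_integrable_def)
qed

lemma square_integrable_indicator_mult:
  assumes "square_integrable f" and [measurable]: "U \<in> sets lebesgue"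
  shows "square_integrable (\<lambda>x. indicator U x * f x)"
  by (rule square_integrable_bounded_mult[where c = 1])
     (use assms in \<open>auto simp: indicator_def\<close>)

lemma fun_of_ind_op:
  "U \<in> sets lebesgue \<Longrightarrow> AE x in lebesgue. fun_of (ind_op U u) x = indicator U x * fun_of u x"
  unfolding ind_op_def
  by (intro fun_of_L2_of square_integrable_indicator_mult square_integrable_fun_of)

lemma ind_op_in_L2_on: "U \<in> sets lebesgue \<Longrightarrow> ind_op U u \<in> L2_on U"
  unfolding L2_on_def using fun_of_ind_op[of U u] by (auto elim: eventually_mono)

lemma inner_ind_op:
  assumes "U \<in> sets lebesgue"
  shows "inner (ind_op U u) v = (\<integral>x. indicator U x * (fun_of u x * fun_of v x) \<partial>lebesgue)"
  using inner_fun_of_L2_of[OF square_integrable_indicator_mult[OF square_integrable_fun_of assms], of v u]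
  by (simp add: ind_op_def inner_commute mult_ac)

lemma ind_op_L2_on:
  assumes "U \<in> sets lebesgue" "u \<in> L2_on U"
  shows "ind_op U u = u"
proof (rule L2_eqI)
  show "AE x in lebesgue. fun_of (ind_op U u) x = fun_of u x"
    using fun_of_ind_op[OF assms(1), of u] assms(2) unfolding L2_on_def mem_Collect_eq
    by eventually_elim (auto simp: indicator_def)
qed

lemma inner_ind_op_commute:
  "U \<in> sets lebesgue \<Longrightarrow> inner (ind_op U u) v = inner u (ind_op U v)"
  by (simp add: inner_ind_op inner_commute[of u] mult_ac)

lemma inner_ind_op_L2_on:
  "U \<in> sets lebesgue \<Longrightarrow> v \<in> L2_on U \<Longrightarrow> inner (ind_op U u) v = inner u v"
  by (simp add: inner_ind_op_commute ind_op_L2_on)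

lemma norm_ind_op_le:
  assumes "U \<in> sets lebesgue" shows "norm (ind_op U u) \<le> norm u"
proof -
  have "(norm (ind_op U u))\<^sup>2 = inner u (ind_op U u)"
    using inner_ind_op_L2_on[OF assms ind_op_in_L2_on[OF assms], of u u]
    by (simp add: power2_norm_eq_inner)
  also have "\<dots> \<le> norm u * norm (ind_op U u)" by (rule norm_cauchy_schwarz)
  finally show ?thesis
    by (cases "norm (ind_op U u) = 0") (auto simp: power2_eq_square)
qed

lemma gram_eq_inner:
  assumes "U \<in> sets lebesgue"
  shows "gram \<xi> U i j = inner (ind_op U (\<xi> i)) (ind_op U (\<xi> j))"
  using inner_ind_op_L2_on[OF assms ind_op_in_L2_on[OF assms], of "\<xi> i" "\<xi> j"]
  by (simp add: gram_def set_lebesgue_integral_def inner_ind_op[OF assms] inner_commute[of "\<xi> i"] mult_ac)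

section \<open>Completeness of $L^2$\<close>

text \<open>
  The Riesz--Fischer theorem. Passing to a subsequence whose increments have norms at most
  $2^{-k}$, the function $G = \sum_k 2^k (f_{k+1} - f_k)^2$ is integrable, hence finite almost
  everywhere, and where it is finite the increments are summable by comparison with
  $2 |a| \<le> 2^{-k} + 2^k a^2$. Fatou's lemma identifies the pointwise limit as limit in norm.
\<close>

lemma L2_Cauchy_convergent:
  fixes X :: "nat \<Rightarrow> 'a::euclidean_space L2"
  assumes "Cauchy X"
  shows "convergent X"
proof -
  have "\<exists>N. \<forall>m\<ge>N. \<forall>n\<ge>N. norm (X m - X n) < (1/2)^k" for k :: nat
    using assms unfolding Cauchy_def dist_norm by (simp add: eventually_sequentially)
  then obtain N where N: "\<And>k m n. m \<ge> N k \<Longrightarrow> n \<ge> N k \<Longrightarrow> norm (X m - X n) < (1/2)^k"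
    by metis
  \<comment> \<open>The maximum makes all earlier thresholds available at stage \<open>k\<close>.\<close>
  define r where "r k = Max (N ` {..k}) + k" for k
  have rN: "N i \<le> r k" if "i \<le> k" for i k
    using that by (auto simp: r_def intro!: trans_le_add1 Max_ge)
  define f where "f k = fun_of (X (r k))" for k
  have [measurable]: "f k \<in> borel_measurable lebesgue" for k by (simp add: f_def)
  have sq: "square_integrable (f k)" for k by (simp add: f_def square_integrable_fun_of)
  have Xf: "X (r k) = L2_of (f k)" for k by (simp add: f_def L2_of_fun_of)
  have near: "(\<integral>\<^sup>+x. ennreal ((f m x - f n x)\<^sup>2) \<partial>lebesgue) \<le> ennreal ((1/4)^k)"
    if "k \<le> m" "k \<le> n" for k m n
  proof -
    have "(\<integral>\<^sup>+x. ennreal ((f m x - f n x)\<^sup>2) \<partial>lebesgue) = ennreal ((norm (X (r m) - X (r n)))\<^sup>2)"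
      unfolding Xf L2_of_diff[OF sq sq] by (rule ennreal_norm_L2_of[symmetric]) (intro square_integrable_diff sq)
    also have "\<dots> \<le> ennreal (((1/2)^k)\<^sup>2)"
      using N[of k "r m" "r n"] rN that by (intro ennreal_leI power_mono) (auto intro: less_imp_le)
    also have "((1/2)^k)\<^sup>2 = (1/4::real)^k"
      by (simp add: power2_eq_square flip: power_mult_distrib)
    finally show ?thesis .
  qed
  define G where "G x = (\<Sum>k. ennreal (2^k * (f (Suc k) x - f k x)\<^sup>2))" for x
  have [measurable]: "G \<in> borel_measurable lebesgue" unfolding G_def by measurable
  have "(\<integral>\<^sup>+x. G x \<partial>lebesgue) = (\<Sum>k. \<integral>\<^sup>+x. ennreal (2^k * (f (Suc k) x - f k x)\<^sup>2) \<partial>lebesgue)"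
    unfolding G_def by (rule nn_integral_suminf) measurable
  also have "\<dots> \<le> (\<Sum>k. ennreal ((1/2)^k))"
  proof (rule suminf_le; simp?)
    fix k
    have "(\<integral>\<^sup>+x. ennreal (2^k * (f (Suc k) x - f k x)\<^sup>2) \<partial>lebesgue)
        = ennreal (2^k) * (\<integral>\<^sup>+x. ennreal ((f (Suc k) x - f k x)\<^sup>2) \<partial>lebesgue)"
      by (simp add: ennreal_mult nn_integral_cmult)
    also have "\<dots> \<le> ennreal (2^k) * ennreal ((1/4)^k)"
      by (intro mult_left_mono near) auto
    also have "\<dots> = ennreal ((1/2)^k)"
      by (simp flip: ennreal_mult power_mult_distrib)
    finally show "(\<integral>\<^sup>+x. ennreal (2^k * (f (Suc k) x - f k x)\<^sup>2) \<partial>lebesgue) \<le> ennreal ((1/2)^k)" .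
  qed
  also have "\<dots> < \<infinity>"
    by (subst suminf_ennreal2) (auto simp: summable_geometric)
  finally have "(\<integral>\<^sup>+x. G x \<partial>lebesgue) \<noteq> \<infinity>" by simp
  then have "AE x in lebesgue. G x \<noteq> \<infinity>" by (intro nn_integral_noteq_infinite) measurable
  then have conv: "AE x in lebesgue. convergent (\<lambda>k. f k x)"
  proof eventually_elim
    case (elim x)
    then have s: "summable (\<lambda>k. 2^k * (f (Suc k) x - f k x)\<^sup>2)"
      unfolding G_def by (intro summable_suminf_not_top) (auto simp: top_ennreal_def)
    have "summable (\<lambda>k. (1/2)^k + 2^k * (f (Suc k) x - f k x)\<^sup>2)"
      by (intro summable_add s summable_geometric) auto
    then have "summable (\<lambda>k. f (Suc k) x - f k x)"
    proof (rule summable_comparison_test')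
      fix k
      let ?a = "\<bar>f (Suc k) x - f k x\<bar>"
      have "0 \<le> (1 - 2^k * ?a)\<^sup>2" by simp
      then have "2 * (2^k * ?a) \<le> 1 + (2^k)\<^sup>2 * ?a\<^sup>2" by (simp add: power2_diff power_mult_distrib)
      then have "2^k * (2 * ?a) \<le> 2^k * ((1/2)^k + 2^k * ?a\<^sup>2)"
        by (simp add: algebra_simps power_divide power2_eq_square)
      then have "2 * ?a \<le> (1/2)^k + 2^k * ?a\<^sup>2" by simp
      then have "?a \<le> (1/2)^k + 2^k * ?a\<^sup>2" by (smt (verit) abs_ge_zero)
      then show "norm (f (Suc k) x - f k x) \<le> (1/2)^k + 2^k * (f (Suc k) x - f k x)\<^sup>2"
        by simp
    qed
    then have "(\<lambda>n. \<Sum>k<n. f (Suc k) x - f k x) \<longlonglongrightarrow> (\<Sum>k. f (Suc k) x - f k x)"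
      by (rule summable_LIMSEQ)
    then have "(\<lambda>n. f n x - f 0 x) \<longlonglongrightarrow> (\<Sum>k. f (Suc k) x - f k x)"
      by (simp add: sum_lessThan_telescope[of "\<lambda>k. f k x"])
    from tendsto_add[OF this tendsto_const[of "f 0 x"]] show ?case
      by (auto simp: convergent_def)
  qed
  define g where "g x = lim (\<lambda>k. f k x)" for x
  have [measurable]: "g \<in> borel_measurable lebesgue" unfolding g_def by measurable
  have lim: "AE x in lebesgue. (\<lambda>k. f k x) \<longlonglongrightarrow> g x"
    using conv by eventually_elim (simp add: g_def convergent_LIMSEQ_iff)
  have gn: "(\<integral>\<^sup>+x. ennreal ((g x - f n x)\<^sup>2) \<partial>lebesgue) \<le> ennreal ((1/4)^n)" for n
  proof -
    have "(\<integral>\<^sup>+x. ennreal ((g x - f n x)\<^sup>2) \<partial>lebesgue)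
        = (\<integral>\<^sup>+x. liminf (\<lambda>m. ennreal ((f m x - f n x)\<^sup>2)) \<partial>lebesgue)"
    proof (rule nn_integral_cong_AE)
      show "AE x in lebesgue. ennreal ((g x - f n x)\<^sup>2) = liminf (\<lambda>m. ennreal ((f m x - f n x)\<^sup>2))"
        using lim
      proof eventually_elim
        case (elim x)
        then have "(\<lambda>m. ennreal ((f m x - f n x)\<^sup>2)) \<longlonglongrightarrow> ennreal ((g x - f n x)\<^sup>2)"
          by (intro tendsto_ennrealI tendsto_intros)
        then show ?case by (rule lim_imp_Liminf[OF trivial_limit_sequentially, symmetric])
      qed
    qed
    also have "\<dots> \<le> liminf (\<lambda>m. \<integral>\<^sup>+x. ennreal ((f m x - f n x)\<^sup>2) \<partial>lebesgue)"
      by (rule nn_integral_liminf) measurable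
    also have "\<dots> \<le> liminf (\<lambda>m. ennreal ((1/4)^n))"
      by (rule Liminf_mono) (auto simp: eventually_sequentially intro!: exI[of _ n] near)
    also have "\<dots> = ennreal ((1/4)^n)" by (rule Liminf_const) simp
    finally show ?thesis .
  qed
  have sqd: "square_integrable (\<lambda>x. g x - f n x)" for n
    unfolding square_integrable_def
  proof (intro conjI integrableI_bounded)
    show "(\<integral>\<^sup>+x. ennreal (norm ((g x - f n x)\<^sup>2)) \<partial>lebesgue) < \<infinity>"
      using gn[of n] by (simp add: le_less_trans[OF _ ennreal_less_top])
  qed measurable
  have sqg: "square_integrable g" using square_integrable_add[OF sqd[of 0] sq[of 0]] by simp
  have le: "norm (X (r n) - L2_of g) \<le> (1/2)^n" for n
  proof -
    have "ennreal ((norm (L2_of g - X (r n)))\<^sup>2) \<le> ennreal ((1/4)^n)"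
      using gn[of n] unfolding Xf L2_of_diff[OF sqg sq] by (simp add: ennreal_norm_L2_of[OF sqd])
    then have "(norm (L2_of g - X (r n)))\<^sup>2 \<le> (1/4)^n" by simp
    also have "(1/4::real)^n = ((1/2)^n)\<^sup>2"
      by (simp add: power2_eq_square flip: power_mult_distrib)
    finally have "norm (L2_of g - X (r n)) \<le> (1/2)^n" by (rule power2_le_imp_le) simp
    then show ?thesis by (simp only: norm_minus_commute)
  qed
  have "X \<longlonglongrightarrow> L2_of g"
  proof (rule LIMSEQ_I)
    fix e :: real assume "e > 0"
    then obtain k where k: "(1/2)^k < e/2" using real_arch_pow_inv[of "e/2" "1/2"] by auto
    have "norm (X n - L2_of g) < e" if "n \<ge> N k" for n
    proof -
      have "norm (X n - X (r k)) < (1/2)^k" using N[of k n "r k"] that rN by simp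
      then show ?thesis
        using le[of k] k norm_triangle_ineq[of "X n - X (r k)" "X (r k) - L2_of g"] by simp
    qed
    then show "\<exists>no. \<forall>n\<ge>no. norm (X n - L2_of g) < e" by blast
  qed
  then show ?thesis by (auto simp: convergent_def)
qed

instance L2 :: (euclidean_space) banach
  by standard (rule L2_Cauchy_convergent)

section \<open>Expansions in an orthonormal sequence\<close>

locale orthonormal_seq =
  fixes \<xi> :: "nat \<Rightarrow> 'b::real_inner"
  assumes orthonormal: "i \<ge> 1 \<Longrightarrow> j \<ge> 1 \<Longrightarrow> inner (\<xi> i) (\<xi> j) = (if i = j then 1 else 0)"
begin

lemma norm_basis [simp]: "i \<ge> 1 \<Longrightarrow> norm (\<xi> i) = 1"
  using orthonormal[of i i] by (simp add: norm_eq_sqrt_inner)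

definition partial_expansion :: "nat \<Rightarrow> 'b \<Rightarrow> 'b" where
  "partial_expansion n u = (\<Sum>i=1..n. inner u (\<xi> i) *\<^sub>R \<xi> i)"

lemma inner_sum_basis:
  "l \<ge> 1 \<Longrightarrow> inner (\<Sum>i=1..n. c i *\<^sub>R \<xi> i) (\<xi> l) = (if l \<le> n then c l else 0)"
proof -
  assume l: "l \<ge> 1"
  have "inner (\<Sum>i=1..n. c i *\<^sub>R \<xi> i) (\<xi> l) = (\<Sum>i=1..n. if i = l then c l else 0)"
    unfolding inner_sum_left by (rule sum.cong) (use l in \<open>auto simp: orthonormal\<close>)
  then show ?thesis using l by simp
qed

lemma inner_partial_expansion:
  "l \<ge> 1 \<Longrightarrow> inner (partial_expansion n u) (\<xi> l) = (if l \<le> n then inner u (\<xi> l) else 0)"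
  unfolding partial_expansion_def by (rule inner_sum_basis)

lemma inner_right_partial_expansion:
  "inner v (partial_expansion n u) = (\<Sum>i=1..n. inner u (\<xi> i) * inner v (\<xi> i))"
  by (simp add: partial_expansion_def inner_sum_right)

lemma norm_partial_expansion: "(norm (partial_expansion n u))\<^sup>2 = (\<Sum>i=1..n. (inner u (\<xi> i))\<^sup>2)"
  unfolding power2_norm_eq_inner inner_right_partial_expansion
  by (rule sum.cong) (auto simp: inner_partial_expansion power2_eq_square)

lemma partial_expansion_in_span: "partial_expansion n u \<in> span (\<xi> ` {1..n})"
  unfolding partial_expansion_def by (intro span_sum span_mul span_base) auto

lemma orthogonal_span:
  assumes "\<And>i. i \<in> {1..n} \<Longrightarrow> inner z (\<xi> i) = 0" "s \<in> span (\<xi> ` {1..n})"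
  shows "inner z s = 0"
  using assms(2)
proof (induction rule: span_induct_alt)
  case (step c x y)
  then show ?case using assms(1) by (auto simp: inner_add_right)
qed simp

lemma inner_expansion_error: "s \<in> span (\<xi> ` {1..n}) \<Longrightarrow> inner (u - partial_expansion n u) s = 0"
  by (rule orthogonal_span) (auto simp: inner_diff_left inner_partial_expansion)

lemma best_approximation:
  assumes "s \<in> span (\<xi> ` {1..n})"
  shows "norm (u - partial_expansion n u) \<le> norm (u - s)"
proof -
  let ?p = "partial_expansion n u"
  have "inner (u - ?p) (?p - s) = 0"
    by (intro inner_expansion_error span_diff partial_expansion_in_span assms)
  then have "(norm ((u - ?p) + (?p - s)))\<^sup>2 = (norm (u - ?p))\<^sup>2 + (norm (?p - s))\<^sup>2"
    by (intro norm_add_Pythagorean) (simp add: orthogonal_def)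
  then show ?thesis by (simp add: power2_le_imp_le)
qed

lemma norm_expansion_error: 
  "(norm (u - partial_expansion n u))\<^sup>2 = (norm u)\<^sup>2 - (\<Sum>i=1..n. (inner u (\<xi> i))\<^sup>2)"
proof -
  have "orthogonal (u - partial_expansion n u) (partial_expansion n u)"
    unfolding orthogonal_def by (intro inner_expansion_error partial_expansion_in_span)
  from norm_add_Pythagorean[OF this] show ?thesis
    by (simp only: norm_partial_expansion diff_add_cancel)
qed

lemma bessel: "(\<Sum>i=1..n. (inner u (\<xi> i))\<^sup>2) \<le> (norm u)\<^sup>2"
  using norm_expansion_error[of u n] by (smt (verit) zero_le_power2)

lemma partial_expansion_tendsto:
  assumes "u \<in> closure (span (\<xi> ` {1..}))"
  shows "(\<lambda>n. partial_expansion n u) \<longlonglongrightarrow> u"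
proof (rule LIMSEQ_I)
  fix e :: real assume "e > 0"
  then obtain s where s: "s \<in> span (\<xi> ` {1..})" "norm (u - s) < e"
    using assms unfolding closure_approachable dist_norm by (metis norm_minus_commute)
  \<comment> \<open>An element of the span uses only finitely many basis vectors.\<close>
  obtain n where n: "s \<in> span (\<xi> ` {1..n})"
  proof -
    obtain t r where t: "finite t" "t \<subseteq> \<xi> ` {1..}" "s = (\<Sum>a\<in>t. r a *\<^sub>R a)"
      using s(1) unfolding span_explicit by auto
    obtain I where I: "I \<subseteq> {1..}" "finite I" "t = \<xi> ` I"
      using finite_subset_image[OF t(1,2)] by auto
    have "I \<subseteq> {1..Max (insert 1 I)}" using I by auto
    then have "t \<subseteq> \<xi> ` {1..Max (insert 1 I)}" using I by auto
    then have "s \<in> span (\<xi> ` {1..Max (insert 1 I)})"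
      unfolding t(3) by (intro span_sum span_mul span_base) auto
    then show ?thesis by (rule that)
  qed
  have "norm (partial_expansion m u - u) < e" if "m \<ge> n" for m
  proof -
    have "s \<in> span (\<xi> ` {1..m})" using n that by (rule_tac subsetD[OF span_mono]) auto
    then show ?thesis using best_approximation[of s m u] s(2) by (simp add: norm_minus_commute)
  qed
  then show "\<exists>no. \<forall>n\<ge>no. norm (partial_expansion n u - u) < e" by blast
qed

lemma eq_zero_if_orthogonal_basis:
  assumes "u \<in> closure (span (\<xi> ` {1..}))" "\<And>l. l \<ge> 1 \<Longrightarrow> inner u (\<xi> l) = 0"
  shows "u = 0"
proof -
  have "partial_expansion n u = 0" for n by (simp add: partial_expansion_def assms(2))
  then show ?thesis using partial_expansion_tendsto[OF assms(1)] by (simp add: LIMSEQ_const_iff)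
qed

lemma orth_proj_span: "orth_proj (span (\<xi> ` {1..n})) u = partial_expansion n u"
  unfolding orth_proj_def
proof (rule the_equality)
  show "partial_expansion n u \<in> span (\<xi> ` {1..n}) \<and>
        (\<forall>x\<in>span (\<xi> ` {1..n}). inner (u - partial_expansion n u) x = 0)"
    using partial_expansion_in_span inner_expansion_error by blast
next
  fix p assume p: "p \<in> span (\<xi> ` {1..n}) \<and> (\<forall>x\<in>span (\<xi> ` {1..n}). inner (u - p) x = 0)"
  let ?q = "partial_expansion n u"
  have q: "?q - p \<in> span (\<xi> ` {1..n})" using p partial_expansion_in_span by (intro span_diff) auto
  have "inner (?q - p) (?q - p) = inner (u - p) (?q - p) - inner (u - ?q) (?q - p)"
    by (simp add: inner_diff_left)
  also have "\<dots> = 0" using p q inner_expansion_error[OF q] by simp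
  finally show "p = ?q" by simp
qed

end

section \<open>Shortest elements under a constraint on finitely many inner products\<close>

text \<open>
  A constraint that sees $f$ only through the data $b_i = \langle f, g_i\rangle$. Among the
  elements with given data the shortest is $F(b) = \sum_k (B^{-1} b)_k g_k$, with
  $\|F(b)\|^2 = b' B^{-1} b$, where $B$ is the Gram matrix; so the search reduces to data, and the
  admissible data form a compact set because all the weights $\kappa_i$ are positive. The upper
  bound comes from the data $b_i = -e_i / \kappa_i$, which make the constraint vanish.
\<close>

lemma min_norm_element_finite_constraint:
  fixes g :: "nat \<Rightarrow> 'b::real_inner" and Binv :: "nat \<Rightarrow> nat \<Rightarrow> real"
  assumes X: "subspace X" and g: "\<And>i. i \<in> {1..M} \<Longrightarrow> g i \<in> X"
    and inv: "\<And>i j. i \<in> {1..M} \<Longrightarrow> j \<in> {1..M} \<Longrightarrow>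
                (\<Sum>k=1..M. inner (g i) (g k) * Binv k j) = (if i = j then 1 else 0)"
    and bound: "\<And>a :: nat \<Rightarrow> real. (\<Sum>i=1..M. \<Sum>j=1..M. a i * Binv i j * a j) \<le> D * (\<Sum>i=1..M. (a i)\<^sup>2)"
    and \<kappa>: "\<And>i. i \<in> {1..M} \<Longrightarrow> \<kappa> i > 0" and \<epsilon>: "\<epsilon> \<ge> 0"
    and K: "K = {f \<in> X. (\<Sum>i=1..M. (e i + \<kappa> i * inner f (g i))\<^sup>2) \<le> \<epsilon>\<^sup>2}"
  shows "min_norm_element K \<in> K"
    and "(norm (min_norm_element K))\<^sup>2 \<le> D * (\<Sum>i=1..M. (e i / \<kappa> i)\<^sup>2)"
proof -
  define F where "F b = (\<Sum>k=1..M. (\<Sum>j=1..M. Binv k j * b j) *\<^sub>R g k)" for b :: "nat \<Rightarrow> real"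
  have F_X: "F b \<in> X" for b
    unfolding F_def by (intro subspace_sum subspace_scale X g) auto
  have F_data: "inner (F b) (g i) = b i" if i: "i \<in> {1..M}" for b i
  proof -
    have "inner (F b) (g i) = (\<Sum>k=1..M. \<Sum>j=1..M. b j * (inner (g i) (g k) * Binv k j))"
      unfolding F_def inner_sum_left inner_scaleR_left sum_distrib_right
      by (intro sum.cong) (simp_all add: inner_commute mult_ac)
    also have "\<dots> = (\<Sum>j=1..M. b j * (\<Sum>k=1..M. inner (g i) (g k) * Binv k j))"
      by (subst sum.swap) (simp add: sum_distrib_left)
    also have "\<dots> = (\<Sum>j=1..M. b j * (if i = j then 1 else 0))"
      using inv[OF i] by (intro sum.cong) auto
    also have "\<dots> = b i" using i by (simp add: if_distrib cong: if_cong)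
    finally show ?thesis .
  qed
  have inner_F: "inner f (F b) = (\<Sum>k=1..M. (\<Sum>j=1..M. Binv k j * b j) * inner f (g k))" for f b
    by (simp add: F_def inner_sum_right)
  have F_norm: "(norm (F b))\<^sup>2 = (\<Sum>i=1..M. \<Sum>j=1..M. b i * Binv i j * b j)" for b
    unfolding power2_norm_eq_inner inner_F[of "F b"]
    by (rule sum.cong) (auto simp: F_data sum_distrib_left sum_distrib_right mult_ac)
  have F_le: "norm (F b) \<le> norm f" if "\<And>i. i \<in> {1..M} \<Longrightarrow> b i = inner f (g i)" for f b
  proof -
    have "inner f (F b) = inner (F b) (F b)"
      unfolding inner_F using that F_data by (intro sum.cong) auto
    then have "norm (F b) * norm (F b) \<le> norm f * norm (F b)"
      by (metis norm_cauchy_schwarz power2_eq_square power2_norm_eq_inner)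
    then show ?thesis by (cases "norm (F b) = 0") auto
  qed
  define S where "S = {b. (\<forall>i. i \<notin> {1..M} \<longrightarrow> b i = 0) \<and> (\<Sum>i=1..M. (e i + \<kappa> i * b i)\<^sup>2) \<le> \<epsilon>\<^sup>2}"
  define b0 where "b0 i = (if i \<in> {1..M} then - e i / \<kappa> i else 0)" for i
  have b0: "(\<Sum>i=1..M. (e i + \<kappa> i * b0 i)\<^sup>2) = 0"
    using \<kappa> by (intro sum.neutral) (auto simp: b0_def less_imp_neq[symmetric])
  then have "b0 \<in> S" by (auto simp: S_def b0_def)
  \<comment> \<open>Data are functions on the natural numbers vanishing off the index range, so that
     compactness comes from Tychonoff's theorem on a product of intervals.\<close>
  have "compact S"
  proof -
    define I where "I i = (if i \<in> {1..M} then {(- \<epsilon> - e i) / \<kappa> i..(\<epsilon> - e i) / \<kappa> i} else {0})" for i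
    have "compactin (product_topology (\<lambda>_. euclidean) UNIV) (PiE UNIV I)"
      by (subst compactin_PiE) (auto simp: I_def)
    then have cI: "compact (Pi UNIV I)" by (simp add: euclidean_product_topology PiE_UNIV_domain)
    have "closed S"
      unfolding S_def Collect_conj_eq Collect_all_eq Collect_imp_eq
      by (intro closed_Int closed_INT ballI closed_Un closed_Collect_le closed_Collect_eq 
          continuous_intros continuous_on_product_coordinates) auto
    moreover have "S \<subseteq> Pi UNIV I"
    proof (intro subsetI Pi_I)
      fix b i assume b: "b \<in> S"
      show "b i \<in> I i"
      proof (cases "i \<in> {1..M}")
        case True
        have "(e i + \<kappa> i * b i)\<^sup>2 \<le> (\<Sum>i=1..M. (e i + \<kappa> i * b i)\<^sup>2)"
          using True by (intro member_le_sum) auto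
        then have "(e i + \<kappa> i * b i)\<^sup>2 \<le> \<epsilon>\<^sup>2" using b by (simp add: S_def)
        then have "\<bar>e i + \<kappa> i * b i\<bar> \<le> \<epsilon>" using \<epsilon> by (simp flip: abs_le_square_iff)
        then show ?thesis using \<kappa>[OF True] True by (auto simp: I_def field_simps abs_le_iff)
      qed (use b in \<open>auto simp: I_def S_def\<close>)
    qed
    ultimately show ?thesis using cI by (metis compact_Int_closed inf.absorb_iff2)
  qed
  moreover have "continuous_on S (\<lambda>b. norm (F b))"
    unfolding F_def
    by (intro continuous_intros continuous_on_subset[OF continuous_on_product_coordinates]) auto
  ultimately obtain bs where bs: "bs \<in> S" "\<And>b. b \<in> S \<Longrightarrow> norm (F bs) \<le> norm (F b)"
    using continuous_attains_inf[of S "\<lambda>b. norm (F b)"] \<open>b0 \<in> S\<close> by blast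
  have F_K: "F b \<in> K" if "b \<in> S" for b
    using that F_X by (simp add: K S_def F_data)
  have F_min: "norm (F bs) \<le> norm f" if "f \<in> K" for f
  proof -
    define b where "b i = (if i \<in> {1..M} then inner f (g i) else 0)" for i
    have "(\<Sum>i=1..M. (e i + \<kappa> i * b i)\<^sup>2) = (\<Sum>i=1..M. (e i + \<kappa> i * inner f (g i))\<^sup>2)"
      by (intro sum.cong) (auto simp: b_def)
    then have "b \<in> S" using that by (auto simp: S_def K b_def)
    then have "norm (F bs) \<le> norm (F b)" by (rule bs)
    also have "\<dots> \<le> norm f" by (rule F_le) (simp add: b_def)
    finally show ?thesis .
  qed
  have convex: "((x + y) / 2)\<^sup>2 \<le> (x\<^sup>2 + y\<^sup>2) / 2" for x y :: real
    using zero_le_power2[of "x - y"] by (simp add: power2_diff power2_sum power_divide)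
  \<comment> \<open>Uniqueness: the constraint is convex, so the parallelogram law applies to a midpoint.\<close>
  have mid: "(1/2) *\<^sub>R (f + f') \<in> K" if "f \<in> K" "f' \<in> K" for f f'
  proof -
    have "(\<Sum>i=1..M. (e i + \<kappa> i * inner ((1/2) *\<^sub>R (f + f')) (g i))\<^sup>2)
        \<le> (\<Sum>i=1..M. ((e i + \<kappa> i * inner f (g i))\<^sup>2 + (e i + \<kappa> i * inner f' (g i))\<^sup>2) / 2)"
    proof (rule sum_mono)
      fix i
      let ?x = "e i + \<kappa> i * inner f (g i)" and ?y = "e i + \<kappa> i * inner f' (g i)"
      have "e i + \<kappa> i * inner ((1/2) *\<^sub>R (f + f')) (g i) = (?x + ?y) / 2"
        by (simp add: inner_add_left field_simps)
      then show "(e i + \<kappa> i * inner ((1/2) *\<^sub>R (f + f')) (g i))\<^sup>2 \<le> (?x\<^sup>2 + ?y\<^sup>2) / 2"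
        using convex[of ?x ?y] by (simp only:)
    qed
    also have "\<dots> \<le> \<epsilon>\<^sup>2" using that by (simp add: K sum.distrib flip: sum_divide_distrib)
    finally show ?thesis using that X by (auto simp: K intro!: subspace_scale subspace_add)
  qed
  have "min_norm_element K = F bs"
    unfolding min_norm_element_def
  proof (rule the_equality)
    show "F bs \<in> K \<and> (\<forall>f\<in>K. norm (F bs) \<le> norm f)" using F_K[OF bs(1)] F_min by blast
  next
    fix f assume f: "f \<in> K \<and> (\<forall>h\<in>K. norm f \<le> norm h)"
    then have eq: "norm f = norm (F bs)" using F_min F_K[OF bs(1)] by (meson order_antisym)
    have "norm (F bs) \<le> norm ((1/2) *\<^sub>R (f + F bs))" using f F_K[OF bs(1)] by (intro F_min mid) auto
    then have "2 * norm (F bs) \<le> norm (f + F bs)" by simp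
    then have "(2 * norm (F bs))\<^sup>2 \<le> (norm (f + F bs))\<^sup>2" by (intro power_mono) auto
    moreover have "(norm (f + F bs))\<^sup>2 + (norm (f - F bs))\<^sup>2 = 2 * (norm f)\<^sup>2 + 2 * (norm (F bs))\<^sup>2"
      by (simp add: power2_norm_eq_inner inner_add_left inner_add_right inner_diff_left inner_diff_right)
    ultimately have "(norm (f - F bs))\<^sup>2 \<le> 0"
      unfolding eq power_mult_distrib power2_eq_square[of 2] by linarith
    then show "f = F bs" by simp
  qed
  then show "min_norm_element K \<in> K" using F_K[OF bs(1)] by simp
  have "(norm (F bs))\<^sup>2 \<le> (norm (F b0))\<^sup>2" using bs(2)[OF \<open>b0 \<in> S\<close>] by (intro power_mono) auto
  also have "\<dots> \<le> D * (\<Sum>i=1..M. (b0 i)\<^sup>2)" unfolding F_norm by (rule bound)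
  also have "(\<Sum>i=1..M. (b0 i)\<^sup>2) = (\<Sum>i=1..M. (e i / \<kappa> i)\<^sup>2)"
    by (intro sum.cong) (auto simp: b0_def power_divide)
  finally show "(norm (min_norm_element K))\<^sup>2 \<le> D * (\<Sum>i=1..M. (e i / \<kappa> i)\<^sup>2)"
    using \<open>min_norm_element K = F bs\<close> by simp
qed

section \<open>Test functions and bounded potentials\<close>

lemma test_function_Ck: "\<phi> \<in> test_functions U \<Longrightarrow> Ck k \<phi>"
  by (simp add: test_functions_def)

lemma test_function_differentiable: "\<phi> \<in> test_functions U \<Longrightarrow> \<phi> differentiable (at x)"
  using test_function_Ck[of \<phi> U 1] by simp

lemma test_function_has_derivative:
  assumes "\<phi> \<in> test_functions U"
  shows "(\<phi> has_derivative (\<lambda>h. \<Sum>i\<in>Basis. inner h i * pderivative i \<phi> x)) (at x)"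
proof -
  let ?D = "frechet_derivative \<phi> (at x)"
  have D: "(\<phi> has_derivative ?D) (at x)"
    using test_function_differentiable[OF assms] by (simp add: frechet_derivative_works)
  then interpret bounded_linear ?D by (rule has_derivative_bounded_linear)
  have "?D = (\<lambda>h. \<Sum>i\<in>Basis. inner h i * pderivative i \<phi> x)"
  proof
    fix h :: 'a
    have "?D h = ?D (\<Sum>i\<in>Basis. inner h i *\<^sub>R i)" by (simp add: euclidean_representation)
    then show "?D h = (\<Sum>i\<in>Basis. inner h i * pderivative i \<phi> x)"
      by (simp add: sum scaleR pderivative_def)
  qed
  then show ?thesis using D by simp
qed

lemma test_function_continuous: "\<phi> \<in> test_functions U \<Longrightarrow> continuous_on UNIV \<phi>"
  using test_function_Ck[of \<phi> U 0] by simp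

lemma test_function_pderivative_continuous:
  "\<phi> \<in> test_functions U \<Longrightarrow> i \<in> Basis \<Longrightarrow> continuous_on UNIV (pderivative i \<phi>)"
  using test_function_Ck[of \<phi> U 1] by simp

lemma test_function_zero_outside: "\<phi> \<in> test_functions U \<Longrightarrow> x \<notin> U \<Longrightarrow> \<phi> x = 0"
  using closure_subset[of "{x. \<phi> x \<noteq> 0}"] by (auto simp: test_functions_def)

lemma pderivative_zero_outside_support:
  assumes "x \<notin> closure {x. \<phi> x \<noteq> 0}"
  shows "pderivative i \<phi> x = 0"
proof -
  have "((\<lambda>_. 0) has_derivative (\<lambda>_. 0)) (at x)" by simp
  then have "(\<phi> has_derivative (\<lambda>_. 0)) (at x)"
  proof (rule has_derivative_transform_within_open)
    show "0 = \<phi> y" if "y \<in> - closure {x. \<phi> x \<noteq> 0}" for y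
      using that closure_subset[of "{x. \<phi> x \<noteq> 0}"] by auto
  qed (use assms in auto)
  then show ?thesis by (simp add: pderivative_def frechet_derivative_at[symmetric])
qed

lemma square_integrable_continuous_compact_support:
  fixes f :: "'a::euclidean_space \<Rightarrow> real"
  assumes f: "continuous_on UNIV f" and "compact C" "\<And>x. x \<notin> C \<Longrightarrow> f x = 0"
  shows "square_integrable f"
proof -
  have "integrable lborel (\<lambda>x. indicator C x *\<^sub>R (f x)\<^sup>2)"
    by (intro borel_integrable_compact assms continuous_on_subset[OF continuous_on_power[OF f]]) auto
  also have "(\<lambda>x. indicator C x *\<^sub>R (f x)\<^sup>2) = (\<lambda>x. (f x)\<^sup>2)"
    using assms(3) by (auto simp: indicator_def fun_eq_iff)
  finally have "integrable lebesgue (\<lambda>x. (f x)\<^sup>2)"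
    using borel_measurable_continuous_onI[OF f] by (subst integrable_completion) auto
  then show ?thesis
    using measurable_completion[of f lborel borel] borel_measurable_continuous_onI[OF f]
    by (simp add: square_integrable_def)
qed

lemma test_function_square_integrable: "\<phi> \<in> test_functions U \<Longrightarrow> square_integrable \<phi>"
  by (rule square_integrable_continuous_compact_support[of _ "closure {x. \<phi> x \<noteq> 0}"])
     (auto simp: test_function_continuous, auto simp: test_functions_def intro: closure_subset[THEN subsetD])

lemma test_function_pderivative_square_integrable:
  "\<phi> \<in> test_functions U \<Longrightarrow> i \<in> Basis \<Longrightarrow> square_integrable (pderivative i \<phi>)"
  by (rule square_integrable_continuous_compact_support[of _ "closure {x. \<phi> x \<noteq> 0}"])
     (auto simp: test_function_pderivative_continuous pderivative_zero_outside_support, auto simp: test_functions_def)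

lemma has_weak_derivative_inner:
  assumes "i \<in> Basis"
  shows "has_weak_derivative U i u g \<longleftrightarrow> g \<in> L2_on U \<and>
    (\<forall>\<phi>\<in>test_functions U. inner u (L2_of (pderivative i \<phi>)) = - inner g (L2_of \<phi>))"
  unfolding has_weak_derivative_def
  by (intro conj_cong refl ball_cong)
     (simp add: inner_fun_of_L2_of test_function_square_integrable
        test_function_pderivative_square_integrable assms)

lemma H10_approximation:
  assumes "u \<in> H10 U"
  obtains \<phi> where "\<And>n. \<phi> n \<in> test_functions U" "(\<lambda>n. L2_of (\<phi> n)) \<longlonglongrightarrow> u"
    "\<And>i. i \<in> Basis \<Longrightarrow> (\<lambda>n. L2_of (pderivative i (\<phi> n))) \<longlonglongrightarrow> weak_derivative U i u"
  using assms unfolding H10_def by blast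

lemma Linf_norm_AE:
  assumes "V \<in> Linf_on U" and [measurable]: "U \<in> sets lebesgue"
  shows "AE x in lebesgue. \<bar>indicator U x * V x\<bar> \<le> max 0 (Linf_norm U V)"
proof -
  let ?E = "esssup (lebesgue_on U) (\<lambda>x. ereal \<bar>V x\<bar>)"
  have "?E < \<infinity>" using assms by (simp add: Linf_on_def)
  have "AE x in lebesgue_on U. ereal \<bar>V x\<bar> \<le> ?E" by (rule esssup_AE)
  then have "AE x in lebesgue. x \<in> U \<longrightarrow> ereal \<bar>V x\<bar> \<le> ?E"
    by (simp add: AE_restrict_space_iff)
  then show ?thesis
  proof eventually_elim
    case (elim x)
    show ?case
    proof (cases "x \<in> U")
      case True
      then have "ereal \<bar>V x\<bar> \<le> ?E" using elim by simp
      then have "\<bar>V x\<bar> \<le> Linf_norm U V"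
        using \<open>?E < \<infinity>\<close> unfolding Linf_norm_def by (cases ?E) auto
      then show ?thesis using True by simp
    qed simp
  qed
qed

lemma Linf_on_measurable:
  assumes "V \<in> Linf_on U" and "U \<in> sets lebesgue"
  shows "(\<lambda>x. indicator U x * V x) \<in> borel_measurable lebesgue"
  using assms borel_measurable_restrict_space_iff[of U lebesgue V] by (simp add: Linf_on_def)

lemma inner_mult_op:
  assumes "V \<in> Linf_on U" "U \<in> sets lebesgue"
  shows "inner (mult_op U V u) v = (\<integral>x. (indicator U x * V x) * (fun_of u x * fun_of v x) \<partial>lebesgue)"
    and "integrable lebesgue (\<lambda>x. (indicator U x * V x) * (fun_of u x * fun_of v x))"
proof -
  have sq: "square_integrable (\<lambda>x. (indicator U x * V x) * fun_of u x)"
    by (rule square_integrable_bounded_mult[OF square_integrable_fun_of Linf_on_measurable[OF assms] Linf_norm_AE[OF assms]])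
  show "inner (mult_op U V u) v = (\<integral>x. (indicator U x * V x) * (fun_of u x * fun_of v x) \<partial>lebesgue)"
    using inner_fun_of_L2_of[OF sq, of v] by (simp add: mult_op_def inner_commute[of v] mult_ac)
  show "integrable lebesgue (\<lambda>x. (indicator U x * V x) * (fun_of u x * fun_of v x))"
    using square_integrable_mult[OF sq square_integrable_fun_of[of v]] by (simp add: mult_ac)
qed

lemma inner_mult_op_commute:
  "V \<in> Linf_on U \<Longrightarrow> U \<in> sets lebesgue \<Longrightarrow> inner (mult_op U V u) v = inner u (mult_op U V v)"
  by (simp add: inner_mult_op inner_commute[of u] mult_ac)

lemma inner_mult_op_bound:
  assumes "V \<in> Linf_on U" "U \<in> sets lebesgue"
  shows "\<bar>inner (mult_op U V u) u\<bar> \<le> max 0 (Linf_norm U V) * (norm u)\<^sup>2"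
proof -
  let ?c = "max 0 (Linf_norm U V)"
  let ?h = "\<lambda>x. (indicator U x * V x) * (fun_of u x * fun_of u x)"
  have "\<bar>inner (mult_op U V u) u\<bar> \<le> (\<integral>x. norm (?h x) \<partial>lebesgue)"
    unfolding inner_mult_op(1)[OF assms] real_norm_def[symmetric] by (rule integral_norm_bound)
  also have "\<dots> \<le> (\<integral>x. ?c * (fun_of u x * fun_of u x) \<partial>lebesgue)"
  proof (rule integral_mono_AE)
    show "AE x in lebesgue. norm (?h x) \<le> ?c * (fun_of u x * fun_of u x)"
      using Linf_norm_AE[OF assms]
    proof eventually_elim
      case (elim x)
      from mult_right_mono[OF elim, of "fun_of u x * fun_of u x"] show ?case
        by (simp add: abs_mult)
    qed
  qed (use inner_mult_op(2)[OF assms] square_integrable_mult[OF square_integrable_fun_of square_integrable_fun_of] in auto)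
  also have "\<dots> = ?c * (norm u)\<^sup>2"
    by (simp add: power2_norm_eq_inner inner_L2_eq)
  finally show ?thesis .
qed

section \<open>The operator and its quadratic form\<close>

locale schroedinger =
  fixes \<Omega> :: "'a::euclidean_space set" and V :: "'a \<Rightarrow> real" and lam :: "nat \<Rightarrow> real"
    and \<xi> :: "nat \<Rightarrow> 'a L2" and \<gamma>0 :: real
  assumes domain: "bounded_C2_domain \<Omega>"
    and standing: "standing_assumptions \<Omega> V lam \<xi>"
    and \<gamma>0: "Linf_norm \<Omega> V = \<gamma>0"
begin

lemma open_\<Omega>: "open \<Omega>" and bounded_\<Omega>: "bounded \<Omega>"
  using domain by (auto simp: bounded_C2_domain_def)

lemma \<Omega>_sets: "\<Omega> \<in> sets lebesgue"
  using open_\<Omega> by auto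

lemma V_Linf: "V \<in> Linf_on \<Omega>"
  using standing by (simp add: standing_assumptions_def)

lemma
  shows basis_dom: "j \<ge> 1 \<Longrightarrow> \<xi> j \<in> dom_A \<Omega>"
    and eigen: "j \<ge> 1 \<Longrightarrow> op_A \<Omega> V (\<xi> j) = - (lam j *\<^sub>R \<xi> j)"
    and lam_mono: "i \<ge> 1 \<Longrightarrow> i \<le> j \<Longrightarrow> lam i \<le> lam j"
    and closure_basis: "closure (span (\<xi> ` {1..})) = L2_on \<Omega>"
    and lam_1_neg: "lam 1 < 0"
proof -
  have e: "eigensystem \<Omega> V lam \<xi>" using standing by (simp add: standing_assumptions_def)
  show "j \<ge> 1 \<Longrightarrow> \<xi> j \<in> dom_A \<Omega>" "closure (span (\<xi> ` {1..})) = L2_on \<Omega>"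
    using e by (auto simp: eigensystem_def)
  show "j \<ge> 1 \<Longrightarrow> op_A \<Omega> V (\<xi> j) = - (lam j *\<^sub>R \<xi> j)"
    using e unfolding eigensystem_def by (metis minus_minus)
  show mono: "i \<ge> 1 \<Longrightarrow> i \<le> j \<Longrightarrow> lam i \<le> lam j" for i j
    using e unfolding eigensystem_def by blast
  obtain j where "j \<ge> 1" "lam j < 0" using standing by (auto simp: standing_assumptions_def)
  then show "lam 1 < 0" using mono[of 1 j] by simp
qed

sublocale orthonormal_seq \<xi>
  by unfold_locales (use standing in \<open>auto simp: standing_assumptions_def eigensystem_def\<close>)

lemma basis_L2_on: "j \<ge> 1 \<Longrightarrow> \<xi> j \<in> L2_on \<Omega>"
  using basis_dom[of j] by (simp add: dom_A_def H10_def H1_def)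

lemma expansion_tendsto: "u \<in> L2_on \<Omega> \<Longrightarrow> (\<lambda>n. partial_expansion n u) \<longlonglongrightarrow> u"
  using partial_expansion_tendsto[of u] closure_basis by simp

text \<open>
  Test functions separate the points of $L^2(\Omega)$ because every eigenfunction, being in
  $H_0^1$, is a limit of test functions, and the eigenfunctions span a dense subspace.
\<close>

lemma eq_zero_if_orthogonal_test_functions:
  assumes "g \<in> L2_on \<Omega>" "\<And>\<phi>. \<phi> \<in> test_functions \<Omega> \<Longrightarrow> inner g (L2_of \<phi>) = 0"
  shows "g = 0"
proof (rule eq_zero_if_orthogonal_basis)
  show "g \<in> closure (span (\<xi> ` {1..}))" using assms(1) closure_basis by simp
  fix l :: nat assume "l \<ge> 1"
  then have "\<xi> l \<in> H10 \<Omega>" using basis_dom by (simp add: dom_A_def)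
  then obtain \<phi> where \<phi>: "\<And>n. \<phi> n \<in> test_functions \<Omega>" "(\<lambda>n. L2_of (\<phi> n)) \<longlonglongrightarrow> \<xi> l"
    by (rule H10_approximation) blast
  have "(\<lambda>n. inner g (L2_of (\<phi> n))) \<longlonglongrightarrow> inner g (\<xi> l)" by (intro tendsto_intros \<phi>)
  then show "inner g (\<xi> l) = 0" using assms(2)[OF \<phi>(1)] by (simp add: LIMSEQ_const_iff)
qed

lemma weak_derivative_unique:
  assumes "i \<in> Basis" "has_weak_derivative \<Omega> i u g"
  shows "weak_derivative \<Omega> i u = g"
  unfolding weak_derivative_def
proof (rule the_equality)
  show "has_weak_derivative \<Omega> i u g" by (rule assms(2))
  fix g' assume g': "has_weak_derivative \<Omega> i u g'"
  have "g' - g = 0"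
  proof (rule eq_zero_if_orthogonal_test_functions)
    show "g' - g \<in> L2_on \<Omega>"
      using g' assms by (intro subspace_diff[OF subspace_L2_on]) (auto simp: has_weak_derivative_def)
    show "inner (g' - g) (L2_of \<phi>) = 0" if "\<phi> \<in> test_functions \<Omega>" for \<phi>
    proof -
      have "- inner g' (L2_of \<phi>) = - inner g (L2_of \<phi>)"
        using that g' assms(2) unfolding has_weak_derivative_inner[OF assms(1)] by metis
      then show ?thesis by (simp add: inner_diff_left)
    qed
  qed
  then show "g' = g" by simp
qed

lemma H1_weak_derivative:
  assumes "i \<in> Basis" "u \<in> H1 \<Omega>"
  shows "has_weak_derivative \<Omega> i u (weak_derivative \<Omega> i u)"
proof -
  obtain g where "has_weak_derivative \<Omega> i u g" using assms by (auto simp: H1_def)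
  then show ?thesis using weak_derivative_unique[OF assms(1)] by metis
qed

text \<open>
  Green's formula. The definition of a weak derivative gives it for test functions in place of
  $v$, and both sides pass to the limit because test functions approximate $v$ together with its
  gradient.
\<close>

lemma inner_laplacian:
  assumes "u \<in> dom_A \<Omega>" "v \<in> dom_A \<Omega>"
  shows "inner (laplacian \<Omega> u) v = - (\<Sum>i\<in>Basis. inner (weak_derivative \<Omega> i u) (weak_derivative \<Omega> i v))"
proof -
  have v: "v \<in> H10 \<Omega>" using assms by (simp add: dom_A_def)
  obtain \<phi> where \<phi>: "\<And>n. \<phi> n \<in> test_functions \<Omega>" "(\<lambda>n. L2_of (\<phi> n)) \<longlonglongrightarrow> v"
    "\<And>i. i \<in> Basis \<Longrightarrow> (\<lambda>n. L2_of (pderivative i (\<phi> n))) \<longlonglongrightarrow> weak_derivative \<Omega> i v"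
    using v by (rule H10_approximation) blast
  have "inner (weak_derivative \<Omega> i (weak_derivative \<Omega> i u)) v = - inner (weak_derivative \<Omega> i u) (weak_derivative \<Omega> i v)"
    if i: "i \<in> Basis" for i
  proof (rule LIMSEQ_unique)
    let ?d = "weak_derivative \<Omega> i u"
    have "?d \<in> H1 \<Omega>" using assms i by (auto simp: dom_A_def H2_def)
    then have "inner ?d (L2_of (pderivative i (\<phi> n))) = - inner (weak_derivative \<Omega> i ?d) (L2_of (\<phi> n))" for n
      using H1_weak_derivative[OF i] \<phi>(1) unfolding has_weak_derivative_inner[OF i] by blast
    then have eq: "- inner ?d (L2_of (pderivative i (\<phi> n))) = inner (weak_derivative \<Omega> i ?d) (L2_of (\<phi> n))" for n
      by simp
    show "(\<lambda>n. inner (weak_derivative \<Omega> i ?d) (L2_of (\<phi> n))) \<longlonglongrightarrow> inner (weak_derivative \<Omega> i ?d) v"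
      by (intro tendsto_intros \<phi>)
    show "(\<lambda>n. inner (weak_derivative \<Omega> i ?d) (L2_of (\<phi> n))) \<longlonglongrightarrow> - inner ?d (weak_derivative \<Omega> i v)"
      unfolding eq[symmetric] by (intro tendsto_intros \<phi> i)
  qed
  then show ?thesis by (simp add: laplacian_def inner_sum_left sum_negf)
qed

lemma op_A_symmetric:
  assumes "u \<in> dom_A \<Omega>" "v \<in> dom_A \<Omega>"
  shows "inner (op_A \<Omega> V u) v = inner u (op_A \<Omega> V v)"
  using inner_laplacian[OF assms] inner_laplacian[OF assms(2,1)] inner_mult_op_commute[OF V_Linf \<Omega>_sets, of u v]
  by (simp add: op_A_def inner_diff_left inner_diff_right inner_commute)

lemma inner_op_A_basis:
  "u \<in> dom_A \<Omega> \<Longrightarrow> l \<ge> 1 \<Longrightarrow> inner (op_A \<Omega> V u) (\<xi> l) = - (lam l * inner u (\<xi> l))"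
  by (simp add: op_A_symmetric basis_dom eigen)

lemma gradient_basis_bound:
  assumes "j \<ge> 1"
  shows "(\<Sum>i\<in>Basis. (norm (weak_derivative \<Omega> i (\<xi> j)))\<^sup>2) \<le> lam j + max 0 \<gamma>0"
proof -
  let ?u = "\<xi> j"
  have u: "?u \<in> dom_A \<Omega>" using assms by (rule basis_dom)
  have "- inner (op_A \<Omega> V ?u) ?u = (\<Sum>i\<in>Basis. (norm (weak_derivative \<Omega> i ?u))\<^sup>2) + inner (mult_op \<Omega> V ?u) ?u"
    by (simp add: op_A_def inner_diff_left inner_laplacian[OF u u] power2_norm_eq_inner)
  moreover have "- inner (op_A \<Omega> V ?u) ?u = lam j" using assms by (simp add: eigen orthonormal)
  moreover have "\<bar>inner (mult_op \<Omega> V ?u) ?u\<bar> \<le> max 0 \<gamma>0"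
    using inner_mult_op_bound[OF V_Linf \<Omega>_sets, of ?u] assms \<gamma>0 by simp
  ultimately show ?thesis by linarith
qed

text \<open>
  The Dirichlet integral of $\xi_1$ is nonnegative while $\lambda_1$ is negative, so the
  potential cannot vanish.
\<close>

lemma \<gamma>0_pos: "\<gamma>0 > 0"
proof (rule ccontr)
  assume "\<not> \<gamma>0 > 0"
  then have "(\<Sum>i\<in>Basis. (norm (weak_derivative \<Omega> i (\<xi> 1)))\<^sup>2) \<le> lam 1"
    using gradient_basis_bound[of 1] by simp
  then show False using lam_1_neg sum_nonneg[of Basis "\<lambda>i. (norm (weak_derivative \<Omega> i (\<xi> 1)))\<^sup>2"] by simp
qed

lemma gradient_basis_le:
  "j \<ge> 1 \<Longrightarrow> (\<Sum>i\<in>Basis. (norm (weak_derivative \<Omega> i (\<xi> j)))\<^sup>2) \<le> lam j + \<gamma>0"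
  using gradient_basis_bound[of j] \<gamma>0_pos by simp

lemma lam_ge: assumes "j \<ge> 1" shows "lam j \<ge> - \<gamma>0"
  using gradient_basis_le[OF assms] sum_nonneg[of Basis "\<lambda>i. (norm (weak_derivative \<Omega> i (\<xi> j)))\<^sup>2"]
  by simp

text \<open>
  Formally the quadratic form is $\sum_l \lambda_l \langle u, \xi_l\rangle^2$, and $\lambda_l$
  is replaced by $L$ for $l > m$. Pairing $-Au$ with the partial sums of the expansion of $u$
  makes every sum finite; the limit is taken only in the resulting inequality.
\<close>

lemma quadratic_form_lower_bound:
  assumes u: "u \<in> dom_A \<Omega>" and L: "\<And>l. l > m \<Longrightarrow> lam l \<ge> L"
  shows "L * (norm u)\<^sup>2 + (\<Sum>l=1..m. (lam l - L) * (inner u (\<xi> l))\<^sup>2) \<le> - inner (op_A \<Omega> V u) u"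
proof (rule LIMSEQ_le)
  let ?p = "\<lambda>n. partial_expansion n u"
  have "u \<in> L2_on \<Omega>" using u by (simp add: dom_A_def H10_def H1_def)
  note lim = expansion_tendsto[OF this]
  show "(\<lambda>n. L * (norm (?p n))\<^sup>2 + (\<Sum>l=1..m. (lam l - L) * (inner u (\<xi> l))\<^sup>2))
      \<longlonglongrightarrow> L * (norm u)\<^sup>2 + (\<Sum>l=1..m. (lam l - L) * (inner u (\<xi> l))\<^sup>2)"
    by (intro tendsto_intros lim)
  show "(\<lambda>n. - inner (op_A \<Omega> V u) (?p n)) \<longlonglongrightarrow> - inner (op_A \<Omega> V u) u"
    by (intro tendsto_intros lim)
  have "L * (norm (?p n))\<^sup>2 + (\<Sum>l=1..m. (lam l - L) * (inner u (\<xi> l))\<^sup>2) \<le> - inner (op_A \<Omega> V u) (?p n)"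
    if "n \<ge> m" for n
  proof -
    have "(\<Sum>l=1..m. (lam l - L) * (inner u (\<xi> l))\<^sup>2)
        \<le> (\<Sum>l=1..m. (lam l - L) * (inner u (\<xi> l))\<^sup>2) + (\<Sum>l\<in>{1..n} - {1..m}. (lam l - L) * (inner u (\<xi> l))\<^sup>2)"
      using L by (auto intro!: sum_nonneg)
    also have "\<dots> = (\<Sum>l=1..n. (lam l - L) * (inner u (\<xi> l))\<^sup>2)"
      using that by (subst sum.subset_diff[of "{1..m}" "{1..n}"]) auto
    also have "\<dots> = (\<Sum>l=1..n. lam l * (inner u (\<xi> l))\<^sup>2) - L * (norm (?p n))\<^sup>2"
      by (simp add: norm_partial_expansion left_diff_distrib sum_subtractf sum_distrib_left)
    also have "(\<Sum>l=1..n. lam l * (inner u (\<xi> l))\<^sup>2) = - inner (op_A \<Omega> V u) (?p n)"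
      unfolding inner_right_partial_expansion sum_negf[symmetric]
      by (rule sum.cong) (auto simp: inner_op_A_basis[OF u] power2_eq_square)
    finally show ?thesis by simp
  qed
  then show "\<exists>N. \<forall>n\<ge>N. L * (norm (?p n))\<^sup>2 + (\<Sum>l=1..m. (lam l - L) * (inner u (\<xi> l))\<^sup>2)
      \<le> - inner (op_A \<Omega> V u) (?p n)" by blast
qed

end

section \<open>Counting eigenvalues\<close>

definition gradient_square :: "('a::euclidean_space \<Rightarrow> real) \<Rightarrow> 'a \<Rightarrow> real" where
  "gradient_square \<phi> x = (\<Sum>i\<in>Basis. (pderivative i \<phi> x)\<^sup>2)"

lemma gradient_square_nonneg: "0 \<le> gradient_square \<phi> x"
  by (simp add: gradient_square_def sum_nonneg)

lemma gradient_square_continuous: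
  "\<phi> \<in> test_functions U \<Longrightarrow> continuous_on UNIV (gradient_square \<phi>)"
  unfolding gradient_square_def
  by (intro continuous_intros test_function_pderivative_continuous)

lemma square_integral_le:
  fixes q :: "real \<Rightarrow> real"
  assumes "continuous_on {0..1} q" "(q has_integral I) {0..1}"
  shows "I\<^sup>2 \<le> integral {0..1} (\<lambda>s. (q s)\<^sup>2)"
proof -
  have "((\<lambda>s. (2 * I) * q s - I\<^sup>2) has_integral (2 * I) * I - I\<^sup>2) {0..1}"
    using has_integral_diff[OF has_integral_mult_right[OF assms(2)] has_integral_const_real[of "I\<^sup>2" 0 1]]
    by simp
  moreover have "((\<lambda>s. (q s)\<^sup>2) has_integral integral {0..1} (\<lambda>s. (q s)\<^sup>2)) {0..1}"
    by (intro integrable_integral integrable_continuous_real continuous_intros assms)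
  moreover have "(2 * I) * q s - I\<^sup>2 \<le> (q s)\<^sup>2" for s
    using zero_le_power2[of "q s - I"] by (simp add: power2_diff mult_ac)
  ultimately have "(2 * I) * I - I\<^sup>2 \<le> integral {0..1} (\<lambda>s. (q s)\<^sup>2)"
    by (rule has_integral_le)
  then show ?thesis by (simp add: power2_eq_square)
qed

text \<open>
  The fundamental theorem of calculus along the segment from $x$ to $x + h$, followed by the
  Cauchy--Schwarz inequality in the segment parameter and in the coordinates.
\<close>

lemma test_function_difference_le:
  assumes \<phi>: "\<phi> \<in> test_functions U"
  shows "ennreal ((\<phi> (x + h) - \<phi> x)\<^sup>2)
    \<le> ennreal ((norm h)\<^sup>2) * (\<integral>\<^sup>+s. ennreal (gradient_square \<phi> (x + s *\<^sub>R h)) * indicator {0..1} s \<partial>lborel)"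
proof -
  define q where "q s = (\<Sum>i\<in>Basis. inner h i * pderivative i \<phi> (x + s *\<^sub>R h))" for s :: real
  define g where "g s = gradient_square \<phi> (x + s *\<^sub>R h)" for s :: real
  have cont: "continuous_on A (\<lambda>s. f (x + s *\<^sub>R h))" if "continuous_on UNIV f" for A and f :: "'a \<Rightarrow> real"
    by (rule continuous_on_compose2[OF that]) (auto intro!: continuous_intros)
  have cq: "continuous_on {0..1} q"
    unfolding q_def by (intro continuous_intros cont test_function_pderivative_continuous[OF \<phi>])
  have cg: "continuous_on A g" for A
    unfolding g_def by (intro cont gradient_square_continuous[OF \<phi>])
  have "(q has_integral \<phi> (x + 1 *\<^sub>R h) - \<phi> (x + 0 *\<^sub>R h)) {0..1}"
  proof (rule fundamental_theorem_of_calculus[where f = "\<lambda>s. \<phi> (x + s *\<^sub>R h)"])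
    fix s :: real
    have "((\<lambda>s. \<phi> (x + s *\<^sub>R h)) has_derivative (\<lambda>t. \<Sum>i\<in>Basis. inner (t *\<^sub>R h) i * pderivative i \<phi> (x + s *\<^sub>R h))) (at s within {0..1})"
      by (rule has_derivative_compose[OF _ test_function_has_derivative[OF \<phi>]])
         (auto intro!: derivative_eq_intros)
    then show "((\<lambda>s. \<phi> (x + s *\<^sub>R h)) has_vector_derivative q s) (at s within {0..1})"
      by (simp add: has_vector_derivative_def q_def sum_distrib_left mult_ac)
  qed simp
  then have "(\<phi> (x + h) - \<phi> x)\<^sup>2 \<le> integral {0..1} (\<lambda>s. (q s)\<^sup>2)"
    using square_integral_le[OF cq] by simp
  also have "\<dots> \<le> integral {0..1} (\<lambda>s. (norm h)\<^sup>2 * g s)"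
  proof (rule integral_le)
    fix s :: real
    have "(q s)\<^sup>2 \<le> (\<Sum>i\<in>Basis. (inner h i)\<^sup>2) * (\<Sum>i\<in>Basis. (pderivative i \<phi> (x + s *\<^sub>R h))\<^sup>2)"
      unfolding q_def by (rule Cauchy_Schwarz_ineq_sum)
    also have "(\<Sum>i\<in>Basis. (inner h i)\<^sup>2) = (norm h)\<^sup>2"
      unfolding power2_norm_eq_inner by (subst euclidean_inner) (simp add: power2_eq_square)
    finally show "(q s)\<^sup>2 \<le> (norm h)\<^sup>2 * g s" by (simp add: g_def gradient_square_def)
  qed (intro integrable_continuous_real continuous_intros cq cg)+
  also have "\<dots> = (norm h)\<^sup>2 * integral {0..1} g" by simp
  finally have "ennreal ((\<phi> (x + h) - \<phi> x)\<^sup>2) \<le> ennreal ((norm h)\<^sup>2) * ennreal (integral {0..1} g)"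
    by (subst ennreal_mult[symmetric]) (auto intro!: ennreal_leI integral_nonneg integrable_continuous_real cg
        simp: g_def gradient_square_nonneg)
  also have "ennreal (integral {0..1} g) = (\<integral>\<^sup>+s. ennreal (g s) * indicator {0..1} s \<partial>lborel)"
  proof (rule nn_integral_has_integral_lebesgue'[symmetric])
    show "(g has_integral integral {0..1} g) {0..1}"
      by (intro integrable_integral integrable_continuous_real cg)
  qed (simp add: g_def gradient_square_nonneg)
  finally show ?thesis by (simp only: g_def)
qed

lemma nn_integral_lborel_translate:
  fixes f :: "'a::euclidean_space \<Rightarrow> ennreal"
  assumes [measurable]: "f \<in> borel_measurable borel"
  shows "(\<integral>\<^sup>+x. f (c + x) \<partial>lborel) = (\<integral>\<^sup>+x. f x \<partial>lborel)"
  by (subst (2) lborel_distr_plus[of c, symmetric]) (simp add: nn_integral_distr)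

lemma test_function_translation:
  fixes \<phi> :: "'a::euclidean_space \<Rightarrow> real"
  assumes \<phi>: "\<phi> \<in> test_functions U"
  shows "(\<integral>\<^sup>+x. ennreal ((\<phi> (x + h) - \<phi> x)\<^sup>2) \<partial>lborel)
    \<le> ennreal ((norm h)\<^sup>2) * (\<integral>\<^sup>+x. ennreal (gradient_square \<phi> x) \<partial>lborel)"
proof -
  have [measurable]: "gradient_square \<phi> \<in> borel_measurable borel"
    by (intro borel_measurable_continuous_onI gradient_square_continuous[OF \<phi>])
  have "(\<integral>\<^sup>+x. ennreal ((\<phi> (x + h) - \<phi> x)\<^sup>2) \<partial>lborel)
    \<le> (\<integral>\<^sup>+x. ennreal ((norm h)\<^sup>2) * (\<integral>\<^sup>+s. ennreal (gradient_square \<phi> (x + s *\<^sub>R h)) * indicator {0..1} s \<partial>lborel) \<partial>lborel)"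
    by (intro nn_integral_mono test_function_difference_le[OF \<phi>])
  also have "\<dots> = ennreal ((norm h)\<^sup>2) * (\<integral>\<^sup>+x. (\<integral>\<^sup>+s. ennreal (gradient_square \<phi> (x + s *\<^sub>R h)) * indicator {0..1} s \<partial>lborel) \<partial>lborel)"
    by (rule nn_integral_cmult) measurable
  also have "(\<integral>\<^sup>+x. (\<integral>\<^sup>+s. ennreal (gradient_square \<phi> (x + s *\<^sub>R h)) * indicator {0..1} s \<partial>lborel) \<partial>lborel)
    = (\<integral>\<^sup>+s. (\<integral>\<^sup>+x. ennreal (gradient_square \<phi> (x + s *\<^sub>R h)) * indicator {0..1} s \<partial>lborel) \<partial>lborel)"
    by (rule lborel_pair.Fubini'[symmetric]) measurable
  also have "\<dots> = (\<integral>\<^sup>+s. (\<integral>\<^sup>+x. ennreal (gradient_square \<phi> x) \<partial>lborel) * indicator {0..1} (s::real) \<partial>lborel)"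
  proof (rule nn_integral_cong)
    fix s :: real
    have "(\<integral>\<^sup>+x. ennreal (gradient_square \<phi> (x + s *\<^sub>R h)) * indicator {0..1} s \<partial>lborel)
        = (\<integral>\<^sup>+x. ennreal (gradient_square \<phi> (s *\<^sub>R h + x)) \<partial>lborel) * indicator {0..1} s"
      by (subst nn_integral_multc) (auto simp: add.commute)
    also have "(\<integral>\<^sup>+x. ennreal (gradient_square \<phi> (s *\<^sub>R h + x)) \<partial>lborel) = (\<integral>\<^sup>+x. ennreal (gradient_square \<phi> x) \<partial>lborel)"
      by (rule nn_integral_lborel_translate) measurable
    finally show "(\<integral>\<^sup>+x. ennreal (gradient_square \<phi> (x + s *\<^sub>R h)) * indicator {0..1} s \<partial>lborel)
        = (\<integral>\<^sup>+x. ennreal (gradient_square \<phi> x) \<partial>lborel) * indicator {0..1} s" .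
  qed
  also have "\<dots> = (\<integral>\<^sup>+x. ennreal (gradient_square \<phi> x) \<partial>lborel)"
    by (simp add: nn_integral_cmult_indicator)
  finally show ?thesis .
qed

definition cell :: "real \<Rightarrow> 'a::euclidean_space set" where
  "cell \<delta> = cbox 0 (\<delta> *\<^sub>R One)"

lemma measure_cell: "\<delta> \<ge> 0 \<Longrightarrow> measure lborel (cell \<delta> :: 'a::euclidean_space set) = \<delta> ^ DIM('a)"
  unfolding cell_def by (subst content_cbox) (auto simp: inner_Basis)

lemma cell_sets [measurable]: "cell \<delta> \<in> sets borel"
  by (simp add: cell_def)

lemma norm_cell:
  assumes "h \<in> (cell \<delta> :: 'a::euclidean_space set)"
  shows "(norm h)\<^sup>2 \<le> real DIM('a) * \<delta>\<^sup>2"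
proof -
  have "(norm h)\<^sup>2 = (\<Sum>i\<in>Basis. (inner h i)\<^sup>2)"
    unfolding power2_norm_eq_inner by (subst euclidean_inner) (simp add: power2_eq_square)
  also have "\<dots> \<le> (\<Sum>i\<in>(Basis::'a set). \<delta>\<^sup>2)"
    using assms by (intro sum_mono power_mono) (auto simp: cell_def mem_box)
  finally show ?thesis by simp
qed

text \<open>
  With $c$ the average of $f$ over the cell, the mean of $(f - f(x))^2$ is at least
  $(f(x) - c)^2$, and $f(x)^2 \le 2 (f(x) - c)^2 + 2 c^2$.
\<close>

lemma average_inequality:
  fixes f :: "'a::euclidean_space \<Rightarrow> real"
  assumes f: "continuous_on UNIV f" and "\<delta> > 0"
  shows "\<delta> ^ DIM('a) * (f x)\<^sup>2 \<le> 2 * integral (cell \<delta>) (\<lambda>h. (f (x + h) - f x)\<^sup>2)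
           + 2 / \<delta> ^ DIM('a) * (integral (cell \<delta>) (\<lambda>h. f (x + h)))\<^sup>2"
proof -
  let ?m = "\<delta> ^ DIM('a)" and ?I = "integral (cell \<delta>) (\<lambda>h. f (x + h))"
  let ?Q = "integral (cell \<delta>) (\<lambda>h. (f (x + h) - f x)\<^sup>2)"
  have m: "?m > 0" using assms by simp
  define c where "c = ?I / ?m"
  have I: "?I = c * ?m" using assms by (simp add: c_def)
  have cont: "continuous_on A (\<lambda>h. f (x + h))" for A
    by (rule continuous_on_compose2[OF f]) (auto intro!: continuous_intros)
  have i1: "((\<lambda>h. f (x + h)) has_integral ?I) (cell \<delta>)"
    unfolding cell_def by (intro integrable_integral integrable_continuous cont)
  have "((\<lambda>h. (2 * c - 2 * f x) * f (x + h) + ((f x)\<^sup>2 - c\<^sup>2)) has_integral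
      (2 * c - 2 * f x) * ?I + ?m * ((f x)\<^sup>2 - c\<^sup>2)) (cell \<delta>)"
    using has_integral_add[OF has_integral_mult_right[OF i1]
        has_integral_const[of "(f x)\<^sup>2 - c\<^sup>2" 0 "\<delta> *\<^sub>R One", folded cell_def], of "2 * c - 2 * f x"]
      measure_cell[of \<delta>, where 'a = 'a] assms by (simp add: mult.commute)
  moreover have "((\<lambda>h. (f (x + h) - f x)\<^sup>2) has_integral ?Q) (cell \<delta>)"
    unfolding cell_def by (intro integrable_integral integrable_continuous continuous_intros cont)
  moreover have "(2 * c - 2 * f x) * f (x + h) + ((f x)\<^sup>2 - c\<^sup>2) \<le> (f (x + h) - f x)\<^sup>2" for h
    using zero_le_power2[of "f (x + h) - c"] by (simp add: power2_diff algebra_simps)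
  ultimately have "(2 * c - 2 * f x) * ?I + ?m * ((f x)\<^sup>2 - c\<^sup>2) \<le> ?Q"
    by (rule has_integral_le)
  moreover have "(2 * c - 2 * f x) * ?I + ?m * ((f x)\<^sup>2 - c\<^sup>2) = ?m * (f x - c)\<^sup>2"
    unfolding I by (simp add: power2_eq_square algebra_simps)
  moreover have "?m * (f x)\<^sup>2 \<le> ?m * (2 * (f x - c)\<^sup>2 + 2 * c\<^sup>2)"
    using zero_le_power2[of "f x - 2 * c"] m by (intro mult_left_mono) (auto simp: power2_diff algebra_simps)
  moreover have "2 / ?m * ?I\<^sup>2 = ?m * (2 * c\<^sup>2)"
    unfolding I using m by (simp add: power2_eq_square)
  ultimately show ?thesis by (simp add: algebra_simps)
qed

lemma square_integrable_indicator_cbox: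
  "square_integrable (indicator (cbox a b) :: 'a::euclidean_space \<Rightarrow> real)"
proof -
  have "cbox a b \<in> sets lebesgue" by simp
  then have "(indicator (cbox a b) :: 'a \<Rightarrow> real) \<in> borel_measurable lebesgue"
    by (rule borel_measurable_indicator)
  then show ?thesis
    unfolding square_integrable_def
    by (simp add: power2_eq_square emeasure_lborel_cbox_eq flip: indicator_inter_arith)
qed

lemma norm_indicator_cell:
  "\<delta> \<ge> 0 \<Longrightarrow> (norm (L2_of (indicator (cbox x (x + \<delta> *\<^sub>R One)) :: 'a::euclidean_space \<Rightarrow> real)))\<^sup>2 = \<delta> ^ DIM('a)"
  unfolding norm_L2_of_power2[OF square_integrable_indicator_cbox]
  by (simp add: power2_eq_square content_cbox_if box_eq_empty inner_add_left flip: indicator_inter_arith)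

lemma integral_cell_eq_inner:
  fixes \<phi> :: "'a::euclidean_space \<Rightarrow> real"
  assumes \<phi>: "\<phi> \<in> test_functions U"
  shows "integral (cell \<delta>) (\<lambda>h. \<phi> (x + h)) = inner (L2_of \<phi>) (L2_of (indicator (cbox x (x + \<delta> *\<^sub>R One))))"
proof -
  let ?B = "cbox x (x + \<delta> *\<^sub>R One)"
  note sq = test_function_square_integrable[OF \<phi>] square_integrable_indicator_cbox
  have "((\<lambda>y. \<phi> y * indicator ?B y) has_integral inner (L2_of \<phi>) (L2_of (indicator ?B))) UNIV"
    unfolding inner_L2_of[OF sq] by (intro has_integral_integral_lebesgue square_integrable_mult sq)
  also have "(\<lambda>y. \<phi> y * indicator ?B y) = (\<lambda>y. if y \<in> ?B then \<phi> y else 0)"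
    by (auto simp: fun_eq_iff)
  finally have "(\<phi> has_integral inner (L2_of \<phi>) (L2_of (indicator ?B))) ?B" by simp
  then have "integral ?B \<phi> = inner (L2_of \<phi>) (L2_of (indicator ?B))" by (rule integral_unique)
  moreover have "integral (cell \<delta>) (\<lambda>h. \<phi> (x + h)) = integral ?B \<phi>"
    using integral_shift_cbox_plus[of 0 "\<delta> *\<^sub>R One" \<phi> x] by (simp add: cell_def o_def add.commute)
  ultimately show ?thesis by simp
qed

text \<open>
  A quantitative Rellich inequality. Comparing each function with its averages over cells of side
  $\delta$ costs a multiple of $\delta^2$ times the Dirichlet integral; the averages are inner
  products with the indicators of cells, over which an almost orthonormal family has
  bounded total mass.
\<close>

lemma cell_average_estimate:
  fixes \<phi> :: "nat \<Rightarrow> 'a::euclidean_space \<Rightarrow> real"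
  assumes \<phi>: "\<And>j. j \<in> {1..n} \<Longrightarrow> \<phi> j \<in> test_functions U"
    and U: "open U" "bounded U" and \<delta>: "\<delta> > 0" and c: "c \<ge> 0"
    and bessel: "\<And>b. (\<Sum>j=1..n. (inner (L2_of (\<phi> j)) b)\<^sup>2) \<le> c * (norm b)\<^sup>2"
  shows "(\<Sum>j=1..n. (norm (L2_of (\<phi> j)))\<^sup>2)
    \<le> 2 * real DIM('a) * \<delta>\<^sup>2 * (\<Sum>j=1..n. \<Sum>i\<in>Basis. (norm (L2_of (pderivative i (\<phi> j))))\<^sup>2)
      + 2 * c * measure lborel U / \<delta> ^ DIM('a)"
proof -
  let ?m = "\<delta> ^ DIM('a)" and ?d = "real DIM('a)"
  have m: "?m > 0" using \<delta> by simp
  have meas: "\<phi> j \<in> borel_measurable borel" "gradient_square (\<phi> j) \<in> borel_measurable borel" if "j \<in> {1..n}" for j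
    using borel_measurable_continuous_onI[OF test_function_continuous[OF \<phi>[OF that]]]
      borel_measurable_continuous_onI[OF gradient_square_continuous[OF \<phi>[OF that]]] by auto
  have [measurable]: "U \<in> sets borel" using U by auto
  have Ufin: "emeasure lborel U = ennreal (measure lborel U)"
    using emeasure_bounded_finite[OF U(2)] by (intro emeasure_eq_ennreal_measure) auto
  define G where "G j = (\<Sum>i\<in>Basis. (norm (L2_of (pderivative i (\<phi> j))))\<^sup>2)" for j
  have G0: "G j \<ge> 0" for j by (simp add: G_def sum_nonneg)
  have G: "(\<integral>\<^sup>+x. ennreal (gradient_square (\<phi> j) x) \<partial>lborel) = ennreal (G j)" if j: "j \<in> {1..n}" for j
  proof -
    have pm: "pderivative i (\<phi> j) \<in> borel_measurable borel" if "i \<in> Basis" for i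
      by (intro borel_measurable_continuous_onI test_function_pderivative_continuous[OF \<phi>[OF j] that])
    have "(\<integral>\<^sup>+x. ennreal (gradient_square (\<phi> j) x) \<partial>lborel)
        = (\<integral>\<^sup>+x. (\<Sum>i\<in>Basis. ennreal ((pderivative i (\<phi> j) x)\<^sup>2)) \<partial>lborel)"
      by (simp add: gradient_square_def sum_ennreal)
    also have "\<dots> = (\<Sum>i\<in>Basis. \<integral>\<^sup>+x. ennreal ((pderivative i (\<phi> j) x)\<^sup>2) \<partial>lborel)"
      using pm by (intro nn_integral_sum) simp
    also have "\<dots> = (\<Sum>i\<in>Basis. ennreal ((norm (L2_of (pderivative i (\<phi> j))))\<^sup>2))"
      by (intro sum.cong refl)
         (simp add: ennreal_norm_L2_of[OF test_function_pderivative_square_integrable[OF \<phi>[OF j]]] nn_integral_completion)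
    finally show ?thesis by (simp add: G_def sum_ennreal)
  qed
  define Q where "Q j x = (\<integral>\<^sup>+h. ennreal ((\<phi> j (x + h) - \<phi> j x)\<^sup>2) * indicator (cell \<delta>) h \<partial>lborel)" for j x
  have Qm: "Q j \<in> borel_measurable borel" if "j \<in> {1..n}" for j
    unfolding Q_def using meas[OF that] by measurable
  have Q: "(\<integral>\<^sup>+x. Q j x \<partial>lborel) \<le> ennreal (?m * (?d * \<delta>\<^sup>2 * G j))" if j: "j \<in> {1..n}" for j
  proof -
    note [measurable] = meas[OF j]
    have "(\<integral>\<^sup>+x. Q j x \<partial>lborel)
        = (\<integral>\<^sup>+h. (\<integral>\<^sup>+x. ennreal ((\<phi> j (x + h) - \<phi> j x)\<^sup>2) * indicator (cell \<delta>) h \<partial>lborel) \<partial>lborel)"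
      unfolding Q_def by (rule lborel_pair.Fubini'[symmetric]) measurable
    also have "\<dots> \<le> (\<integral>\<^sup>+h. ennreal (?d * \<delta>\<^sup>2 * G j) * indicator (cell \<delta>) h \<partial>(lborel :: 'a measure))"
    proof (rule nn_integral_mono)
      fix h :: 'a
      have "(\<integral>\<^sup>+x. ennreal ((\<phi> j (x + h) - \<phi> j x)\<^sup>2) * indicator (cell \<delta>) h \<partial>lborel)
          \<le> ennreal ((norm h)\<^sup>2) * ennreal (G j) * indicator (cell \<delta>) h"
        using test_function_translation[OF \<phi>[OF j], of h]
        by (subst nn_integral_multc) (auto simp: G[OF j] intro!: mult_right_mono)
      also have "\<dots> \<le> ennreal (?d * \<delta>\<^sup>2 * G j) * indicator (cell \<delta>) h"
        using norm_cell[of h \<delta>] G0[of j]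
        by (auto simp: indicator_def intro!: ennreal_leI mult_right_mono simp flip: ennreal_mult)
      finally show "(\<integral>\<^sup>+x. ennreal ((\<phi> j (x + h) - \<phi> j x)\<^sup>2) * indicator (cell \<delta>) h \<partial>lborel)
          \<le> ennreal (?d * \<delta>\<^sup>2 * G j) * indicator (cell \<delta>) h" .
    qed
    also have "\<dots> = ennreal (?d * \<delta>\<^sup>2 * G j) * emeasure lborel (cell \<delta> :: 'a set)"
      by (rule nn_integral_cmult_indicator) simp
    also have "emeasure lborel (cell \<delta> :: 'a set) = ennreal ?m"
      using measure_cell[of \<delta>, where 'a = 'a] \<delta> unfolding cell_def
      by (subst emeasure_eq_ennreal_measure) (auto simp: emeasure_lborel_cbox_eq)
    finally show ?thesis
      using \<delta> G0[of j] by (simp add: mult_ac flip: ennreal_mult)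
  qed
  have pointwise: "ennreal (?m * (\<Sum>j=1..n. (\<phi> j x)\<^sup>2)) \<le> (\<Sum>j=1..n. 2 * Q j x) + ennreal (2 * c) * indicator U x" for x
  proof (cases "x \<in> U")
    case True
    let ?b = "L2_of (indicator (cbox x (x + \<delta> *\<^sub>R One)) :: 'a \<Rightarrow> real)"
    define q where "q j = integral (cell \<delta>) (\<lambda>h. (\<phi> j (x + h) - \<phi> j x)\<^sup>2)" for j
    have q0: "q j \<ge> 0" and qQ: "Q j x = ennreal (q j)" if j: "j \<in> {1..n}" for j
    proof -
      have "continuous_on (cell \<delta>) (\<lambda>h. \<phi> j (x + h))"
        by (rule continuous_on_compose2[OF test_function_continuous[OF \<phi>[OF j]]]) (auto intro!: continuous_intros)
      then have i: "((\<lambda>h. (\<phi> j (x + h) - \<phi> j x)\<^sup>2) has_integral q j) (cell \<delta>)"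
        unfolding q_def cell_def by (intro integrable_integral integrable_continuous continuous_intros)
      show "q j \<ge> 0" by (rule has_integral_nonneg[OF i]) simp
      show "Q j x = ennreal (q j)"
        unfolding Q_def by (rule nn_integral_has_integral_lebesgue'[OF _ i]) simp
    qed
    have "?m * (\<Sum>j=1..n. (\<phi> j x)\<^sup>2) \<le> (\<Sum>j=1..n. 2 * q j + 2 / ?m * (inner (L2_of (\<phi> j)) ?b)\<^sup>2)"
      unfolding sum_distrib_left q_def
    proof (rule sum_mono)
      fix j assume j: "j \<in> {1..n}"
      show "?m * (\<phi> j x)\<^sup>2 \<le> 2 * integral (cell \<delta>) (\<lambda>h. (\<phi> j (x + h) - \<phi> j x)\<^sup>2) + 2 / ?m * (inner (L2_of (\<phi> j)) ?b)\<^sup>2"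
        using average_inequality[OF test_function_continuous[OF \<phi>[OF j]] \<delta>, of x]
        by (simp add: integral_cell_eq_inner[OF \<phi>[OF j]])
    qed
    also have "\<dots> = (\<Sum>j=1..n. 2 * q j) + 2 / ?m * (\<Sum>j=1..n. (inner (L2_of (\<phi> j)) ?b)\<^sup>2)"
      by (simp add: sum.distrib sum_distrib_left)
    also have "\<dots> \<le> (\<Sum>j=1..n. 2 * q j) + 2 / ?m * (c * ?m)"
    proof (intro add_left_mono mult_left_mono)
      have "(norm ?b)\<^sup>2 = ?m"
        using \<delta> by (intro norm_indicator_cell) simp
      then show "(\<Sum>j=1..n. (inner (L2_of (\<phi> j)) ?b)\<^sup>2) \<le> c * ?m" using bessel[of ?b] by simp
    qed (use m in simp)
    also have "\<dots> = (\<Sum>j=1..n. 2 * q j) + 2 * c" using \<delta> by simp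
    finally have "ennreal (?m * (\<Sum>j=1..n. (\<phi> j x)\<^sup>2)) \<le> ennreal ((\<Sum>j=1..n. 2 * q j) + 2 * c)"
      by (rule ennreal_leI)
    also have "\<dots> = (\<Sum>j=1..n. ennreal (2 * q j)) + ennreal (2 * c)"
      using q0 c by (subst sum_ennreal) (auto intro!: ennreal_plus sum_nonneg)
    also have "(\<Sum>j=1..n. ennreal (2 * q j)) = (\<Sum>j=1..n. 2 * Q j x)"
      using q0 by (intro sum.cong) (auto simp: qQ ennreal_mult)
    finally show ?thesis using True by simp
  next
    case False
    then have "\<phi> j x = 0" if "j \<in> {1..n}" for j
      using test_function_zero_outside[OF \<phi>[OF that]] by simp
    then show ?thesis by simp
  qed
  have "ennreal (?m * (\<Sum>j=1..n. (norm (L2_of (\<phi> j)))\<^sup>2)) = (\<integral>\<^sup>+x. ennreal (?m * (\<Sum>j=1..n. (\<phi> j x)\<^sup>2)) \<partial>lborel)"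
  proof -
    have "ennreal (?m * (\<Sum>j=1..n. (norm (L2_of (\<phi> j)))\<^sup>2)) = ennreal ?m * (\<Sum>j=1..n. ennreal ((norm (L2_of (\<phi> j)))\<^sup>2))"
      using m by (simp add: ennreal_mult sum_nonneg sum_ennreal)
    also have "(\<Sum>j=1..n. ennreal ((norm (L2_of (\<phi> j)))\<^sup>2)) = (\<Sum>j=1..n. \<integral>\<^sup>+x. ennreal ((\<phi> j x)\<^sup>2) \<partial>lborel)"
      by (intro sum.cong refl)
         (simp only: ennreal_norm_L2_of[OF test_function_square_integrable[OF \<phi>]] nn_integral_completion)
    also have "\<dots> = (\<integral>\<^sup>+x. (\<Sum>j=1..n. ennreal ((\<phi> j x)\<^sup>2)) \<partial>lborel)"
      using meas by (intro nn_integral_sum[symmetric]) simp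
    also have "ennreal ?m * \<dots> = (\<integral>\<^sup>+x. ennreal ?m * (\<Sum>j=1..n. ennreal ((\<phi> j x)\<^sup>2)) \<partial>lborel)"
      using meas by (intro nn_integral_cmult[symmetric]) simp
    also have "\<dots> = (\<integral>\<^sup>+x. ennreal (?m * (\<Sum>j=1..n. (\<phi> j x)\<^sup>2)) \<partial>lborel)"
      using m by (simp add: ennreal_mult sum_nonneg sum_ennreal)
    finally show ?thesis .
  qed
  also have "\<dots> \<le> (\<integral>\<^sup>+x. (\<Sum>j=1..n. 2 * Q j x) + ennreal (2 * c) * indicator U x \<partial>lborel)"
    by (intro nn_integral_mono pointwise)
  also have "\<dots> = (\<integral>\<^sup>+x. (\<Sum>j=1..n. 2 * Q j x) \<partial>lborel) + (\<integral>\<^sup>+x. ennreal (2 * c) * indicator U x \<partial>lborel)"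
    using Qm by (intro nn_integral_add) auto
  also have "(\<integral>\<^sup>+x. (\<Sum>j=1..n. 2 * Q j x) \<partial>lborel) = (\<Sum>j=1..n. 2 * (\<integral>\<^sup>+x. Q j x \<partial>lborel))"
    using Qm by (subst nn_integral_sum) (auto intro!: sum.cong nn_integral_cmult)
  also have "\<dots> \<le> (\<Sum>j=1..n. 2 * ennreal (?m * (?d * \<delta>\<^sup>2 * G j)))"
    by (intro sum_mono mult_left_mono Q) auto
  also have "\<dots> = ennreal (\<Sum>j=1..n. 2 * (?m * (?d * \<delta>\<^sup>2 * G j)))"
    using m \<delta> by (subst sum_ennreal[symmetric])
      (auto simp: G0 ennreal_mult intro!: mult_nonneg_nonneg)
  also have "(\<integral>\<^sup>+x. ennreal (2 * c) * indicator U x \<partial>lborel) = ennreal (2 * c * measure lborel U)"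
    using c by (subst nn_integral_cmult_indicator) (auto simp: Ufin ennreal_mult)
  finally have "ennreal (?m * (\<Sum>j=1..n. (norm (L2_of (\<phi> j)))\<^sup>2))
      \<le> ennreal ((\<Sum>j=1..n. 2 * (?m * (?d * \<delta>\<^sup>2 * G j))) + 2 * c * measure lborel U)"
    using m \<delta> c by (subst ennreal_plus) (auto simp: G0 intro!: mult_nonneg_nonneg sum_nonneg add_right_mono)
  then have "?m * (\<Sum>j=1..n. (norm (L2_of (\<phi> j)))\<^sup>2) \<le> (\<Sum>j=1..n. 2 * (?m * (?d * \<delta>\<^sup>2 * G j))) + 2 * c * measure lborel U"
    by (rule ennreal_le_iff[THEN iffD1, rotated])
       (use m \<delta> c in \<open>auto simp: G0 intro!: add_nonneg_nonneg mult_nonneg_nonneg sum_nonneg\<close>)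
  also have "(\<Sum>j=1..n. 2 * (?m * (?d * \<delta>\<^sup>2 * G j))) = ?m * (2 * ?d * \<delta>\<^sup>2 * (\<Sum>j=1..n. G j))"
    by (simp add: sum_distrib_left mult_ac)
  also have "\<dots> + 2 * c * measure lborel U = ?m * (2 * ?d * \<delta>\<^sup>2 * (\<Sum>j=1..n. G j) + 2 * c * measure lborel U / ?m)"
    using \<delta> by (simp add: distrib_left)
  finally show ?thesis using m by (simp add: G_def)
qed

context schroedinger
begin

text \<open>
  The estimate is applied to test functions approximating the eigenfunctions. Their deviation from
  orthonormality enters through the constant in Bessel's inequality, which tends to 2.
\<close>

lemma counting_inequality:
  assumes \<delta>: "\<delta> > 0"
  shows "real n \<le> 2 * real DIM('a) * \<delta>\<^sup>2 * (\<Sum>j=1..n. lam j + \<gamma>0) + 4 * measure lborel \<Omega> / \<delta> ^ DIM('a)"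
proof -
  let ?d = "real DIM('a)"
  have "\<exists>\<phi>. (\<forall>k. \<phi> k \<in> test_functions \<Omega>) \<and> (\<lambda>k. L2_of (\<phi> k)) \<longlonglongrightarrow> \<xi> j \<and>
      (\<forall>i\<in>Basis. (\<lambda>k. L2_of (pderivative i (\<phi> k))) \<longlonglongrightarrow> weak_derivative \<Omega> i (\<xi> j))" if "j \<in> {1..n}" for j
    using basis_dom[of j] that by (auto simp: dom_A_def H10_def)
  then obtain \<phi> where \<phi>: "\<And>j k. j \<in> {1..n} \<Longrightarrow> \<phi> j k \<in> test_functions \<Omega>"
      "\<And>j. j \<in> {1..n} \<Longrightarrow> (\<lambda>k. L2_of (\<phi> j k)) \<longlonglongrightarrow> \<xi> j"
      "\<And>i j. j \<in> {1..n} \<Longrightarrow> i \<in> Basis \<Longrightarrow> (\<lambda>k. L2_of (pderivative i (\<phi> j k))) \<longlonglongrightarrow> weak_derivative \<Omega> i (\<xi> j)"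
    by metis
  define c where "c k = 2 + 2 * (\<Sum>j=1..n. (norm (L2_of (\<phi> j k) - \<xi> j))\<^sup>2)" for k
  have c0: "c k \<ge> 0" for k by (simp add: c_def sum_nonneg)
  have bess: "(\<Sum>j=1..n. (inner (L2_of (\<phi> j k)) b)\<^sup>2) \<le> c k * (norm b)\<^sup>2" for b k
  proof -
    have "(\<Sum>j=1..n. (inner (L2_of (\<phi> j k)) b)\<^sup>2)
        \<le> (\<Sum>j=1..n. 2 * (inner b (\<xi> j))\<^sup>2 + 2 * ((norm (L2_of (\<phi> j k) - \<xi> j))\<^sup>2 * (norm b)\<^sup>2))"
    proof (rule sum_mono)
      fix j
      let ?x = "inner b (\<xi> j)" and ?y = "inner (L2_of (\<phi> j k) - \<xi> j) b"
      have "inner (L2_of (\<phi> j k)) b = ?x + ?y" by (simp add: inner_diff_left inner_commute[of b])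
      moreover have "(?x + ?y)\<^sup>2 \<le> 2 * ?x\<^sup>2 + 2 * ?y\<^sup>2"
        using zero_le_power2[of "?x - ?y"] by (simp only: power2_diff power2_sum)
      moreover have "?y\<^sup>2 \<le> (norm (L2_of (\<phi> j k) - \<xi> j))\<^sup>2 * (norm b)\<^sup>2"
        using Cauchy_Schwarz_ineq[of "L2_of (\<phi> j k) - \<xi> j" b] by (simp add: power2_norm_eq_inner)
      ultimately show "(inner (L2_of (\<phi> j k)) b)\<^sup>2 \<le> 2 * ?x\<^sup>2 + 2 * ((norm (L2_of (\<phi> j k) - \<xi> j))\<^sup>2 * (norm b)\<^sup>2)"
        by simp
    qed
    also have "\<dots> = 2 * (\<Sum>j=1..n. (inner b (\<xi> j))\<^sup>2) + 2 * (\<Sum>j=1..n. (norm (L2_of (\<phi> j k) - \<xi> j))\<^sup>2) * (norm b)\<^sup>2"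
      by (simp add: sum.distrib sum_distrib_left sum_distrib_right mult_ac)
    also have "\<dots> \<le> c k * (norm b)\<^sup>2" using bessel[of b n] by (simp add: c_def distrib_right)
    finally show ?thesis .
  qed
  have "(\<Sum>j=1..n. (norm (\<xi> j))\<^sup>2) \<le>
      2 * ?d * \<delta>\<^sup>2 * (\<Sum>j=1..n. \<Sum>i\<in>Basis. (norm (weak_derivative \<Omega> i (\<xi> j)))\<^sup>2)
      + 2 * (2 + 2 * (\<Sum>j=1..n. (norm (\<xi> j - \<xi> j))\<^sup>2)) * measure lborel \<Omega> / \<delta> ^ DIM('a)"
  proof (rule LIMSEQ_le)
    show "(\<lambda>k. \<Sum>j=1..n. (norm (L2_of (\<phi> j k)))\<^sup>2) \<longlonglongrightarrow> (\<Sum>j=1..n. (norm (\<xi> j))\<^sup>2)"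
      by (intro tendsto_intros \<phi>)
    show "(\<lambda>k. 2 * ?d * \<delta>\<^sup>2 * (\<Sum>j=1..n. \<Sum>i\<in>Basis. (norm (L2_of (pderivative i (\<phi> j k))))\<^sup>2)
        + 2 * c k * measure lborel \<Omega> / \<delta> ^ DIM('a))
      \<longlonglongrightarrow> 2 * ?d * \<delta>\<^sup>2 * (\<Sum>j=1..n. \<Sum>i\<in>Basis. (norm (weak_derivative \<Omega> i (\<xi> j)))\<^sup>2)
        + 2 * (2 + 2 * (\<Sum>j=1..n. (norm (\<xi> j - \<xi> j))\<^sup>2)) * measure lborel \<Omega> / \<delta> ^ DIM('a)"
      unfolding c_def using \<delta> by (intro tendsto_intros \<phi>) auto
    show "\<exists>N. \<forall>k\<ge>N. (\<Sum>j=1..n. (norm (L2_of (\<phi> j k)))\<^sup>2)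
      \<le> 2 * ?d * \<delta>\<^sup>2 * (\<Sum>j=1..n. \<Sum>i\<in>Basis. (norm (L2_of (pderivative i (\<phi> j k))))\<^sup>2)
        + 2 * c k * measure lborel \<Omega> / \<delta> ^ DIM('a)"
      by (intro exI allI impI cell_average_estimate open_\<Omega> bounded_\<Omega> \<delta> c0 bess \<phi>)
  qed
  then have "real n \<le> 2 * ?d * \<delta>\<^sup>2 * (\<Sum>j=1..n. \<Sum>i\<in>Basis. (norm (weak_derivative \<Omega> i (\<xi> j)))\<^sup>2)
      + 4 * measure lborel \<Omega> / \<delta> ^ DIM('a)" by simp
  also have "\<dots> \<le> 2 * ?d * \<delta>\<^sup>2 * (\<Sum>j=1..n. lam j + \<gamma>0) + 4 * measure lborel \<Omega> / \<delta> ^ DIM('a)"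
    by (intro add_right_mono mult_left_mono sum_mono gradient_basis_le) auto
  finally show ?thesis .
qed

text \<open>
  Only the logarithm of the number of eigenvalues enters the exponent in the bound for the feedback,
  so a bound that is exponential in $\Lambda$ suffices. Taking $\delta$ of order $1 / (\Lambda + \gamma_0 + 1)$
  absorbs the Dirichlet term into the left hand side.
\<close>

lemma counting_bound:
  assumes "n \<ge> 1" "lam n \<le> \<Lambda>"
  shows "real n \<le> 8 * measure lborel \<Omega> * exp (4 * (real DIM('a))\<^sup>2 * (\<Lambda> + \<gamma>0 + 1))"
proof -
  let ?d = "real DIM('a)"
  define K where "K = \<Lambda> + \<gamma>0"
  define s where "s = 4 * ?d * (K + 1)"
  have d: "?d \<ge> 1" using DIM_positive[where 'a = 'a] by linarith
  have K: "K \<ge> 0" using lam_ge[OF assms(1)] assms(2) by (simp add: K_def)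
  have s: "s > 0" using d K by (simp add: s_def)
  have "(\<Sum>j=1..n. lam j + \<gamma>0) \<le> (\<Sum>j=1..n. K)"
  proof (rule sum_mono)
    fix j assume "j \<in> {1..n}"
    then show "lam j + \<gamma>0 \<le> K" using lam_mono[of j n] assms(2) by (simp add: K_def)
  qed
  then have "2 * ?d * (1 / s)\<^sup>2 * (\<Sum>j=1..n. lam j + \<gamma>0) \<le> 2 * ?d * (1 / s)\<^sup>2 * (real n * K)"
    by (intro mult_left_mono) auto
  also have "\<dots> = (2 * ?d * K / s\<^sup>2) * real n" by (simp add: power_divide)
  also have "\<dots> \<le> 1 / 2 * real n"
  proof (rule mult_right_mono)
    have "1 * K \<le> ?d * (K + 1)" using d K by (intro mult_mono) auto
    then have "4 * ?d * K \<le> s * 1" using d K by (simp add: s_def)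
    also have "\<dots> \<le> s * s" using s d K mult_mono[of 1 ?d 1 "K + 1"] by (intro mult_left_mono) (auto simp: s_def)
    finally show "2 * ?d * K / s\<^sup>2 \<le> 1 / 2" using s by (simp add: field_simps power2_eq_square)
  qed simp
  finally have "real n \<le> 1 / 2 * real n + 4 * measure lborel \<Omega> / (1 / s) ^ DIM('a)"
    using counting_inequality[of "1 / s" n] s by simp
  then have "real n \<le> 8 * measure lborel \<Omega> * s ^ DIM('a)"
    by (simp add: power_divide)
  also have "s ^ DIM('a) \<le> exp s ^ DIM('a)" using s exp_ge_add_one_self[of s] by (intro power_mono; linarith)
  also have "exp s ^ DIM('a) = exp (4 * ?d\<^sup>2 * (\<Lambda> + \<gamma>0 + 1))"
    by (simp add: s_def K_def power2_eq_square mult_ac flip: exp_of_nat_mult)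
  finally show ?thesis by (simp add: mult_left_mono)
qed

end

section \<open>Eigenvalue indices and the first positive eigenvalue\<close>

context schroedinger
begin

lemma finite_below: "finite {j. 1 \<le> j \<and> lam j \<le> \<Lambda>}"
proof (rule finite_subset)
  let ?B = "8 * measure lborel \<Omega> * exp (4 * (real DIM('a))\<^sup>2 * (\<Lambda> + \<gamma>0 + 1))"
  show "{j. 1 \<le> j \<and> lam j \<le> \<Lambda>} \<subseteq> {..nat \<lceil>?B\<rceil>}"
  proof safe
    fix j assume "1 \<le> j" "lam j \<le> \<Lambda>"
    from counting_bound[OF this] show "j \<le> nat \<lceil>?B\<rceil>" by linarith
  qed
qed simp

lemma finite_strictly_below: "finite {j. 1 \<le> j \<and> lam j < \<Lambda>}"
  by (rule finite_subset[OF _ finite_below[of \<Lambda>]]) auto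

lemma
  assumes "\<gamma> > 0" "T > 0"
  shows N_index_ge_1: "N_index lam \<gamma> T \<ge> 1"
    and lam_N_index: "lam (N_index lam \<gamma> T) < 2 * \<gamma> + ln 9 / T"
proof -
  let ?S = "{j. 1 \<le> j \<and> lam j < 2 * \<gamma> + ln 9 / T}"
  have "ln 9 / T > 0" using assms by simp
  then have "lam 1 < 2 * \<gamma> + ln 9 / T" using lam_1_neg assms by linarith
  then have "1 \<in> ?S" by simp
  then have "N_index lam \<gamma> T \<in> ?S"
    unfolding N_index_def by (intro Max_in finite_strictly_below) auto
  then show "N_index lam \<gamma> T \<ge> 1" "lam (N_index lam \<gamma> T) < 2 * \<gamma> + ln 9 / T" by auto
qed

lemma
  shows nonpos_count_ge_1: "nonpos_count lam \<ge> 1"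
    and lam_nonpos_count: "lam (nonpos_count lam) \<le> 0"
    and lam_after_nonpos_count: "lam (nonpos_count lam + 1) > 0"
proof -
  let ?S = "{j. 1 \<le> j \<and> lam j \<le> 0}"
  have "1 \<in> ?S" using lam_1_neg by simp
  then have "nonpos_count lam \<in> ?S"
    unfolding nonpos_count_def by (intro Max_in finite_below) auto
  then show "nonpos_count lam \<ge> 1" "lam (nonpos_count lam) \<le> 0" by auto
  show "lam (nonpos_count lam + 1) > 0"
  proof (rule ccontr)
    assume "\<not> lam (nonpos_count lam + 1) > 0"
    then have "nonpos_count lam + 1 \<in> ?S" by simp
    then have "nonpos_count lam + 1 \<le> nonpos_count lam"
      unfolding nonpos_count_def by (intro Max_ge finite_below)
    then show False by simp
  qed
qed

end

text \<open>
  The first positive eigenvalue is bounded independently of the potential. Take $K > m$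
  eigenfunctions of a reference potential with the same bound. The space spanned by the first
  $m$ eigenfunctions can absorb at most $m$ of their total mass $K$, so at least one unit lies in
  the spectral subspace above $\lambda_{m+1}$, while their total energy is controlled.
\<close>

lemma first_positive_eigenvalue_bound:
  assumes "schroedinger \<Omega> V lam \<xi> \<gamma>0" "schroedinger \<Omega> V' lam' \<xi>' \<gamma>0"
    and K: "K > nonpos_count lam"
  shows "lam (nonpos_count lam + 1) \<le> real K * (lam' K + 3 * \<gamma>0)"
proof -
  interpret A: schroedinger \<Omega> V lam \<xi> \<gamma>0 by fact
  interpret B: schroedinger \<Omega> V' lam' \<xi>' \<gamma>0 by fact
  define m where "m = nonpos_count lam"
  define L where "L = lam (m + 1)"
  have L: "L > 0" using A.lam_after_nonpos_count by (simp add: L_def m_def)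
  have each: "L + (\<Sum>l=1..m. (lam l - L) * (inner (\<xi>' j) (\<xi> l))\<^sup>2) \<le> lam' K + 2 * \<gamma>0" if j: "j \<in> {1..K}" for j
  proof -
    let ?u = "\<xi>' j"
    have n1: "norm ?u = 1" using j by simp
    have "L * (norm ?u)\<^sup>2 + (\<Sum>l=1..m. (lam l - L) * (inner ?u (\<xi> l))\<^sup>2) \<le> - inner (op_A \<Omega> V ?u) ?u"
      using j A.lam_mono by (intro A.quadratic_form_lower_bound B.basis_dom) (auto simp: L_def)
    also have "\<dots> = - inner (op_A \<Omega> V' ?u) ?u + inner (mult_op \<Omega> V ?u) ?u - inner (mult_op \<Omega> V' ?u) ?u"
      by (simp add: op_A_def inner_diff_left)
    also have "- inner (op_A \<Omega> V' ?u) ?u = lam' j" using j by (simp add: B.eigen B.orthonormal)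
    also have "lam' j + inner (mult_op \<Omega> V ?u) ?u - inner (mult_op \<Omega> V' ?u) ?u \<le> lam' K + 2 * \<gamma>0"
      using inner_mult_op_bound[OF A.V_Linf A.\<Omega>_sets, of ?u] inner_mult_op_bound[OF B.V_Linf B.\<Omega>_sets, of ?u]
        B.lam_mono[of j K] j A.\<gamma>0 B.\<gamma>0 A.\<gamma>0_pos n1 by simp
    finally show ?thesis using n1 by simp
  qed
  have "(\<Sum>j=1..K. L + (\<Sum>l=1..m. (lam l - L) * (inner (\<xi>' j) (\<xi> l))\<^sup>2)) \<le> (\<Sum>j=1..K. lam' K + 2 * \<gamma>0)"
    by (intro sum_mono each)
  also have "(\<Sum>j=1..K. L + (\<Sum>l=1..m. (lam l - L) * (inner (\<xi>' j) (\<xi> l))\<^sup>2))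
      = real K * L + (\<Sum>l=1..m. (lam l - L) * (\<Sum>j=1..K. (inner (\<xi> l) (\<xi>' j))\<^sup>2))"
    by (subst sum.distrib, subst sum.swap) (simp add: sum_distrib_left inner_commute)
  finally have 1: "real K * L + (\<Sum>l=1..m. (lam l - L) * (\<Sum>j=1..K. (inner (\<xi> l) (\<xi>' j))\<^sup>2)) \<le> real K * (lam' K + 2 * \<gamma>0)"
    by simp
  have "(\<Sum>l=1..m. - \<gamma>0 - L) \<le> (\<Sum>l=1..m. (lam l - L) * (\<Sum>j=1..K. (inner (\<xi> l) (\<xi>' j))\<^sup>2))"
  proof (rule sum_mono)
    fix l assume l: "l \<in> {1..m}"
    let ?s = "\<Sum>j=1..K. (inner (\<xi> l) (\<xi>' j))\<^sup>2"
    have s: "?s \<le> 1" using B.bessel[of "\<xi> l" K] l by simp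
    have "lam l - L \<le> 0" using l A.lam_mono[of l "m + 1"] by (simp add: L_def)
    then have "(lam l - L) * 1 \<le> (lam l - L) * ?s" using s by (intro mult_left_mono_neg)
    then show "- \<gamma>0 - L \<le> (lam l - L) * ?s" using A.lam_ge[of l] l by simp
  qed
  then have 2: "- real m * \<gamma>0 - real m * L \<le> (\<Sum>l=1..m. (lam l - L) * (\<Sum>j=1..K. (inner (\<xi> l) (\<xi>' j))\<^sup>2))"
    by (simp add: right_diff_distrib)
  have "1 * L \<le> (real K - real m) * L" using K L by (intro mult_right_mono) (auto simp: m_def)
  moreover have "real m * \<gamma>0 \<le> real K * \<gamma>0" using K A.\<gamma>0_pos by (intro mult_right_mono) (auto simp: m_def)
  ultimately have "L \<le> real K * (lam' K + 3 * \<gamma>0)" using 1 2 by (simp add: algebra_simps)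
  then show ?thesis by (simp add: L_def m_def)
qed

section \<open>The semigroup in the eigenbasis\<close>

text \<open>
  Splitting $[0, t]$ into $n$ equal steps bounds the total change
  by $((1 + \eta t / n)^n - 1) \|R(0)\|$, hence by $(e^{\eta t} - 1) \|R(0)\|$, for every $\eta$.
\<close>

lemma constant_if_relative_increments_small:
  fixes R :: "real \<Rightarrow> 'b::real_normed_vector"
  assumes inc: "\<And>\<eta>. \<eta> > 0 \<Longrightarrow> \<exists>\<delta>>0. \<forall>h. 0 < h \<and> h < \<delta> \<longrightarrow> (\<forall>t\<ge>0. norm (R (t + h) - R t) \<le> \<eta> * h * norm (R t))"
    and "t \<ge> 0"
  shows "R t = R 0"
proof (cases "t = 0")
  case False
  then have t: "t > 0" using assms by simp
  have bound: "norm (R t - R 0) \<le> (exp (\<eta> * t) - 1) * norm (R 0)" if \<eta>: "\<eta> > 0" for \<eta>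
  proof -
    obtain \<delta> where \<delta>: "\<delta> > 0" "\<And>h t. 0 < h \<Longrightarrow> h < \<delta> \<Longrightarrow> t \<ge> 0 \<Longrightarrow> norm (R (t + h) - R t) \<le> \<eta> * h * norm (R t)"
      using inc[OF \<eta>] by blast
    obtain n :: nat where n: "real n > t / \<delta>" using reals_Archimedean2 by blast
    moreover have "t / \<delta> > 0" using t \<delta> by simp
    ultimately have n0: "real n > 0" by linarith
    define h where "h = t / real n"
    have h: "0 < h" "h < \<delta>" using t n n0 \<delta>(1) by (auto simp: h_def field_simps)
    have "norm (R (real k * h) - R 0) \<le> ((1 + \<eta> * h) ^ k - 1) * norm (R 0)" for k
    proof (induction k)
      case (Suc k)
      let ?r = "norm (R 0)" and ?q = "1 + \<eta> * h"
      have nr: "norm (R (real k * h)) \<le> ?q ^ k * ?r"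
        using Suc norm_triangle_sub[of "R (real k * h)" "R 0"] by (simp add: left_diff_distrib)
      have "norm (R (real k * h + h) - R (real k * h)) \<le> \<eta> * h * norm (R (real k * h))"
        using h by (intro \<delta>) auto
      also have "\<dots> \<le> \<eta> * h * (?q ^ k * ?r)" using h \<eta> by (intro mult_left_mono nr) auto
      finally have "norm (R (real k * h + h) - R 0) \<le> \<eta> * h * (?q ^ k * ?r) + (?q ^ k - 1) * ?r"
        using Suc norm_triangle_ineq[of "R (real k * h + h) - R (real k * h)" "R (real k * h) - R 0"] by simp
      also have "\<dots> = (?q ^ Suc k - 1) * ?r" by (simp add: algebra_simps)
      finally show ?case by (simp add: algebra_simps)
    qed simp
    from this[of n] have "norm (R t - R 0) \<le> ((1 + \<eta> * h) ^ n - 1) * norm (R 0)"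
      using n0 by (simp add: h_def)
    also have "\<dots> \<le> (exp (\<eta> * h) ^ n - 1) * norm (R 0)"
      using h \<eta> by (intro mult_right_mono diff_right_mono power_mono exp_ge_add_one_self) auto
    also have "exp (\<eta> * h) ^ n = exp (\<eta> * t)"
      using n0 by (simp add: h_def flip: exp_of_nat_mult)
    finally show ?thesis .
  qed
  have "norm (R t - R 0) \<le> (exp (0 * t) - 1) * norm (R 0)"
  proof (rule tendsto_lowerbound)
    show "((\<lambda>\<eta>. (exp (\<eta> * t) - 1) * norm (R 0)) \<longlongrightarrow> (exp (0 * t) - 1) * norm (R 0)) (at_right 0)"
      by (intro tendsto_intros)
    show "\<forall>\<^sub>F \<eta> in at_right 0. norm (R t - R 0) \<le> (exp (\<eta> * t) - 1) * norm (R 0)"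
      using bound by (auto simp: eventually_at_filter)
  qed simp
  then show ?thesis by simp
qed simp

text \<open>
  The integral $\int_0^t e^{-\mu (t-s)}\,ds$: the response at time $t$ of a mode with eigenvalue
  $\mu$ to a unit force that is constant in time.
\<close>

definition duhamel_weight :: "real \<Rightarrow> real \<Rightarrow> real" where
  "duhamel_weight \<mu> t = (if \<mu> = 0 then t else (1 - exp (- \<mu> * t)) / \<mu>)"

lemma has_integral_duhamel_weight:
  assumes "t \<ge> 0"
  shows "((\<lambda>s. exp (- \<mu> * (t - s))) has_integral duhamel_weight \<mu> t) {0..t}"
proof (cases "\<mu> = 0")
  case True
  then show ?thesis using assms has_integral_const_real[of "1::real" 0 t] by (simp add: duhamel_weight_def)
next
  case False
  have "((\<lambda>s. exp (- \<mu> * (t - s))) has_integral exp (- \<mu> * (t - t)) / \<mu> - exp (- \<mu> * (t - 0)) / \<mu>) {0..t}"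
    using assms False
    by (intro fundamental_theorem_of_calculus[where f = "\<lambda>s. exp (- \<mu> * (t - s)) / \<mu>"])
       (auto intro!: derivative_eq_intros simp flip: has_real_derivative_iff_has_vector_derivative)
  then show ?thesis using False by (simp add: duhamel_weight_def diff_divide_distrib)
qed

lemma duhamel_weight_pos:
  assumes "t > 0"
  shows "duhamel_weight \<mu> t > 0"
proof -
  consider "\<mu> = 0" | "\<mu> > 0" | "\<mu> < 0" by linarith
  then show ?thesis
  proof cases
    case 3
    then show ?thesis using assms by (auto simp: duhamel_weight_def mult_neg_pos intro!: divide_neg_neg)
  qed (use assms in \<open>auto simp: duhamel_weight_def\<close>)
qed

text \<open>
  The cost of cancelling one mode by a constant force. For $\mu \ge 0$ the response is at least
  $t e^{-\mu t}$; for $\mu < 0$ the bound is $x e^x \le (1 + x)(e^x - 1)$ with $x = -\mu t$.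
\<close>

lemma exp_div_duhamel_weight:
  assumes "t > 0"
  shows "exp (- \<mu> * t) / duhamel_weight \<mu> t \<le> 1 / t + max 0 (- \<mu>)"
proof -
  let ?w = "duhamel_weight \<mu> t"
  consider "\<mu> = 0" | "\<mu> > 0" | "\<mu> < 0" by linarith
  then have "t * exp (- \<mu> * t) \<le> (1 + max 0 (- \<mu>) * t) * ?w"
  proof cases
    case 2
    have "1 + \<mu> * t \<le> exp (\<mu> * t)" by (rule exp_ge_add_one_self)
    then have "(1 + \<mu> * t) * exp (- \<mu> * t) \<le> exp (\<mu> * t) * exp (- \<mu> * t)" by (intro mult_right_mono) auto
    then have "\<mu> * (t * exp (- \<mu> * t)) \<le> 1 - exp (- \<mu> * t)" by (simp add: algebra_simps flip: exp_add)
    then show ?thesis using 2 by (simp add: duhamel_weight_def pos_le_divide_eq mult.commute)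
  next
    case 3
    define x where "x = - \<mu> * t"
    have "1 + x \<le> exp x" by (rule exp_ge_add_one_self)
    then have "x * exp x \<le> (1 + x) * (exp x - 1)" by (simp add: algebra_simps)
    then have "x * exp x / (- \<mu>) \<le> (1 + x) * (exp x - 1) / (- \<mu>)" using 3 by (intro divide_right_mono) auto
    moreover have "x * exp x / (- \<mu>) = t * exp x" using 3 by (simp add: x_def)
    moreover have "(exp x - 1) / (- \<mu>) = ?w" using 3 by (simp add: duhamel_weight_def x_def divide_simps)
    ultimately have "t * exp x \<le> (1 + x) * ?w" by (metis times_divide_eq_right)
    then show ?thesis using 3 by (simp add: x_def)
  qed (simp add: duhamel_weight_def)
  then have "exp (- \<mu> * t) \<le> ((1 + max 0 (- \<mu>) * t) / t) * ?w"
    using assms by (simp add: pos_le_divide_eq mult.commute)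
  also have "(1 + max 0 (- \<mu>) * t) / t = 1 / t + max 0 (- \<mu>)" using assms by (simp add: add_divide_distrib)
  finally show ?thesis using duhamel_weight_pos[OF assms, of \<mu>] by (simp add: pos_divide_le_eq)
qed

lemma linear_on_subspace_sum:
  fixes f :: "nat \<Rightarrow> 'b::real_vector"
  assumes X: "subspace X" and f: "\<And>i. i \<ge> 1 \<Longrightarrow> f i \<in> X"
    and lin: "\<And>u v a b. u \<in> X \<Longrightarrow> v \<in> X \<Longrightarrow> T (a *\<^sub>R u + b *\<^sub>R v) = a *\<^sub>R T u + b *\<^sub>R T v"
  shows "T (\<Sum>i=1..n. c i *\<^sub>R f i) = (\<Sum>i=1..n. c i *\<^sub>R T (f i) :: 'b)"
proof (induction n)
  case 0
  show ?case using lin[of 0 0 0 0] subspace_0[OF X] by simp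
next
  case (Suc n)
  have "(\<Sum>i=1..n. c i *\<^sub>R f i) \<in> X" using f by (intro subspace_sum subspace_scale X) auto
  then show ?case
    using lin[of "\<Sum>i=1..n. c i *\<^sub>R f i" "f (Suc n)" 1 "c (Suc n)"] f[of "Suc n"] Suc by simp
qed

locale schroedinger_semigroup = schroedinger +
  fixes S :: "real \<Rightarrow> 'a L2 \<Rightarrow> 'a L2"
  assumes generates: "generates_semigroup (L2_on \<Omega>) (dom_A \<Omega>) (op_A \<Omega> V) S"
begin

lemma
  shows S_in: "t \<ge> 0 \<Longrightarrow> u \<in> L2_on \<Omega> \<Longrightarrow> S t u \<in> L2_on \<Omega>"
    and S_linear: "t \<ge> 0 \<Longrightarrow> u \<in> L2_on \<Omega> \<Longrightarrow> v \<in> L2_on \<Omega> \<Longrightarrow> S t (a *\<^sub>R u + b *\<^sub>R v) = a *\<^sub>R S t u + b *\<^sub>R S t v"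
    and S_bounded: "t \<ge> 0 \<Longrightarrow> \<exists>K. \<forall>u\<in>L2_on \<Omega>. norm (S t u) \<le> K * norm u"
    and S_0: "u \<in> L2_on \<Omega> \<Longrightarrow> S 0 u = u"
    and S_add: "s \<ge> 0 \<Longrightarrow> t \<ge> 0 \<Longrightarrow> u \<in> L2_on \<Omega> \<Longrightarrow> S (s + t) u = S s (S t u)"
    and dom_A_iff: "u \<in> dom_A \<Omega> \<longleftrightarrow> u \<in> L2_on \<Omega> \<and> (\<exists>w. ((\<lambda>h. (S h u - u) /\<^sub>R h) \<longlongrightarrow> w) (at_right 0))"
    and generator_limit: "u \<in> dom_A \<Omega> \<Longrightarrow> ((\<lambda>h. (S h u - u) /\<^sub>R h) \<longlongrightarrow> op_A \<Omega> V u) (at_right 0)"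
proof -
  have C: "C0_semigroup_on (L2_on \<Omega>) S" using generates by (simp add: generates_semigroup_def)
  show "t \<ge> 0 \<Longrightarrow> u \<in> L2_on \<Omega> \<Longrightarrow> S t u \<in> L2_on \<Omega>"
    using C unfolding C0_semigroup_on_def by blast
  show "t \<ge> 0 \<Longrightarrow> u \<in> L2_on \<Omega> \<Longrightarrow> v \<in> L2_on \<Omega> \<Longrightarrow> S t (a *\<^sub>R u + b *\<^sub>R v) = a *\<^sub>R S t u + b *\<^sub>R S t v"
    using C unfolding C0_semigroup_on_def by blast
  show "t \<ge> 0 \<Longrightarrow> \<exists>K. \<forall>u\<in>L2_on \<Omega>. norm (S t u) \<le> K * norm u"
    using C unfolding C0_semigroup_on_def by blast
  show "u \<in> L2_on \<Omega> \<Longrightarrow> S 0 u = u"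
    using C unfolding C0_semigroup_on_def by blast
  show "s \<ge> 0 \<Longrightarrow> t \<ge> 0 \<Longrightarrow> u \<in> L2_on \<Omega> \<Longrightarrow> S (s + t) u = S s (S t u)"
    using C unfolding C0_semigroup_on_def by blast
  have "dom_A \<Omega> = {u \<in> L2_on \<Omega>. \<exists>w. ((\<lambda>h. (S h u - u) /\<^sub>R h) \<longlongrightarrow> w) (at_right 0)}"
    using generates unfolding generates_semigroup_def by (rule conjE) (erule conjE)
  then show "u \<in> dom_A \<Omega> \<longleftrightarrow> u \<in> L2_on \<Omega> \<and> (\<exists>w. ((\<lambda>h. (S h u - u) /\<^sub>R h) \<longlongrightarrow> w) (at_right 0))"
    by simp
  show "u \<in> dom_A \<Omega> \<Longrightarrow> ((\<lambda>h. (S h u - u) /\<^sub>R h) \<longlongrightarrow> op_A \<Omega> V u) (at_right 0)"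
    using generates unfolding generates_semigroup_def by simp
qed

lemma S_scaleR: "t \<ge> 0 \<Longrightarrow> u \<in> L2_on \<Omega> \<Longrightarrow> S t (a *\<^sub>R u) = a *\<^sub>R S t u"
  using S_linear[of t u u a 0] by simp

lemma S_diff: "t \<ge> 0 \<Longrightarrow> u \<in> L2_on \<Omega> \<Longrightarrow> v \<in> L2_on \<Omega> \<Longrightarrow> S t (u - v) = S t u - S t v"
  using S_linear[of t u v 1 "-1"] by simp

lemma S_sum_basis: "t \<ge> 0 \<Longrightarrow> S t (\<Sum>i=1..n. c i *\<^sub>R \<xi> i) = (\<Sum>i=1..n. c i *\<^sub>R S t (\<xi> i))"
  by (rule linear_on_subspace_sum[OF subspace_L2_on basis_L2_on S_linear])

lemma S_tendsto:
  assumes t: "t \<ge> 0" and u: "u \<in> L2_on \<Omega>" "\<forall>\<^sub>F h in F. f h \<in> L2_on \<Omega>" and lim: "(f \<longlongrightarrow> u) F"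
  shows "((\<lambda>h. S t (f h)) \<longlongrightarrow> S t u) F"
proof -
  obtain K where K: "\<And>u. u \<in> L2_on \<Omega> \<Longrightarrow> norm (S t u) \<le> K * norm u" using S_bounded[OF t] by blast
  have "((\<lambda>h. S t (f h) - S t u) \<longlongrightarrow> 0) F"
  proof (rule tendsto_0_le[where K = K])
    show "((\<lambda>h. f h - u) \<longlongrightarrow> 0) F" using lim by (simp add: LIM_zero_iff)
    show "\<forall>\<^sub>F h in F. norm (S t (f h) - S t u) \<le> norm (f h - u) * K"
      using u(2)
    proof eventually_elim
      case (elim h)
      then show ?case using K[of "f h - u"] u t subspace_diff[OF subspace_L2_on elim u(1)]
        by (simp add: S_diff mult.commute)
    qed
  qed
  then show ?thesis by (simp add: LIM_zero_iff)
qed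

text \<open>
  The difference quotients of $S(\cdot) S(t) \xi_i$ at $0$ are the images under $S(t)$ of those of
  $S(\cdot) \xi_i$, and the single operator $S(t)$ is bounded.
\<close>

lemma S_basis_eigenvector:
  assumes i: "i \<ge> 1" and t: "t \<ge> 0"
  shows "S t (\<xi> i) \<in> dom_A \<Omega>" "op_A \<Omega> V (S t (\<xi> i)) = - (lam i *\<^sub>R S t (\<xi> i))"
proof -
  have \<xi>: "\<xi> i \<in> L2_on \<Omega>" by (rule basis_L2_on[OF i])
  have "((\<lambda>h. S t ((S h (\<xi> i) - \<xi> i) /\<^sub>R h)) \<longlongrightarrow> S t (- (lam i *\<^sub>R \<xi> i))) (at_right 0)"
  proof (rule S_tendsto[OF t])
    show "- (lam i *\<^sub>R \<xi> i) \<in> L2_on \<Omega>"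
      by (intro subspace_neg[OF subspace_L2_on] subspace_scale[OF subspace_L2_on] \<xi>)
    show "\<forall>\<^sub>F h in at_right 0. (S h (\<xi> i) - \<xi> i) /\<^sub>R h \<in> L2_on \<Omega>"
      unfolding eventually_at_filter
      by (auto intro!: always_eventually subspace_diff[OF subspace_L2_on] subspace_scale[OF subspace_L2_on] S_in \<xi>)
    show "((\<lambda>h. (S h (\<xi> i) - \<xi> i) /\<^sub>R h) \<longlongrightarrow> - (lam i *\<^sub>R \<xi> i)) (at_right 0)"
      using generator_limit[OF basis_dom[OF i]] eigen[OF i] by simp
  qed
  also have "S t (- (lam i *\<^sub>R \<xi> i)) = - (lam i *\<^sub>R S t (\<xi> i))"
    using S_scaleR[OF t \<xi>, of "- lam i"] by simp
  finally have "((\<lambda>h. S t ((S h (\<xi> i) - \<xi> i) /\<^sub>R h)) \<longlongrightarrow> - (lam i *\<^sub>R S t (\<xi> i))) (at_right 0)" .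
  moreover have "\<forall>\<^sub>F h in at_right 0. S t ((S h (\<xi> i) - \<xi> i) /\<^sub>R h) = (S h (S t (\<xi> i)) - S t (\<xi> i)) /\<^sub>R h"
    unfolding eventually_at_filter
  proof (intro always_eventually allI impI)
    fix h :: real assume "h \<in> {0<..}"
    then have h: "h \<ge> 0" by simp
    have "S t ((S h (\<xi> i) - \<xi> i) /\<^sub>R h) = (S t (S h (\<xi> i)) - S t (\<xi> i)) /\<^sub>R h"
      using S_in[OF h \<xi>] \<xi> t by (simp add: S_scaleR S_diff subspace_diff[OF subspace_L2_on])
    also have "S t (S h (\<xi> i)) = S h (S t (\<xi> i))"
      using S_add[OF t h \<xi>] S_add[OF h t \<xi>] by (simp add: add.commute)
    finally show "S t ((S h (\<xi> i) - \<xi> i) /\<^sub>R h) = (S h (S t (\<xi> i)) - S t (\<xi> i)) /\<^sub>R h" .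
  qed
  ultimately have lim: "((\<lambda>h. (S h (S t (\<xi> i)) - S t (\<xi> i)) /\<^sub>R h) \<longlongrightarrow> - (lam i *\<^sub>R S t (\<xi> i))) (at_right 0)"
    by (rule Lim_transform_eventually)
  then show dom: "S t (\<xi> i) \<in> dom_A \<Omega>" using S_in[OF t \<xi>] by (auto simp: dom_A_iff)
  show "op_A \<Omega> V (S t (\<xi> i)) = - (lam i *\<^sub>R S t (\<xi> i))"
    by (rule tendsto_unique[OF _ generator_limit[OF dom] lim]) simp
qed

lemma eigenspace_expansion:
  assumes "u \<in> L2_on \<Omega>" "finite J" "J \<subseteq> {1..}" "\<And>k. k \<ge> 1 \<Longrightarrow> k \<notin> J \<Longrightarrow> inner u (\<xi> k) = 0"
  shows "u = (\<Sum>k\<in>J. inner u (\<xi> k) *\<^sub>R \<xi> k)"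
proof -
  have "u - (\<Sum>k\<in>J. inner u (\<xi> k) *\<^sub>R \<xi> k) = 0"
  proof (rule eq_zero_if_orthogonal_basis)
    show "u - (\<Sum>k\<in>J. inner u (\<xi> k) *\<^sub>R \<xi> k) \<in> closure (span (\<xi> ` {1..}))"
      unfolding closure_basis using assms
      by (intro subspace_diff subspace_sum subspace_scale subspace_L2_on basis_L2_on) auto
    fix l :: nat assume l: "l \<ge> 1"
    have "inner (\<Sum>k\<in>J. inner u (\<xi> k) *\<^sub>R \<xi> k) (\<xi> l) = (\<Sum>k\<in>J. if k = l then inner u (\<xi> l) else 0)"
      unfolding inner_sum_left by (rule sum.cong) (use assms(3) l in \<open>auto simp: orthonormal\<close>)
    also have "\<dots> = inner u (\<xi> l)" using assms(2,4) l by (auto simp: sum.delta)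
    finally show "inner (u - (\<Sum>k\<in>J. inner u (\<xi> k) *\<^sub>R \<xi> k)) (\<xi> l) = 0" by (simp add: inner_diff_left)
  qed
  then show ?thesis by simp
qed

text \<open>
  By symmetry of the generator, $S(t) \xi_i$ stays in the eigenspace of $\lambda_i$, which is
  finite dimensional because only finitely many eigenvalues lie below a given level. On that space
  the estimate $S(h) \xi_k = e^{-\lambda_i h} \xi_k + o(h)$ is uniform, so
  $e^{\lambda_i t} S(t) \xi_i$ has small relative increments. Differentiating the orbit instead would
  need its continuity from the left, hence a bound on $S(t)$ uniform for $t$ in an interval.
\<close>

lemma S_basis:
  assumes i: "i \<ge> 1" and t: "t \<ge> 0"
  shows "S t (\<xi> i) = exp (- lam i * t) *\<^sub>R \<xi> i"
proof -
  define J where "J = {k. 1 \<le> k \<and> lam k = lam i}"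
  have J: "finite J" "J \<subseteq> {1..}" "i \<in> J"
    using i by (auto simp: J_def intro: finite_subset[OF _ finite_below[of "lam i"]])
  define v where "v s = S s (\<xi> i)" for s
  define R where "R s = exp (lam i * s) *\<^sub>R v s" for s
  have v_in: "v s \<in> L2_on \<Omega>" if "s \<ge> 0" for s
    unfolding v_def using that by (intro S_in basis_L2_on i)
  have v_orth: "inner (v s) (\<xi> k) = 0" if "s \<ge> 0" "k \<ge> 1" "k \<notin> J" for s k
  proof -
    have "- (lam k * inner (v s) (\<xi> k)) = - (lam i * inner (v s) (\<xi> k))"
      using inner_op_A_basis[OF S_basis_eigenvector(1)[OF i that(1)] that(2)] S_basis_eigenvector(2)[OF i that(1)]
      by (auto simp: v_def)
    then show ?thesis using that by (auto simp: J_def)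
  qed
  have v_exp: "v s = (\<Sum>k\<in>J. inner (v s) (\<xi> k) *\<^sub>R \<xi> k)" if "s \<ge> 0" for s
    by (rule eigenspace_expansion) (use J v_in v_orth that in auto)
  define e where "e h k = S h (\<xi> k) - exp (- lam i * h) *\<^sub>R \<xi> k" for h k
  have v_step: "v (s + h) - exp (- lam i * h) *\<^sub>R v s = (\<Sum>k\<in>J. inner (v s) (\<xi> k) *\<^sub>R e h k)"
    if s: "s \<ge> 0" and h: "h \<ge> 0" for s h
  proof -
    define n where "n = Max J"
    define c where "c k = (if k \<in> J then inner (v s) (\<xi> k) else 0)" for k
    have Jn: "J \<subseteq> {1..n}" using J by (auto simp: n_def)
    have sums: "(\<Sum>k\<in>J. inner (v s) (\<xi> k) *\<^sub>R f k) = (\<Sum>k=1..n. c k *\<^sub>R f k)" for f :: "nat \<Rightarrow> 'a L2"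
      using Jn by (intro sum.mono_neutral_cong_left) (auto simp: c_def)
    have "v (s + h) = S h (v s)"
      unfolding v_def using S_add[OF h s basis_L2_on[OF i]] by (simp add: add.commute)
    also have "\<dots> = S h (\<Sum>k=1..n. c k *\<^sub>R \<xi> k)" using v_exp[OF s] sums by simp
    also have "\<dots> = (\<Sum>k\<in>J. inner (v s) (\<xi> k) *\<^sub>R S h (\<xi> k))"
      unfolding S_sum_basis[OF h] sums ..
    finally have "v (s + h) - exp (- lam i * h) *\<^sub>R v s
        = (\<Sum>k\<in>J. inner (v s) (\<xi> k) *\<^sub>R S h (\<xi> k)) - exp (- lam i * h) *\<^sub>R (\<Sum>k\<in>J. inner (v s) (\<xi> k) *\<^sub>R \<xi> k)"
      using v_exp[OF s] by simp
    also have "\<dots> = (\<Sum>k\<in>J. inner (v s) (\<xi> k) *\<^sub>R e h k)"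
      by (simp add: e_def scaleR_right_diff_distrib sum_subtractf scaleR_sum_right mult.commute)
    finally show ?thesis .
  qed
  have e_small: "\<forall>\<^sub>F h in at_right 0. \<forall>k\<in>J. norm (e h k) \<le> \<epsilon> * h" if \<epsilon>: "\<epsilon> > 0" for \<epsilon>
  proof (rule eventually_ball_finite[OF J(1)], rule ballI)
    fix k assume k: "k \<in> J"
    have "((\<lambda>h. (exp (- lam i * h) - exp (- lam i * 0)) / (h - 0)) \<longlongrightarrow> - lam i) (at_right 0)"
    proof -
      have "((\<lambda>h. exp (- lam i * h)) has_real_derivative - lam i) (at 0 within {0<..})"
        by (auto intro!: derivative_eq_intros)
      then show ?thesis by (simp only: has_field_derivative_iff)
    qed
    then have "((\<lambda>h. ((exp (- lam i * h) - 1) / h) *\<^sub>R \<xi> k) \<longlongrightarrow> (- lam i) *\<^sub>R \<xi> k) (at_right 0)"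
      by (intro tendsto_intros) simp
    moreover have "((\<lambda>h. (S h (\<xi> k) - \<xi> k) /\<^sub>R h) \<longlongrightarrow> (- lam i) *\<^sub>R \<xi> k) (at_right 0)"
      using generator_limit[OF basis_dom, of k] eigen[of k] k by (simp add: J_def)
    ultimately have "((\<lambda>h. (S h (\<xi> k) - \<xi> k) /\<^sub>R h - ((exp (- lam i * h) - 1) / h) *\<^sub>R \<xi> k) \<longlongrightarrow> (- lam i) *\<^sub>R \<xi> k - (- lam i) *\<^sub>R \<xi> k) (at_right 0)"
      by (intro tendsto_diff)
    then have "((\<lambda>h. (S h (\<xi> k) - \<xi> k) /\<^sub>R h - ((exp (- lam i * h) - 1) / h) *\<^sub>R \<xi> k) \<longlongrightarrow> 0) (at_right 0)"
      by simp
    from tendstoD[OF this \<epsilon>] have "\<forall>\<^sub>F h in at_right 0. norm ((S h (\<xi> k) - \<xi> k) /\<^sub>R h - ((exp (- lam i * h) - 1) / h) *\<^sub>R \<xi> k) < \<epsilon>"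
      by (simp add: dist_norm)
    moreover have "\<forall>\<^sub>F h in at_right 0. h > (0::real)" by (simp add: eventually_at_right_less)
    ultimately show "\<forall>\<^sub>F h in at_right 0. norm (e h k) \<le> \<epsilon> * h"
    proof eventually_elim
      case (elim h)
      have "(S h (\<xi> k) - \<xi> k) /\<^sub>R h - ((exp (- lam i * h) - 1) / h) *\<^sub>R \<xi> k = e h k /\<^sub>R h"
        by (simp add: e_def algebra_simps divide_inverse)
      then show ?case using elim by (simp add: field_simps)
    qed
  qed
  have "R t = R 0"
  proof (rule constant_if_relative_increments_small[OF _ t])
    fix \<eta> :: real assume \<eta>: "\<eta> > 0"
    define \<epsilon> where "\<epsilon> = \<eta> / (exp \<bar>lam i\<bar> * real (card J))"
    have card: "real (card J) > 0" using J by (auto simp: card_gt_0_iff)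
    have "\<epsilon> > 0" using \<eta> card by (simp add: \<epsilon>_def)
    then obtain \<delta> where \<delta>: "\<delta> > 0" "\<And>h k. 0 < h \<Longrightarrow> h < \<delta> \<Longrightarrow> k \<in> J \<Longrightarrow> norm (e h k) \<le> \<epsilon> * h"
      using e_small[of \<epsilon>] unfolding eventually_at_right_field by blast
    have "norm (R (s + h) - R s) \<le> \<eta> * h * norm (R s)" if h: "0 < h" "h < min \<delta> 1" and s: "s \<ge> 0" for h s
    proof -
      have "norm (v (s + h) - exp (- lam i * h) *\<^sub>R v s) \<le> (\<Sum>k\<in>J. norm (v s) * (\<epsilon> * h))"
        unfolding v_step[OF s less_imp_le[OF h(1)]]
      proof (intro sum_norm_le)
        fix k assume k: "k \<in> J"
        have "\<bar>inner (v s) (\<xi> k)\<bar> \<le> norm (v s)"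
          using Cauchy_Schwarz_ineq2[of "v s" "\<xi> k"] k J by auto
        then show "norm (inner (v s) (\<xi> k) *\<^sub>R e h k) \<le> norm (v s) * (\<epsilon> * h)"
          using \<delta>(2)[of h k] h k by (simp add: mult_mono)
      qed
      also have "\<dots> = \<eta> * h / exp \<bar>lam i\<bar> * norm (v s)" using card by (simp add: \<epsilon>_def)
      finally have le: "norm (v (s + h) - exp (- lam i * h) *\<^sub>R v s) \<le> \<eta> * h / exp \<bar>lam i\<bar> * norm (v s)" .
      have "R (s + h) - R s = (exp (lam i * s) * exp (lam i * h)) *\<^sub>R (v (s + h) - exp (- lam i * h) *\<^sub>R v s)"
        by (simp add: R_def scaleR_right_diff_distrib distrib_left flip: exp_add)
      then have "norm (R (s + h) - R s) = exp (lam i * h) * exp (lam i * s) * norm (v (s + h) - exp (- lam i * h) *\<^sub>R v s)"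
        by (simp add: abs_mult)
      also have "\<dots> \<le> exp \<bar>lam i\<bar> * exp (lam i * s) * (\<eta> * h / exp \<bar>lam i\<bar> * norm (v s))"
      proof (intro mult_mono le order.refl)
        have "lam i * h \<le> \<bar>lam i\<bar> * 1" using h by (intro mult_mono) auto
        then show "exp (lam i * h) \<le> exp \<bar>lam i\<bar>" by simp
      qed auto
      also have "\<dots> = \<eta> * h * norm (R s)" by (simp add: R_def)
      finally show ?thesis .
    qed
    then show "\<exists>\<delta>>0. \<forall>h. 0 < h \<and> h < \<delta> \<longrightarrow> (\<forall>t\<ge>0. norm (R (t + h) - R t) \<le> \<eta> * h * norm (R t))"
      using \<delta>(1) by (intro exI[of _ "min \<delta> 1"]) auto
  qed
  then have "exp (lam i * t) *\<^sub>R S t (\<xi> i) = \<xi> i"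
    using S_0[OF basis_L2_on[OF i]] by (simp add: R_def v_def)
  then have "exp (- lam i * t) *\<^sub>R exp (lam i * t) *\<^sub>R S t (\<xi> i) = exp (- lam i * t) *\<^sub>R \<xi> i" by simp
  then show ?thesis by (simp flip: exp_add)
qed

lemma inner_S_basis:
  assumes i: "i \<ge> 1" and t: "t \<ge> 0" and u: "u \<in> L2_on \<Omega>"
  shows "inner (S t u) (\<xi> i) = exp (- lam i * t) * inner u (\<xi> i)"
proof (rule LIMSEQ_unique)
  have "\<forall>n. partial_expansion n u \<in> L2_on \<Omega>"
    unfolding partial_expansion_def by (auto intro!: subspace_sum subspace_scale subspace_L2_on basis_L2_on)
  then show "(\<lambda>n. inner (S t (partial_expansion n u)) (\<xi> i)) \<longlonglongrightarrow> inner (S t u) (\<xi> i)"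
    by (intro tendsto_intros S_tendsto t u expansion_tendsto) simp
  have "inner (S t (partial_expansion n u)) (\<xi> i) = exp (- lam i * t) * inner u (\<xi> i)" if "n \<ge> i" for n
  proof -
    have "S t (partial_expansion n u) = (\<Sum>k=1..n. (inner u (\<xi> k) * exp (- lam k * t)) *\<^sub>R \<xi> k)"
      unfolding partial_expansion_def S_sum_basis[OF t] by (intro sum.cong) (auto simp: S_basis t)
    then show ?thesis using that i by (simp only: inner_sum_basis if_True mult.commute)
  qed
  then show "(\<lambda>n. inner (S t (partial_expansion n u)) (\<xi> i)) \<longlonglongrightarrow> exp (- lam i * t) * inner u (\<xi> i)"
    by (intro tendsto_eventually) (auto simp: eventually_sequentially)
qed

lemma norm_S_le:
  assumes t: "t \<ge> 0" and u: "u \<in> L2_on \<Omega>"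
  shows "norm (S t u) \<le> exp (\<gamma>0 * t) * norm u"
proof (rule LIMSEQ_le_const2)
  show "(\<lambda>n. norm (partial_expansion n (S t u))) \<longlonglongrightarrow> norm (S t u)"
    by (intro tendsto_intros expansion_tendsto S_in t u)
  have "norm (partial_expansion n (S t u)) \<le> exp (\<gamma>0 * t) * norm u" for n
  proof (rule power2_le_imp_le)
    have "(norm (partial_expansion n (S t u)))\<^sup>2 = (\<Sum>i=1..n. (exp (- lam i * t) * inner u (\<xi> i))\<^sup>2)"
      unfolding norm_partial_expansion by (intro sum.cong) (auto simp: inner_S_basis t u)
    also have "\<dots> \<le> (\<Sum>i=1..n. (exp (\<gamma>0 * t))\<^sup>2 * (inner u (\<xi> i))\<^sup>2)"
      unfolding power_mult_distrib
    proof (intro sum_mono mult_right_mono power_mono)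
      fix i assume "i \<in> {1..n}"
      then show "exp (- lam i * t) \<le> exp (\<gamma>0 * t)" using lam_ge[of i] t
        mult_right_mono[of "- lam i" \<gamma>0 t] by simp
    qed auto
    also have "\<dots> \<le> (exp (\<gamma>0 * t))\<^sup>2 * (norm u)\<^sup>2"
      unfolding sum_distrib_left[symmetric] by (intro mult_left_mono bessel) auto
    finally show "(norm (partial_expansion n (S t u)))\<^sup>2 \<le> (exp (\<gamma>0 * t) * norm u)\<^sup>2"
      by (simp add: power_mult_distrib)
  qed simp
  then show "\<exists>N. \<forall>n\<ge>N. norm (partial_expansion n (S t u)) \<le> exp (\<gamma>0 * t) * norm u" by blast
qed

lemma continuous_on_S:
  assumes u: "u \<in> L2_on \<Omega>"
  shows "continuous_on {0..T} (\<lambda>t. S t u)"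
proof (rule uniform_limit_theorem[where F = sequentially])
  let ?p = "\<lambda>n. partial_expansion n u"
  have p: "?p n \<in> L2_on \<Omega>" for n
    unfolding partial_expansion_def by (auto intro!: subspace_sum subspace_scale subspace_L2_on basis_L2_on)
  have eq: "S t (?p n) = (\<Sum>k=1..n. (inner u (\<xi> k) * exp (- lam k * t)) *\<^sub>R \<xi> k)" if "t \<ge> 0" for t n
    unfolding partial_expansion_def S_sum_basis[OF that] by (intro sum.cong) (auto simp: S_basis that)
  have "continuous_on {0..T} (\<lambda>t. S t (?p n))" for n
  proof (rule continuous_on_eq)
    show "continuous_on {0..T} (\<lambda>t. \<Sum>k=1..n. (inner u (\<xi> k) * exp (- lam k * t)) *\<^sub>R \<xi> k)"
      by (intro continuous_intros)
  qed (simp add: eq)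
  then show "\<forall>\<^sub>F n in sequentially. continuous_on {0..T} (\<lambda>t. S t (?p n))" by simp
  show "uniform_limit {0..T} (\<lambda>n t. S t (?p n)) (\<lambda>t. S t u) sequentially"
  proof (rule uniform_limitI)
    fix e :: real assume e: "e > 0"
    have "e / exp (\<gamma>0 * \<bar>T\<bar>) > 0" using e by simp
    from tendstoD[OF expansion_tendsto[OF u] this]
    show "\<forall>\<^sub>F n in sequentially. \<forall>t\<in>{0..T}. dist (S t (?p n)) (S t u) < e"
    proof eventually_elim
      case (elim n)
      show ?case
      proof
        fix t assume t: "t \<in> {0..T}"
        have "dist (S t (?p n)) (S t u) = norm (S t (?p n - u))"
          using t p u by (simp add: dist_norm S_diff)
        also have "\<dots> \<le> exp (\<gamma>0 * t) * norm (?p n - u)"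
          using t p u by (intro norm_S_le subspace_diff subspace_L2_on) auto
        also have "\<dots> \<le> exp (\<gamma>0 * \<bar>T\<bar>) * norm (?p n - u)"
          using t \<gamma>0_pos by (intro mult_right_mono) auto
        also have "\<dots> < e" using elim by (simp add: dist_norm field_simps)
        finally show "dist (S t (?p n)) (S t u) < e" .
      qed
    qed
  qed
qed simp

text \<open>Completeness of $L^2$ enters here: it makes the orbit integrable.\<close>

lemma inner_mild_solution:
  assumes i: "i \<ge> 1" and t: "t \<ge> 0" and u: "u \<in> L2_on \<Omega>" and b: "b \<in> L2_on \<Omega>"
  shows "inner (mild_solution S u (\<lambda>_. b) t) (\<xi> i)
    = exp (- lam i * t) * inner u (\<xi> i) + duhamel_weight (lam i) t * inner b (\<xi> i)"
proof -
  have "continuous_on {0..t} (\<lambda>s. S (t - s) b)"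
    by (rule continuous_on_compose2[OF continuous_on_S[OF b, of t]]) (auto intro!: continuous_intros)
  then have "((\<lambda>s. S (t - s) b) has_integral integral {0..t} (\<lambda>s. S (t - s) b)) {0..t}"
    by (intro integrable_integral integrable_continuous_real)
  from has_integral_linear[OF this bounded_linear_inner_left[of "\<xi> i"]]
  have "((\<lambda>s. inner (S (t - s) b) (\<xi> i)) has_integral inner (integral {0..t} (\<lambda>s. S (t - s) b)) (\<xi> i)) {0..t}"
    by (simp add: o_def)
  moreover have "((\<lambda>s. inner (S (t - s) b) (\<xi> i)) has_integral duhamel_weight (lam i) t * inner b (\<xi> i)) {0..t}"
    by (rule has_integral_eq[OF _ has_integral_mult_left[OF has_integral_duhamel_weight[OF t]]])
       (simp add: inner_S_basis[OF i _ b])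
  ultimately have "inner (integral {0..t} (\<lambda>s. S (t - s) b)) (\<xi> i) = duhamel_weight (lam i) t * inner b (\<xi> i)"
    by (rule has_integral_unique)
  then show ?thesis by (simp add: mild_solution_def inner_add_left inner_S_basis[OF i t u])
qed

lemma inner_impulse_solution:
  assumes i: "i \<ge> 1" and j: "j \<ge> 1" and t: "0 < \<tau>" "\<tau> \<le> t" and b: "b \<in> L2_on \<Omega>"
  shows "inner (impulse_solution S (\<xi> j) \<tau> b t) (\<xi> i)
    = exp (- lam i * t) * inner (\<xi> j) (\<xi> i) + exp (- lam i * (t - \<tau>)) * inner b (\<xi> i)"
proof -
  have "((\<lambda>s. exp (- lam j * s) *\<^sub>R \<xi> j) \<longlongrightarrow> exp (- lam j * \<tau>) *\<^sub>R \<xi> j) (at_left \<tau>)"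
    by (intro tendsto_intros)
  moreover have "\<forall>\<^sub>F s in at_left \<tau>. exp (- lam j * s) *\<^sub>R \<xi> j = S s (\<xi> j)"
    using eventually_at_left_real[OF t(1)] by eventually_elim (simp add: S_basis[OF j])
  ultimately have "((\<lambda>s. S s (\<xi> j)) \<longlongrightarrow> exp (- lam j * \<tau>) *\<^sub>R \<xi> j) (at_left \<tau>)"
    by (rule Lim_transform_eventually)
  then have lim: "Lim (at_left \<tau>) (\<lambda>s. S s (\<xi> j)) = exp (- lam j * \<tau>) *\<^sub>R \<xi> j"
    by (intro tendsto_Lim) auto
  have in_X: "exp (- lam j * \<tau>) *\<^sub>R \<xi> j + b \<in> L2_on \<Omega>"
    by (intro subspace_add subspace_scale subspace_L2_on basis_L2_on j b)
  have "inner (impulse_solution S (\<xi> j) \<tau> b t) (\<xi> i)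
      = exp (- lam i * (t - \<tau>)) * (exp (- lam j * \<tau>) * inner (\<xi> j) (\<xi> i) + inner b (\<xi> i))"
    using t inner_S_basis[OF i _ in_X, of "t - \<tau>"]
    by (simp add: impulse_solution_def lim inner_add_left del: scaleR_scaleR)
  moreover have "exp (- lam i * (t - \<tau>)) * (exp (- lam j * \<tau>) * inner (\<xi> j) (\<xi> i)) = exp (- lam i * t) * inner (\<xi> j) (\<xi> i)"
    using i j by (cases "i = j") (auto simp: orthonormal algebra_simps simp flip: exp_add)
  ultimately show ?thesis by (simp add: distrib_left)
qed

end

section \<open>The minimal controls and the feedback\<close>

locale controlled_schroedinger = schroedinger_semigroup +
  fixes \<omega> \<omega>1 :: "'a set" and C0 \<gamma> T :: real
  assumes \<omega>: "open \<omega>" "\<omega> \<subseteq> \<Omega>" and \<omega>1: "open \<omega>1" "\<omega>1 \<subseteq> \<Omega>"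
    and spectral: "spectral_constant \<Omega> \<omega> \<omega>1 C0"
    and \<gamma>: "\<gamma> > 0" and T: "T > 0"
begin

abbreviation "N \<equiv> N_index lam \<gamma> T"
abbreviation "M \<equiv> M_index lam \<gamma>0 C0 \<gamma> T"
abbreviation "\<epsilon> \<equiv> eps0 lam \<gamma>0 \<gamma> T"
abbreviation "fc \<equiv> f_control \<omega> lam \<xi> S \<gamma>0 C0 \<gamma> T"
abbreviation "hc \<equiv> h_control \<omega>1 lam \<xi> S \<gamma>0 C0 \<gamma> T"
abbreviation "F \<equiv> feedback \<omega> \<omega>1 lam \<xi> S \<gamma>0 C0 \<gamma> T"

definition spectral_bound :: real where
  "spectral_bound = exp (C0 * (1 + \<gamma>0 powr (2/3) + sqrt (lam M)))"

lemma spectral_bound_pos: "spectral_bound > 0"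
  by (simp add: spectral_bound_def)

lemma C0_pos: "C0 > 0"
  using spectral by (simp add: spectral_constant_def)

lemma N_ge_1: "N \<ge> 1" and lam_N: "lam N < 2 * \<gamma> + ln 9 / T"
  using N_index_ge_1[OF \<gamma> T] lam_N_index[OF \<gamma> T] by auto

lemma ln_N_nonneg: "ln (9 * sqrt (real N)) \<ge> 0"
proof -
  have "sqrt (real N) \<ge> 1" using N_ge_1 by simp
  then show ?thesis by (intro ln_ge_zero) linarith
qed

text \<open>
  The threshold exceeds $\lambda_{m+1}$, so that $\lambda_M > 0$ and the spectral inequality is
  applicable to $X_M$.
\<close>

lemma C_threshold_gt: "C_threshold lam \<gamma>0 C0 \<gamma> T > 3 * \<gamma>0 + c_hat lam \<gamma>0"
proof -
  let ?C1 = "C0 / 2"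
  let ?R = "?C1\<^sup>2 + 2 * T * (ln (9 * sqrt (real N)) + ?C1 * (1 + \<gamma>0 powr (2/3))) + (4 * \<gamma> + 3 * \<gamma>0) * T\<^sup>2"
  have R: "?R \<ge> (4 * \<gamma> + 3 * \<gamma>0) * T\<^sup>2" "(4 * \<gamma> + 3 * \<gamma>0) * T\<^sup>2 \<ge> 0"
    using C0_pos T \<gamma> \<gamma>0_pos ln_N_nonneg by (auto intro!: add_nonneg_nonneg mult_nonneg_nonneg)
  have "3 * \<gamma>0 < (4 * \<gamma> + 3 * \<gamma>0) * T\<^sup>2 / T\<^sup>2" using \<gamma> T by simp
  also have "\<dots> \<le> (sqrt ?R)\<^sup>2 / T\<^sup>2" using R by (intro divide_right_mono) auto
  also have "\<dots> \<le> (?C1 + sqrt ?R)\<^sup>2 / T\<^sup>2"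
    using C0_pos R by (intro divide_right_mono power_mono) auto
  also have "\<dots> = ((?C1 + sqrt ?R) / T)\<^sup>2" by (simp add: power_divide)
  finally show ?thesis by (simp add: C_threshold_def Let_def)
qed

lemma c_hat_nonneg: "c_hat lam \<gamma>0 \<ge> 0"
  by (simp add: c_hat_def)

lemma
  shows M_ge_1: "M \<ge> 1" and lam_M_pos: "lam M > 0" and lam_M: "lam M < C_threshold lam \<gamma>0 C0 \<gamma> T"
proof -
  let ?S = "{j. 1 \<le> j \<and> lam j < C_threshold lam \<gamma>0 C0 \<gamma> T}"
  let ?m = "nonpos_count lam + 1"
  have "lam ?m < C_threshold lam \<gamma>0 C0 \<gamma> T"
    using C_threshold_gt by (simp add: c_hat_def max_def split: if_splits)
  then have m: "?m \<in> ?S" by simp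
  then have "M \<in> ?S" unfolding M_index_def by (intro Max_in finite_strictly_below) auto
  then show M: "M \<ge> 1" "lam M < C_threshold lam \<gamma>0 C0 \<gamma> T" by auto
  have "?m \<le> M" unfolding M_index_def using m by (intro Max_ge finite_strictly_below)
  then have "lam ?m \<le> lam M" by (intro lam_mono) auto
  then show "lam M > 0" using lam_after_nonpos_count by linarith
qed

lemma eps_nonneg: "\<epsilon> \<ge> 0"
  by (simp add: eps0_def)

lemma N_eps_le: "real N * \<epsilon>\<^sup>2 \<le> 1 / 81"
proof -
  have "- (2 * \<gamma> + 3/2 * \<gamma>0 + c_hat lam \<gamma>0) * T \<le> 0"
    using \<gamma> \<gamma>0_pos c_hat_nonneg T by (intro mult_nonpos_nonneg) auto
  then have "exp (- (2 * \<gamma> + 3/2 * \<gamma>0 + c_hat lam \<gamma>0) * T) \<le> 1" by simp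
  then have "\<epsilon> \<le> 1 / (9 * sqrt (real N)) * 1"
    unfolding eps0_def by (intro mult_left_mono) auto
  then have "\<epsilon>\<^sup>2 \<le> (1 / (9 * sqrt (real N)))\<^sup>2" using eps_nonneg by (intro power_mono) auto
  also have "\<dots> = 1 / (81 * real N)" by (simp add: power_divide power_mult_distrib)
  finally show ?thesis using N_ge_1 by (simp add: field_simps)
qed

lemma subset_sets: "U \<in> {\<omega>, \<omega>1} \<Longrightarrow> U \<in> sets lebesgue"
  using \<omega> \<omega>1 by auto

text \<open>
  What the two control problems have in common: each coordinate of the state at time $T/2$ is an
  affine function, with positive slope, of one inner product of the control.
\<close>

lemma minimal_control:
  assumes U: "U \<in> {\<omega>, \<omega>1}" and j: "j \<ge> 1"
    and y: "\<And>i f. i \<ge> 1 \<Longrightarrow> f \<in> L2_on U \<Longrightarrow>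
              inner (y f) (\<xi> i) = (if i = j then e else 0) + \<kappa> i * inner f (ind_op U (\<xi> i))"
    and \<kappa>: "\<And>i. i \<ge> 1 \<Longrightarrow> \<kappa> i > 0" and e: "e \<ge> 0"
    and c: "c = min_norm_element {f \<in> L2_on U. norm (P_proj \<xi> M (y f)) \<le> \<epsilon> * norm (\<xi> j)}"
  shows "c \<in> L2_on U" and "norm (P_proj \<xi> M (y c)) \<le> \<epsilon>"
    and "norm c \<le> sqrt spectral_bound * (e / \<kappa> j)"
proof -
  let ?K = "{f \<in> L2_on U. norm (P_proj \<xi> M (y f)) \<le> \<epsilon> * norm (\<xi> j)}"
  let ?e = "\<lambda>i. if i = j then e else 0"
  let ?g = "\<lambda>i. ind_op U (\<xi> i)"
  have "norm (P_proj \<xi> M (y f)) \<le> \<epsilon> \<longleftrightarrow> (\<Sum>i=1..M. (?e i + \<kappa> i * inner f (?g i))\<^sup>2) \<le> \<epsilon>\<^sup>2"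
    if f: "f \<in> L2_on U" for f
  proof -
    have "(\<Sum>i=1..M. (?e i + \<kappa> i * inner f (?g i))\<^sup>2) = (norm (P_proj \<xi> M (y f)))\<^sup>2"
      unfolding P_proj_def orth_proj_span norm_partial_expansion
      by (rule sum.cong) (auto simp: y[OF _ f])
    then show ?thesis using eps_nonneg by (simp add: abs_le_square_iff[symmetric])
  qed
  then have K: "?K = {f \<in> L2_on U. (\<Sum>i=1..M. (?e i + \<kappa> i * inner f (?g i))\<^sup>2) \<le> \<epsilon>\<^sup>2}"
    using j by auto
  obtain Binv :: "nat \<Rightarrow> nat \<Rightarrow> real" where
    B: "\<And>i j. i \<in> {1..M} \<Longrightarrow> j \<in> {1..M} \<Longrightarrow> (\<Sum>k=1..M. gram \<xi> U i k * Binv k j) = (if i = j then 1 else 0)"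
       "\<And>a :: nat \<Rightarrow> real. (\<Sum>i=1..M. \<Sum>j=1..M. a i * Binv i j * a j) \<le> spectral_bound * (\<Sum>i=1..M. (a i)\<^sup>2)"
    using spectral[unfolded spectral_constant_def, THEN conjunct2, rule_format,
        OF standing U M_ge_1 less_imp_le[OF lam_M_pos], unfolded \<gamma>0, folded spectral_bound_def]
    by blast
  note min = min_norm_element_finite_constraint[OF subspace_L2_on ind_op_in_L2_on[OF subset_sets[OF U]]
      B(1)[unfolded gram_eq_inner[OF subset_sets[OF U]]] B(2) \<kappa> eps_nonneg K]
  have "c \<in> ?K" unfolding c by (rule min(1)) auto
  then show "c \<in> L2_on U" "norm (P_proj \<xi> M (y c)) \<le> \<epsilon>" using j by auto
  have "(norm c)\<^sup>2 \<le> spectral_bound * (\<Sum>i=1..M. (?e i / \<kappa> i)\<^sup>2)"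
    unfolding c by (rule min(2)) auto
  also have "(\<Sum>i=1..M. (?e i / \<kappa> i)\<^sup>2) = (\<Sum>i=1..M. if i = j then (e / \<kappa> i)\<^sup>2 else 0)"
    by (rule sum.cong) auto
  also have "spectral_bound * \<dots> \<le> spectral_bound * (e / \<kappa> j)\<^sup>2"
    using spectral_bound_pos by (intro mult_left_mono) auto
  also have "spectral_bound * (e / \<kappa> j)\<^sup>2 = (sqrt spectral_bound * (e / \<kappa> j))\<^sup>2"
    unfolding power_mult_distrib using spectral_bound_pos by simp
  finally have "(norm c)\<^sup>2 \<le> (sqrt spectral_bound * (e / \<kappa> j))\<^sup>2" .
  then show "norm c \<le> sqrt spectral_bound * (e / \<kappa> j)"
    by (rule power2_le_imp_le) (use e \<kappa>[OF j] spectral_bound_pos in auto)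
qed

lemma inner_state_f:
  assumes "i \<ge> 1" "j \<ge> 1" "f \<in> L2_on \<omega>"
  shows "inner (mild_solution S (\<xi> j) (\<lambda>_. ind_op \<omega> f) (T/2)) (\<xi> i)
    = (if i = j then exp (- lam j * (T/2)) else 0) + duhamel_weight (lam i) (T/2) * inner f (ind_op \<omega> (\<xi> i))"
proof -
  have "ind_op \<omega> f \<in> L2_on \<Omega>"
    using ind_op_in_L2_on[of \<omega> f] L2_on_mono[OF \<omega>(2)] subset_sets by blast
  then show ?thesis
    using inner_mild_solution[OF assms(1) _ basis_L2_on[OF assms(2)], of "T/2" "ind_op \<omega> f"] T assms
    by (simp add: orthonormal inner_ind_op_commute subset_sets)
qed

lemma inner_state_h:
  assumes "i \<ge> 1" "j \<ge> 1" "h \<in> L2_on \<omega>1"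
  shows "inner (impulse_solution S (\<xi> j) (T/4) (ind_op \<omega>1 h) (T/2)) (\<xi> i)
    = (if i = j then exp (- lam j * (T/2)) else 0) + exp (- lam i * (T/4)) * inner h (ind_op \<omega>1 (\<xi> i))"
proof -
  have "ind_op \<omega>1 h \<in> L2_on \<Omega>"
    using ind_op_in_L2_on[of \<omega>1 h] L2_on_mono[OF \<omega>1(2)] subset_sets by blast
  then show ?thesis
    using inner_impulse_solution[OF assms(1,2), of "T/4" "T/2" "ind_op \<omega>1 h"] T assms
    by (simp add: orthonormal inner_ind_op_commute subset_sets)
qed

lemma
  assumes j: "j \<ge> 1"
  shows fc_in: "fc j \<in> L2_on \<omega>"
    and fc_state: "norm (P_proj \<xi> M (mild_solution S (\<xi> j) (\<lambda>_. ind_op \<omega> (fc j)) (T/2))) \<le> \<epsilon>"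
    and norm_fc: "norm (fc j) \<le> sqrt spectral_bound * (2 / T + \<gamma>0)"
proof -
  note m = minimal_control[of \<omega> j "\<lambda>f. mild_solution S (\<xi> j) (\<lambda>_. ind_op \<omega> f) (T/2)"
      "exp (- lam j * (T/2))" "\<lambda>i. duhamel_weight (lam i) (T/2)" "fc j", OF _ j inner_state_f[OF _ j] _ _ f_control_def]
  have \<kappa>: "duhamel_weight (lam i) (T/2) > 0" for i using T by (intro duhamel_weight_pos) simp
  show "fc j \<in> L2_on \<omega>" by (rule m) (auto simp: \<kappa>)
  show "norm (P_proj \<xi> M (mild_solution S (\<xi> j) (\<lambda>_. ind_op \<omega> (fc j)) (T/2))) \<le> \<epsilon>"
    by (rule m) (auto simp: \<kappa>)
  have "norm (fc j) \<le> sqrt spectral_bound * (exp (- lam j * (T/2)) / duhamel_weight (lam j) (T/2))"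
    by (rule m) (auto simp: \<kappa>)
  also have "\<dots> \<le> sqrt spectral_bound * (2 / T + \<gamma>0)"
    using exp_div_duhamel_weight[of "T/2" "lam j"] T lam_ge[OF j] \<gamma>0_pos spectral_bound_pos
    by (intro mult_left_mono) auto
  finally show "norm (fc j) \<le> sqrt spectral_bound * (2 / T + \<gamma>0)" .
qed

lemma
  assumes j: "j \<ge> 1"
  shows hc_in: "hc j \<in> L2_on \<omega>1"
    and hc_state: "norm (P_proj \<xi> M (impulse_solution S (\<xi> j) (T/4) (ind_op \<omega>1 (hc j)) (T/2))) \<le> \<epsilon>"
    and norm_hc: "norm (hc j) \<le> sqrt spectral_bound * exp (\<gamma>0 * T / 4)"
proof -
  note m = minimal_control[of \<omega>1 j "\<lambda>h. impulse_solution S (\<xi> j) (T/4) (ind_op \<omega>1 h) (T/2)"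
      "exp (- lam j * (T/2))" "\<lambda>i. exp (- lam i * (T/4))" "hc j", OF _ j inner_state_h[OF _ j] _ _ h_control_def]
  show "hc j \<in> L2_on \<omega>1" by (rule m) auto
  show "norm (P_proj \<xi> M (impulse_solution S (\<xi> j) (T/4) (ind_op \<omega>1 (hc j)) (T/2))) \<le> \<epsilon>"
    by (rule m) auto
  have "norm (hc j) \<le> sqrt spectral_bound * (exp (- lam j * (T/2)) / exp (- lam j * (T/4)))"
    by (rule m) auto
  also have "exp (- lam j * (T/2)) / exp (- lam j * (T/4)) = exp (- lam j * (T/4))"
    by (simp add: field_simps flip: exp_add exp_diff)
  also have "sqrt spectral_bound * exp (- lam j * (T/4)) \<le> sqrt spectral_bound * exp (\<gamma>0 * T / 4)"
    using mult_right_mono[of "- lam j" \<gamma>0 "T/4"] lam_ge[OF j] T spectral_bound_pos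
    by (intro mult_left_mono) auto
  finally show "norm (hc j) \<le> sqrt spectral_bound * exp (\<gamma>0 * T / 4)" .
qed

definition feedback_bound :: real where
  "feedback_bound = real N * (spectral_bound * (2 / T + \<gamma>0) * exp (\<gamma>0 * T / 4))"

lemma feedback_bound_nonneg: "feedback_bound \<ge> 0"
  using T \<gamma>0_pos spectral_bound_pos by (simp add: feedback_bound_def)

lemma norm_feedback_le: "norm (F v) \<le> feedback_bound * norm v"
proof -
  have "norm (F v) \<le> (\<Sum>j=1..N. norm v * (spectral_bound * (2 / T + \<gamma>0) * exp (\<gamma>0 * T / 4)))"
    unfolding feedback_def norm_minus_cancel
  proof (intro sum_norm_le)
    fix j assume "j \<in> {1..N}"
    then have j: "j \<ge> 1" by simp
    have "\<bar>inner (ind_op \<omega>1 v) (ind_op \<omega>1 (hc j))\<bar> \<le> norm (ind_op \<omega>1 v) * norm (ind_op \<omega>1 (hc j))"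
      by (rule Cauchy_Schwarz_ineq2)
    also have "\<dots> \<le> norm v * norm (hc j)"
      by (intro mult_mono norm_ind_op_le subset_sets) auto
    also have "\<dots> \<le> norm v * (sqrt spectral_bound * exp (\<gamma>0 * T / 4))"
      by (intro mult_left_mono norm_hc j) auto
    finally have "norm (inner (ind_op \<omega>1 v) (ind_op \<omega>1 (hc j)) *\<^sub>R fc j)
        \<le> norm v * (sqrt spectral_bound * exp (\<gamma>0 * T / 4)) * (sqrt spectral_bound * (2 / T + \<gamma>0))"
      unfolding norm_scaleR using norm_fc[OF j] spectral_bound_pos by (intro mult_mono) auto
    also have "\<dots> = norm v * ((sqrt spectral_bound * sqrt spectral_bound) * (2 / T + \<gamma>0) * exp (\<gamma>0 * T / 4))"
      by (simp only: mult_ac)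
    also have "sqrt spectral_bound * sqrt spectral_bound = spectral_bound"
      using spectral_bound_pos by simp
    finally show "norm (inner (ind_op \<omega>1 v) (ind_op \<omega>1 (hc j)) *\<^sub>R fc j)
        \<le> norm v * (spectral_bound * (2 / T + \<gamma>0) * exp (\<gamma>0 * T / 4))" .
  qed
  then show ?thesis by (simp add: feedback_bound_def mult_ac)
qed

lemma feedback_quotient_le: "norm (F v) / norm v \<le> feedback_bound"
  using norm_feedback_le[of v] feedback_bound_nonneg by (cases "v = 0") (auto simp: pos_divide_le_eq)

lemma onorm_feedback_le: "onorm_on (L2_on \<omega>1) F \<le> feedback_bound"
  unfolding onorm_on_def
  using subspace_0[OF subspace_L2_on[of \<omega>1]] by (intro cSUP_least feedback_quotient_le) auto

lemma feedback_quotient_le_onorm: "v \<in> L2_on \<omega>1 \<Longrightarrow> norm (F v) / norm v \<le> onorm_on (L2_on \<omega>1) F"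
  unfolding onorm_on_def
  by (rule cSUP_upper) (auto intro!: bdd_aboveI2[of _ _ feedback_bound] feedback_quotient_le)

text \<open>
  This is $\frac79\, E^2 / (\theta \kappa)$, where $E = e^{-\lambda_1 T/2}$ is the free growth of the
  first mode and $\kappa$, $\theta = e^{-\lambda_1 T/4}$ are the responses of that mode to the
  constant control and to the impulse.
\<close>

definition lower_profile :: real where
  "lower_profile = 7 / 9 * exp (- (3 / 4 * lam 1 * T)) / duhamel_weight (lam 1) (T / 2)"

text \<open>
  Test the feedback on the unstable mode. For $j = 1$ both controls must remove almost the whole
  growing component $E = e^{-\lambda_1 T/2}$, so the first term of
  $\langle \mathcal{F} \mathbf{1}_{\omega_1} \xi_1, \mathbf{1}_\omega \xi_1\rangle$ is comparable
  to $E^2$ up to explicit weights; the other terms are products of two residuals and sum to at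
  most $N \varepsilon_0^2 \le 1/81$.
\<close>

lemma lower_profile_le_onorm: "lower_profile \<le> onorm_on (L2_on \<omega>1) F"
proof -
  define E where "E = exp (- lam 1 * (T/2))"
  define \<theta> where "\<theta> = exp (- lam 1 * (T/4))"
  define \<kappa> where "\<kappa> = duhamel_weight (lam 1) (T/2)"
  have E: "E \<ge> 1" using lam_1_neg T by (simp add: E_def mult_nonpos_nonneg)
  have \<theta>: "\<theta> > 0" by (simp add: \<theta>_def)
  have \<kappa>: "\<kappa> > 0" unfolding \<kappa>_def using T by (intro duhamel_weight_pos) simp
  let ?v = "ind_op \<omega>1 (\<xi> 1)" and ?w = "ind_op \<omega> (\<xi> 1)"
  have component: "\<bar>inner u (\<xi> 1)\<bar> \<le> \<epsilon>" if "norm (P_proj \<xi> M u) \<le> \<epsilon>" for u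
  proof -
    have "(inner u (\<xi> 1))\<^sup>2 \<le> (\<Sum>i=1..M. (inner u (\<xi> i))\<^sup>2)"
      using M_ge_1 by (intro member_le_sum) auto
    also have "\<dots> = (norm (P_proj \<xi> M u))\<^sup>2"
      by (simp only: P_proj_def orth_proj_span norm_partial_expansion)
    also have "\<dots> \<le> \<epsilon>\<^sup>2" using that by (intro power_mono) auto
    finally show ?thesis using eps_nonneg by (simp flip: abs_le_square_iff)
  qed
  define r where "r j = (if j = 1 then E else 0) + \<kappa> * inner (fc j) ?w" for j
  define s where "s j = (if j = 1 then E else 0) + \<theta> * inner (hc j) ?v" for j
  have r: "\<bar>r j\<bar> \<le> \<epsilon>" if j: "j \<ge> 1" for j
    using component[OF fc_state[OF j]] inner_state_f[OF _ j fc_in[OF j], of 1]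
    by (cases "j = 1") (auto simp: r_def E_def \<kappa>_def)
  have s: "\<bar>s j\<bar> \<le> \<epsilon>" if j: "j \<ge> 1" for j
    using component[OF hc_state[OF j]] inner_state_h[OF _ j hc_in[OF j], of 1]
    by (cases "j = 1") (auto simp: s_def E_def \<theta>_def)
  have "inner (F ?v) ?w = - (\<Sum>j=1..N. inner (hc j) ?v * inner (fc j) ?w)"
    unfolding feedback_def inner_minus_left inner_sum_left inner_scaleR_left
  proof (intro arg_cong[where f = uminus] sum.cong refl)
    fix j assume "j \<in> {1..N}"
    then have "hc j \<in> L2_on \<omega>1" by (intro hc_in) simp
    moreover have "ind_op \<omega>1 ?v = ?v" by (intro ind_op_L2_on ind_op_in_L2_on subset_sets) simp_all
    ultimately have "inner (ind_op \<omega>1 ?v) (ind_op \<omega>1 (hc j)) = inner (hc j) ?v"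
      by (simp add: ind_op_L2_on subset_sets inner_commute)
    then show "inner (ind_op \<omega>1 ?v) (ind_op \<omega>1 (hc j)) * inner (fc j) ?w = inner (hc j) ?v * inner (fc j) ?w" by simp
  qed
  then have "- (\<theta> * \<kappa> * inner (F ?v) ?w) = (\<Sum>j=1..N. (\<theta> * inner (hc j) ?v) * (\<kappa> * inner (fc j) ?w))"
    by (simp add: sum_distrib_left mult_ac)
  also have "\<dots> = (s 1 - E) * (r 1 - E) + (\<Sum>j\<in>{1..N} - {1}. s j * r j)"
    using N_ge_1 by (subst sum.remove[of _ 1]) (auto simp: s_def r_def)
  also have "\<dots> \<ge> 7 / 9 * E\<^sup>2"
  proof -
    have \<epsilon>9: "\<epsilon> \<le> 1 / 9"
    proof (rule power2_le_imp_le)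
      have "1 * \<epsilon>\<^sup>2 \<le> real N * \<epsilon>\<^sup>2" using N_ge_1 by (intro mult_right_mono) auto
      then show "\<epsilon>\<^sup>2 \<le> (1 / 9)\<^sup>2" using N_eps_le by (simp add: power_divide)
    qed simp
    have "(8 / 9 * E) * (8 / 9 * E) \<le> (E - s 1) * (E - r 1)"
      using r[of 1] s[of 1] \<epsilon>9 E by (intro mult_mono) auto
    moreover have "- (\<Sum>j\<in>{1..N} - {1}. s j * r j) \<le> (\<Sum>j\<in>{1..N} - {1}. \<epsilon> * \<epsilon>)"
      unfolding sum_negf[symmetric]
    proof (rule sum_mono)
      fix j assume "j \<in> {1..N} - {1}"
      then have "\<bar>s j * r j\<bar> \<le> \<epsilon> * \<epsilon>" unfolding abs_mult by (intro mult_mono s r eps_nonneg) auto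
      then show "- (s j * r j) \<le> \<epsilon> * \<epsilon>" by linarith
    qed
    moreover have "(\<Sum>j\<in>{1..N} - {1}. \<epsilon> * \<epsilon>) \<le> (\<Sum>j=1..N. \<epsilon> * \<epsilon>)"
      by (intro sum_mono2) auto
    moreover have "(\<Sum>j=1..N. \<epsilon> * \<epsilon>) = real N * \<epsilon>\<^sup>2" by (simp add: power2_eq_square)
    moreover have "1 \<le> E\<^sup>2" using E by simp
    moreover have "(8 / 9 * E) * (8 / 9 * E) = 64 / 81 * E\<^sup>2" by (simp add: power2_eq_square)
    moreover have "(E - s 1) * (E - r 1) = (s 1 - E) * (r 1 - E)" by (simp add: algebra_simps)
    ultimately show ?thesis using N_eps_le by linarith
  qed
  finally have main: "7 / 9 * E\<^sup>2 \<le> - (\<theta> * \<kappa> * inner (F ?v) ?w)" .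
  have "lower_profile = 7 / 9 * E\<^sup>2 / (\<theta> * \<kappa>)"
  proof -
    have "E\<^sup>2 / \<theta> = exp (- (3 / 4 * lam 1 * T))"
      by (simp add: E_def \<theta>_def power2_eq_square flip: exp_add exp_diff)
    then have "7 / 9 * exp (- (3 / 4 * lam 1 * T)) / \<kappa> = 7 / 9 * (E\<^sup>2 / \<theta>) / \<kappa>" by simp
    then show ?thesis by (simp add: lower_profile_def \<kappa>_def)
  qed
  also have "\<dots> \<le> - inner (F ?v) ?w"
    using main \<theta> \<kappa> by (simp add: pos_divide_le_eq mult_ac)
  also have "\<dots> \<le> norm (F ?v) * norm ?w"
    using Cauchy_Schwarz_ineq2[of "F ?v" ?w] by linarith
  also have "\<dots> \<le> norm (F ?v) * 1"
    using norm_ind_op_le[of \<omega> "\<xi> 1"] subset_sets by (intro mult_left_mono) auto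
  finally have le: "lower_profile \<le> norm (F ?v)" by simp
  have v1: "norm ?v \<le> 1" using norm_ind_op_le[of \<omega>1 "\<xi> 1"] subset_sets by auto
  have "lower_profile > 0" using \<kappa> by (simp add: lower_profile_def \<kappa>_def)
  then have "norm (F ?v) > 0" using le by linarith
  then have v0: "norm ?v > 0" using norm_feedback_le[of ?v] by (cases "norm ?v = 0") auto
  have "norm (F ?v) \<le> norm (F ?v) / norm ?v"
    using v0 v1 mult_left_mono[OF v1, of "norm (F ?v)"] by (simp add: pos_le_divide_eq)
  also have "\<dots> \<le> onorm_on (L2_on \<omega>1) F"
    by (intro feedback_quotient_le_onorm ind_op_in_L2_on subset_sets) auto
  finally show ?thesis using le by linarith
qed

end

section \<open>Uniform constants and growth rates\<close>

context controlled_schroedinger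
begin

text \<open>
  With $q = (1 + 1/T)(1 + \gamma)$ all of $1$, $1/T$ and $\gamma$ are at most $q$. Hence
  $\sqrt{\lambda_M}$, which is controlled by the threshold, is at most a constant times $q$, provided
  that $\ln N$ is; and each factor of the bound becomes $e^{\mathrm{const} \cdot q}$, apart from
  $e^{\gamma_0 T / 4}$.
\<close>

lemma feedback_bound_le:
  fixes a c :: real
  defines "q \<equiv> (1 + 1 / T) * (1 + \<gamma>)"
    and "p \<equiv> 1 + \<gamma>0 powr (2/3)"
  defines "b \<equiv> (C0/2)\<^sup>2 + 2 * (ln 9 + a / 2 + C0/2 * p) + 4 + 3 * \<gamma>0"
  assumes a: "a \<ge> 0" "real N \<le> exp (a * q)" and c: "c_hat lam \<gamma>0 \<le> c"
  shows "feedback_bound \<le> exp (\<gamma>0 * T / 4 + (a + C0 * (p + C0/2 + sqrt b + sqrt c) + (2 + \<gamma>0)) * q)"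
proof -
  have g: "\<gamma>0 > 0" by (rule \<gamma>0_pos)
  have "q = 1 + 1 / T + \<gamma> + \<gamma> / T" by (simp add: q_def algebra_simps add_divide_distrib)
  moreover have "1 / T > 0" "\<gamma> / T > 0" using T \<gamma> by auto
  ultimately have q: "1 \<le> q" "1 / T \<le> q" "\<gamma> \<le> q" using \<gamma> by linarith+
  have qq: "q \<le> q * q" using q mult_left_mono[of 1 q q] by simp
  have q2: "1 \<le> q * q" using q(1) qq by linarith
  have p: "p \<ge> 1" by (simp add: p_def)
  have c0: "c \<ge> 0" using c c_hat_nonneg by linarith
  define R where "R = (C0/2)\<^sup>2 + 2 * T * (ln (9 * sqrt (real N)) + C0/2 * p) + (4 * \<gamma> + 3 * \<gamma>0) * T\<^sup>2"
  have "R \<ge> 0"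
    using C0_pos T \<gamma> g ln_N_nonneg p by (auto simp: R_def intro!: add_nonneg_nonneg mult_nonneg_nonneg)
  have lnN: "ln (9 * sqrt (real N)) \<le> ln 9 + a / 2 * q"
  proof -
    have "ln (real N) \<le> ln (exp (a * q))"
      using a(2) N_ge_1 by (subst ln_le_cancel_iff) auto
    then show ?thesis using N_ge_1 by (simp add: ln_mult ln_sqrt)
  qed
  have "R / T\<^sup>2 = (C0/2)\<^sup>2 * (1 / T * (1 / T)) + 2 * (1 / T * (ln (9 * sqrt (real N)) + C0/2 * p)) + 4 * \<gamma> + 3 * \<gamma>0"
    using T by (simp add: R_def power2_eq_square add_divide_distrib)
  also have "\<dots> \<le> (C0/2)\<^sup>2 * (q * q) + 2 * (q * ((ln 9 + a / 2 + C0/2 * p) * q)) + 4 * (q * q) + 3 * \<gamma>0 * (q * q)"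
  proof -
    have "ln 9 \<le> ln 9 * q" "C0/2 * p \<le> C0/2 * p * q"
      using q C0_pos p mult_left_mono[of 1 q "ln 9"] mult_left_mono[of 1 q "C0/2 * p"] by auto
    then have "ln (9 * sqrt (real N)) + C0/2 * p \<le> (ln 9 + a / 2 + C0/2 * p) * q"
      using lnN unfolding distrib_right by linarith
    then have "1 / T * (ln (9 * sqrt (real N)) + C0/2 * p) \<le> q * ((ln 9 + a / 2 + C0/2 * p) * q)"
      using q T ln_N_nonneg C0_pos p by (intro mult_mono) auto
    moreover have "(C0/2)\<^sup>2 * (1 / T * (1 / T)) \<le> (C0/2)\<^sup>2 * (q * q)"
      using q T by (intro mult_left_mono mult_mono) auto
    moreover have "4 * \<gamma> \<le> 4 * (q * q)" using q qq by linarith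
    moreover have "3 * \<gamma>0 \<le> 3 * \<gamma>0 * (q * q)" using mult_left_mono[OF q2, of "3 * \<gamma>0"] g by simp
    ultimately show ?thesis by linarith
  qed
  also have "\<dots> = b * q\<^sup>2" by (simp add: b_def power2_eq_square algebra_simps)
  finally have "sqrt (R / T\<^sup>2) \<le> sqrt (b * q\<^sup>2)" by simp
  then have R: "sqrt R / T \<le> sqrt b * q" using T q by (simp add: real_sqrt_divide real_sqrt_mult)
  have "sqrt (lam M) \<le> sqrt (((C0/2 + sqrt R) / T)\<^sup>2 + c_hat lam \<gamma>0)"
    using lam_M by (simp add: C_threshold_def Let_def R_def p_def)
  also have "\<dots> \<le> sqrt (((C0/2 + sqrt R) / T)\<^sup>2) + sqrt (c_hat lam \<gamma>0)"
    using c_hat_nonneg by (intro sqrt_add_le_add_sqrt) auto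
  also have "sqrt (((C0/2 + sqrt R) / T)\<^sup>2) = C0/2 * (1 / T) + sqrt R / T"
    using C0_pos T \<open>R \<ge> 0\<close> by (simp add: add_divide_distrib)
  also have "\<dots> + sqrt (c_hat lam \<gamma>0) \<le> C0/2 * q + sqrt b * q + sqrt c * q"
  proof (intro add_mono R mult_left_mono q)
    have "sqrt (c_hat lam \<gamma>0) \<le> sqrt c * 1" using c by simp
    also have "\<dots> \<le> sqrt c * q" using q c0 by (intro mult_left_mono) auto
    finally show "sqrt (c_hat lam \<gamma>0) \<le> sqrt c * q" .
  qed (use C0_pos in auto)
  finally have "sqrt (lam M) \<le> (C0/2 + sqrt b + sqrt c) * q" by (simp add: algebra_simps)
  moreover have "p \<le> p * q" using p q by (simp add: mult_le_cancel_left1)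
  ultimately have "p + sqrt (lam M) \<le> (p + C0/2 + sqrt b + sqrt c) * q" by (simp add: algebra_simps)
  then have "spectral_bound \<le> exp (C0 * ((p + C0/2 + sqrt b + sqrt c) * q))"
    unfolding spectral_bound_def p_def using C0_pos by (simp add: mult_left_mono)
  moreover have "2 / T + \<gamma>0 \<le> exp ((2 + \<gamma>0) * q)"
  proof -
    have "2 / T + \<gamma>0 * 1 \<le> 2 * q + \<gamma>0 * q" using q g by (intro add_mono mult_left_mono) auto
    also have "\<dots> \<le> exp ((2 + \<gamma>0) * q)"
      using exp_ge_add_one_self[of "(2 + \<gamma>0) * q"] unfolding distrib_right by linarith
    finally show ?thesis by simp
  qed
  ultimately have "feedback_bound \<le> exp (a * q) * (exp (C0 * ((p + C0/2 + sqrt b + sqrt c) * q)) * exp ((2 + \<gamma>0) * q) * exp (\<gamma>0 * T / 4))"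
    unfolding feedback_bound_def using T g spectral_bound_pos by (intro mult_mono a(2)) auto
  also have "\<dots> = exp (\<gamma>0 * T / 4 + (a + C0 * (p + C0/2 + sqrt b + sqrt c) + (2 + \<gamma>0)) * q)"
    unfolding exp_add[symmetric] by (rule arg_cong[where f = exp]) (simp add: algebra_simps)
  finally show ?thesis .
qed

lemma N_index_exp_bound:
  fixes a :: real
  defines "a \<equiv> 8 * measure lborel \<Omega> + 4 * (real DIM('a))\<^sup>2 * (3 + ln 9 + \<gamma>0)"
  shows "real N \<le> exp (a * ((1 + 1 / T) * (1 + \<gamma>)))"
proof -
  let ?q = "(1 + 1 / T) * (1 + \<gamma>)" and ?W = "measure lborel \<Omega>" and ?\<beta> = "4 * (real DIM('a))\<^sup>2"
  have "?q = 1 + 1 / T + \<gamma> + \<gamma> / T" by (simp add: algebra_simps add_divide_distrib)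
  moreover have "1 / T > 0" "\<gamma> / T > 0" using T \<gamma> by auto
  ultimately have q: "1 \<le> ?q" "1 / T \<le> ?q" "\<gamma> \<le> ?q" using \<gamma> by linarith+
  have "real N \<le> 8 * ?W * exp (?\<beta> * (2 * \<gamma> + ln 9 / T + \<gamma>0 + 1))"
    by (rule counting_bound[OF N_ge_1 less_imp_le[OF lam_N]])
  also have "8 * ?W * exp (?\<beta> * (2 * \<gamma> + ln 9 / T + \<gamma>0 + 1)) \<le> exp (8 * ?W) * exp (?\<beta> * (2 * \<gamma> + ln 9 / T + \<gamma>0 + 1))"
  proof (rule mult_right_mono)
    show "8 * ?W \<le> exp (8 * ?W)" using exp_ge_add_one_self[of "8 * ?W"] by linarith
  qed simp
  also have "\<dots> = exp (8 * ?W * 1 + ?\<beta> * (2 * \<gamma> + ln 9 * (1 / T) + \<gamma>0 * 1 + 1))" by (simp add: exp_add)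
  also have "\<dots> \<le> exp (8 * ?W * ?q + ?\<beta> * (2 * ?q + ln 9 * ?q + \<gamma>0 * ?q + ?q))"
    unfolding exp_le_cancel_iff using q \<gamma>0_pos by (intro add_mono mult_left_mono) auto
  also have "8 * ?W * ?q + ?\<beta> * (2 * ?q + ln 9 * ?q + \<gamma>0 * ?q + ?q) = a * ?q"
    by (simp add: a_def algebra_simps add_divide_distrib)
  finally show ?thesis .
qed

end

lemma bigtheta_if_between:
  fixes f g :: "real \<Rightarrow> real"
  assumes "c > 0" "\<forall>\<^sub>F x in F. 0 \<le> g x \<and> c * g x \<le> f x \<and> f x \<le> c' * g x"
  shows "f \<in> \<Theta>[F](g)"
proof (rule bigthetaI)
  show "f \<in> O[F](g)"
  proof (rule bigoI)
    show "\<forall>\<^sub>F x in F. norm (f x) \<le> c' * norm (g x)"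
      using assms(2)
    proof eventually_elim
      case (elim x)
      then have "0 \<le> c * g x" using assms(1) by simp
      then have "0 \<le> f x" using elim by linarith
      then show ?case using elim by simp
    qed
  qed
  have "g \<in> O[F](f)"
  proof (rule bigoI)
    show "\<forall>\<^sub>F x in F. norm (g x) \<le> 1 / c * norm (f x)"
      using assms(2)
    proof eventually_elim
      case (elim x)
      then have "c * g x \<le> \<bar>f x\<bar>" by linarith
      then show ?case using elim assms(1) by (simp add: field_simps)
    qed
  qed
  then show "f \<in> \<Omega>[F](g)" by (simp add: bigomega_iff_bigo)
qed

text \<open>The lower bound for the norm of the feedback as a function of $T$, with $\mu = -\lambda_1$.\<close>

definition growth_profile :: "real \<Rightarrow> real \<Rightarrow> real" where
  "growth_profile \<mu> T = 7 / 9 * exp (3 / 4 * \<mu> * T) / ((exp (\<mu> * (T / 2)) - 1) / \<mu>)"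

lemma growth_profile_at_0:
  assumes \<mu>: "\<mu> > 0"
  shows "growth_profile \<mu> \<in> \<Theta>[at_right 0](\<lambda>T. 1 / T)"
proof (rule bigtheta_if_between)
  show "14 / 9 * exp (- \<mu>) > 0" by simp
  have "\<forall>\<^sub>F T in at_right 0. T \<in> {0<..<(1::real)}" by (rule eventually_at_right_real) simp
  then show "\<forall>\<^sub>F T in at_right 0. 0 \<le> 1 / T \<and> 14 / 9 * exp (- \<mu>) * (1 / T) \<le> growth_profile \<mu> T
      \<and> growth_profile \<mu> T \<le> 14 / 9 * exp \<mu> * (1 / T)"
  proof eventually_elim
    case (elim T)
    define x where "x = \<mu> * (T / 2)"
    have x: "0 < x" using \<mu> elim by (simp add: x_def)
    have T: "T = 2 * x / \<mu>" using \<mu> by (simp add: x_def)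
    have xm: "x \<le> \<mu>" "3 / 2 * x \<le> \<mu>" using \<mu> elim mult_left_mono[of T 1 \<mu>] by (auto simp: x_def)
    have low: "x \<le> exp x - 1" using exp_ge_add_one_self[of x] by linarith
    have "1 - x \<le> exp (- x)" using exp_ge_add_one_self[of "- x"] by simp
    then have "exp x * (1 - x) \<le> exp x * exp (- x)" by (intro mult_left_mono) auto
    then have up: "exp x - 1 \<le> x * exp x" by (simp add: algebra_simps flip: exp_add)
    have P: "growth_profile \<mu> T = 7 / 9 * \<mu> * exp (3 / 2 * x) / (exp x - 1)"
      by (simp add: growth_profile_def x_def)
    have oneT: "1 / T = \<mu> / (2 * x)" by (simp add: T)
    have "14 / 9 * exp (- \<mu>) * (1 / T) = 7 / 9 * \<mu> * exp (- \<mu>) / x" by (simp add: oneT)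
    also have "\<dots> \<le> 7 / 9 * \<mu> * exp (3 / 2 * x - x) / x"
      using \<mu> x by (intro divide_right_mono mult_left_mono) auto
    also have "\<dots> = 7 / 9 * \<mu> * exp (3 / 2 * x) / (x * exp x)"
      unfolding exp_diff by simp
    also have "\<dots> \<le> growth_profile \<mu> T"
      unfolding P using \<mu> x low up by (intro divide_left_mono mult_pos_pos) auto
    finally have 1: "14 / 9 * exp (- \<mu>) * (1 / T) \<le> growth_profile \<mu> T" .
    have "growth_profile \<mu> T \<le> 7 / 9 * \<mu> * exp (3 / 2 * x) / x"
      unfolding P using \<mu> x low by (intro divide_left_mono mult_pos_pos) auto
    also have "\<dots> \<le> 7 / 9 * \<mu> * exp \<mu> / x"
      using \<mu> x xm by (intro divide_right_mono mult_left_mono) auto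
    also have "\<dots> = 14 / 9 * exp \<mu> * (1 / T)" by (simp add: oneT)
    finally show ?case using 1 elim by simp
  qed
qed

lemma growth_profile_at_top:
  assumes \<mu>: "\<mu> > 0"
  shows "growth_profile \<mu> \<in> \<Theta>[at_top](\<lambda>T. exp (\<mu> * T / 4))"
proof (rule bigtheta_if_between)
  show "7 / 9 * \<mu> > 0" using \<mu> by simp
  have "\<forall>\<^sub>F T in at_top. T \<ge> 2 / \<mu>" by (rule eventually_ge_at_top)
  then show "\<forall>\<^sub>F T in at_top. 0 \<le> exp (\<mu> * T / 4) \<and> 7 / 9 * \<mu> * exp (\<mu> * T / 4) \<le> growth_profile \<mu> T
      \<and> growth_profile \<mu> T \<le> 14 / 9 * \<mu> * exp (\<mu> * T / 4)"
  proof eventually_elim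
    case (elim T)
    define x where "x = \<mu> * (T / 2)"
    have "x \<ge> 1" using elim \<mu> by (simp add: x_def field_simps)
    then have e: "exp x \<ge> 2" using exp_ge_add_one_self[of x] by linarith
    have "exp (3 / 4 * \<mu> * T) = exp (\<mu> * T / 4) * exp x"
      by (simp add: x_def flip: exp_add)
    then have P: "growth_profile \<mu> T = 7 / 9 * \<mu> * exp (\<mu> * T / 4) * (exp x / (exp x - 1))"
      by (simp add: growth_profile_def x_def)
    have "exp x - 1 > 0" using e by linarith
    then have "1 \<le> exp x / (exp x - 1)" and "exp x / (exp x - 1) \<le> 2"
      using e by (auto simp: le_divide_eq_1_pos pos_divide_le_eq)
    moreover have "7 / 9 * \<mu> * exp (\<mu> * T / 4) \<ge> 0" using \<mu> by simp
    ultimately show ?case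
      unfolding P
      using mult_left_mono[of 1 "exp x / (exp x - 1)" "7 / 9 * \<mu> * exp (\<mu> * T / 4)"]
        mult_left_mono[of "exp x / (exp x - 1)" 2 "7 / 9 * \<mu> * exp (\<mu> * T / 4)"] by simp
  qed
qed

theorem theorem4p2:
  fixes \<Omega> \<omega> \<omega>1 :: "'a::euclidean_space set" and C0 \<gamma>0 :: real
  assumes "bounded_C2_domain \<Omega>"
    and "open \<omega>" "\<omega> \<noteq> {}" "\<omega> \<subseteq> \<Omega>"
    and "open \<omega>1" "\<omega>1 \<noteq> {}" "\<omega>1 \<subseteq> \<Omega>"
    and "spectral_constant \<Omega> \<omega> \<omega>1 C0"
  shows "\<exists>C1>0. \<exists>C2>0. \<forall>V lam \<xi> S.
     standing_assumptions \<Omega> V lam \<xi> \<and> Linf_norm \<Omega> V = \<gamma>0 \<and>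
     generates_semigroup (L2_on \<Omega>) (dom_A \<Omega>) (op_A \<Omega> V) S \<longrightarrow>
     (\<forall>\<gamma>>0. \<exists>\<alpha> :: real \<Rightarrow> real.
        (\<forall>T>0. 0 < \<alpha> T \<and>
           \<alpha> T \<le> onorm_on (L2_on \<omega>1) (feedback \<omega> \<omega>1 lam \<xi> S \<gamma>0 C0 \<gamma> T) \<and>
           onorm_on (L2_on \<omega>1) (feedback \<omega> \<omega>1 lam \<xi> S \<gamma>0 C0 \<gamma> T)
             \<le> exp (C1 * (1 + 1 / T) + \<gamma>0 * T / 4) * exp (C2 * (1 + 1 / T) * \<gamma>)) \<and>
        \<alpha> \<in> \<Theta>[at_right 0](\<lambda>T. 1 / T) \<and>
        \<alpha> \<in> \<Theta>[at_top](\<lambda>T. exp (- (lam 1 * T / 4))))"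
proof (cases "\<exists>V lam \<xi>. standing_assumptions \<Omega> V lam \<xi> \<and> Linf_norm \<Omega> V = \<gamma>0")
  \<comment> \<open>The constants are taken from one reference system; without any system there is nothing to bound.\<close>
  case False
  then show ?thesis by (intro exI[of _ "1::real"] conjI zero_less_one) blast
next
  case True
  then obtain V' lam' \<xi>' where ref: "schroedinger \<Omega> V' lam' \<xi>' \<gamma>0"
    using assms(1) by (auto simp: schroedinger_def)
  let ?W = "measure lborel \<Omega>" and ?\<beta> = "4 * (real DIM('a))\<^sup>2"
  \<comment> \<open>\<open>K\<close> exceeds the number of nonpositive eigenvalues of every potential with norm \<open>\<gamma>0\<close>.\<close>
  define K where "K = nat \<lceil>8 * ?W * exp (?\<beta> * (0 + \<gamma>0 + 1))\<rceil> + 1"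
  define c where "c = max 0 (real K * (lam' K + 3 * \<gamma>0))"
  define a where "a = 8 * ?W + ?\<beta> * (3 + ln 9 + \<gamma>0)"
  define p where "p = 1 + \<gamma>0 powr (2/3)"
  define b where "b = (C0/2)\<^sup>2 + 2 * (ln 9 + a / 2 + C0/2 * p) + 4 + 3 * \<gamma>0"
  define C where "C = a + C0 * (p + C0/2 + sqrt b + sqrt c) + (2 + \<gamma>0)"
  have g: "\<gamma>0 > 0" by (rule schroedinger.\<gamma>0_pos[OF ref])
  have C0: "C0 > 0" using assms(8) by (simp add: spectral_constant_def)
  have a: "a \<ge> 0" using g by (simp add: a_def add_nonneg_nonneg)
  have p: "p \<ge> 1" by (simp add: p_def)
  have b: "b \<ge> 0" using a p C0 g by (auto simp: b_def intro!: add_nonneg_nonneg mult_nonneg_nonneg)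
  have c: "c \<ge> 0" by (simp add: c_def)
  have C: "C > 0" unfolding C_def using a C0 p b c g
    by (intro add_nonneg_pos add_nonneg_nonneg mult_nonneg_nonneg) auto
  have main: "\<exists>\<alpha> :: real \<Rightarrow> real.
        (\<forall>T>0. 0 < \<alpha> T \<and>
           \<alpha> T \<le> onorm_on (L2_on \<omega>1) (feedback \<omega> \<omega>1 lam \<xi> S \<gamma>0 C0 \<gamma> T) \<and>
           onorm_on (L2_on \<omega>1) (feedback \<omega> \<omega>1 lam \<xi> S \<gamma>0 C0 \<gamma> T)
             \<le> exp (C * (1 + 1 / T) + \<gamma>0 * T / 4) * exp (C * (1 + 1 / T) * \<gamma>)) \<and>
        \<alpha> \<in> \<Theta>[at_right 0](\<lambda>T. 1 / T) \<and>
        \<alpha> \<in> \<Theta>[at_top](\<lambda>T. exp (- (lam 1 * T / 4)))"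
    if st: "standing_assumptions \<Omega> V lam \<xi>" and V: "Linf_norm \<Omega> V = \<gamma>0"
      and S: "generates_semigroup (L2_on \<Omega>) (dom_A \<Omega>) (op_A \<Omega> V) S" and \<gamma>: "\<gamma> > 0" for V lam \<xi> S \<gamma>
  proof -
    have sch: "schroedinger \<Omega> V lam \<xi> \<gamma>0" using assms(1) st V by (simp add: schroedinger_def)
    interpret schroedinger_semigroup \<Omega> V lam \<xi> \<gamma>0 S
      using sch S by (simp add: schroedinger_semigroup_def schroedinger_semigroup_axioms_def)
    define \<mu> where "\<mu> = - lam 1"
    have \<mu>: "\<mu> > 0" using lam_1_neg by (simp add: \<mu>_def)
    define \<alpha> where "\<alpha> = growth_profile \<mu>"
    have "real (nonpos_count lam) \<le> 8 * ?W * exp (?\<beta> * (0 + \<gamma>0 + 1))"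
      by (rule counting_bound[OF nonpos_count_ge_1 lam_nonpos_count])
    then have "nonpos_count lam < K" unfolding K_def by linarith
    from first_positive_eigenvalue_bound[OF sch ref this]
    have c_hat: "c_hat lam \<gamma>0 \<le> c" using g by (auto simp: c_hat_def c_def)
    have "0 < \<alpha> T \<and>
           \<alpha> T \<le> onorm_on (L2_on \<omega>1) (feedback \<omega> \<omega>1 lam \<xi> S \<gamma>0 C0 \<gamma> T) \<and>
           onorm_on (L2_on \<omega>1) (feedback \<omega> \<omega>1 lam \<xi> S \<gamma>0 C0 \<gamma> T)
             \<le> exp (C * (1 + 1 / T) + \<gamma>0 * T / 4) * exp (C * (1 + 1 / T) * \<gamma>)" if T: "T > 0" for T
    proof (intro conjI)
      interpret controlled_schroedinger \<Omega> V lam \<xi> \<gamma>0 S \<omega> \<omega>1 C0 \<gamma> T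
        by unfold_locales (use assms \<gamma> T in auto)
      show "0 < \<alpha> T" using \<mu> T by (simp add: \<alpha>_def growth_profile_def)
      have "duhamel_weight (lam 1) (T / 2) = (exp (\<mu> * (T / 2)) - 1) / \<mu>"
        using \<mu> by (simp add: duhamel_weight_def \<mu>_def divide_simps)
      then have "\<alpha> T = lower_profile" by (simp add: lower_profile_def \<alpha>_def growth_profile_def \<mu>_def)
      then show "\<alpha> T \<le> onorm_on (L2_on \<omega>1) (feedback \<omega> \<omega>1 lam \<xi> S \<gamma>0 C0 \<gamma> T)"
        using lower_profile_le_onorm by simp
      have "onorm_on (L2_on \<omega>1) (feedback \<omega> \<omega>1 lam \<xi> S \<gamma>0 C0 \<gamma> T) \<le> feedback_bound"
        by (rule onorm_feedback_le)
      also have "\<dots> \<le> exp (\<gamma>0 * T / 4 + C * ((1 + 1 / T) * (1 + \<gamma>)))"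
        using feedback_bound_le[OF a _ c_hat] N_index_exp_bound unfolding C_def b_def p_def a_def by simp
      also have "\<dots> = exp (C * (1 + 1 / T) + \<gamma>0 * T / 4) * exp (C * (1 + 1 / T) * \<gamma>)"
        unfolding exp_add[symmetric] by (rule arg_cong[where f = exp]) (simp add: algebra_simps add_divide_distrib)
      finally show "onorm_on (L2_on \<omega>1) (feedback \<omega> \<omega>1 lam \<xi> S \<gamma>0 C0 \<gamma> T)
             \<le> exp (C * (1 + 1 / T) + \<gamma>0 * T / 4) * exp (C * (1 + 1 / T) * \<gamma>)" .
    qed
    moreover have "\<alpha> \<in> \<Theta>[at_right 0](\<lambda>T. 1 / T)"
      unfolding \<alpha>_def by (rule growth_profile_at_0[OF \<mu>])
    moreover have "\<alpha> \<in> \<Theta>[at_top](\<lambda>T. exp (- (lam 1 * T / 4)))"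
      using growth_profile_at_top[OF \<mu>] unfolding \<alpha>_def by (simp add: \<mu>_def)
    ultimately show ?thesis by blast
  qed
  show ?thesis
    by (rule exI[of _ C], rule conjI[OF C], rule exI[of _ C], rule conjI[OF C], intro allI impI,
        elim conjE, rule main)
qed

end
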